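(* Let $a_{22},a_{50},b_{13},b_{41}$ be real numbers and consider the planar system $$\frac{dx}{dt}=-2y^3+a_{22}x^2y^2+a_{50}x^5,\qquad \frac{dy}{dt}=3x^5+b_{13}xy^3+b_{41}x^4y .$$ The origin of this system is a center if and only if one of the following conditions holds: $$C_1:\ a_{50}=-\tfrac15 b_{41},\ a_{22}=-\tfrac32 b_{13};\qquad\qquad C_2:\ a_{50}=-\tfrac15 b_{41},\ b_{41}=0 .$$
   Context: The origin is called a center if it has a neighborhood in which every orbit other than the origin is a closed (periodic) orbit surrounding the origin. *)

theory Defs
  imports "HOL-Analysis.Analysis"
begin

definition solution_on ::
    "('a::real_normed_vector \<Rightarrow> 'a) \<Rightarrow> real set \<Rightarrow> (real \<Rightarrow> 'a) \<Rightarrow> bool" where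
  "solution_on F I z \<longleftrightarrow> (\<forall>t\<in>I. (z has_vector_derivative F (z t)) (at t))"

text \<open>The full (two-sided) orbit is obtained as the union of the arcs traced by all solutions
  through \<open>p\<close> on open intervals. If \<open>F\<close> is locally Lipschitz, this is the image of the
  unique maximal solution through \<open>p\<close>.\<close>

definition orbit :: "('a::real_normed_vector \<Rightarrow> 'a) \<Rightarrow> 'a \<Rightarrow> 'a set" where
  "orbit F p =
     \<Union>{z ` I | z I. open I \<and> is_interval I \<and> 0 \<in> I \<and> solution_on F I z \<and> z 0 = p}"

definition closed_orbit :: "('a::real_normed_vector \<Rightarrow> 'a) \<Rightarrow> 'a set \<Rightarrow> bool" where
  "closed_orbit F \<gamma> \<longleftrightarrow>
     (\<exists>z T. solution_on F UNIV z \<and> T > 0 \<and> (\<forall>t. z (t + T) = z t) \<and> (\<exists>t. z t \<noteq> z 0) \<and>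
            \<gamma> = range z)"

text \<open>A set surrounds the origin if the origin lies in a bounded component of its complement.
  The neighbourhood \<open>U\<close> need not be open and is required to contain the orbits of its points;
  since the union of all orbits meeting \<open>U\<close> is again a neighbourhood, this requirement does not
  change the notion.\<close>

definition center_at_origin :: "(real \<times> real \<Rightarrow> real \<times> real) \<Rightarrow> bool" where
  "center_at_origin F \<longleftrightarrow>
     (\<exists>U. 0 \<in> interior U \<and>
          (\<forall>p \<in> U - {0}. orbit F p \<subseteq> U \<and> closed_orbit F (orbit F p) \<and> 0 \<in> inside (orbit F p)))"

definition planar_field ::
    "real \<Rightarrow> real \<Rightarrow> real \<Rightarrow> real \<Rightarrow> real \<times> real \<Rightarrow> real \<times> real" where
  "planar_field a22 a50 b13 b41 = (\<lambda>(x, y).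
     (- 2 * y ^ 3 + a22 * x ^ 2 * y ^ 2 + a50 * x ^ 5,
      3 * x ^ 5 + b13 * x * y ^ 3 + b41 * x ^ 4 * y))"

end

theory Submission
  imports Defs
begin

text \<open>
  In quasi-polar coordinates \<open>x = r\<^sup>2 C(\<phi>)\<close>, \<open>y = r\<^sup>3 S(\<phi>)\<close> with \<open>C\<^sup>6 + S\<^sup>4 = 1\<close> the leading part of
  the system becomes a rotation and the orbits near the origin are the solutions of
  \<open>dr/d\<theta> = r\<^sup>2 P / (1 + r Q)\<close>, where \<open>d\<theta>\<close> is the time of the leading part.

  Necessity: functions \<open>1/r + \<Sum> G\<^sub>k r\<^sup>k\<close> with periodic \<open>G\<^sub>k\<close> are constructed whose derivative is
  \<open>V r\<^sup>n\<close> up to higher order. If \<open>V \<noteq> 0\<close> there are no periodic orbits near the origin. The order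
  \<open>n = 0\<close> gives \<open>a50 = - b41 / 5\<close>. Then \<open>P = - Q' / 13 + \<delta> C S\<^sup>2\<close> with \<open>Q = \<beta> C\<^sup>2 S\<^sup>3 + B C\<^sup>5 S\<close>, and
  the order \<open>n = 2\<close> gives \<open>\<delta> B (3 \<delta> / 14 - 27 \<beta> / 13) = 0\<close>. On the remaining line
  \<open>\<delta> = 126 \<beta> / 13\<close>, that is \<open>5 a22 = 3 b13\<close>, the part of the coefficient of order \<open>n = 4\<close> that is
  linear in \<open>B\<close> is an exact derivative, and the part cubic in \<open>B\<close> has a sign.

  Sufficiency: in the first case (\<open>\<delta> = 0\<close>) the system is Hamiltonian, in the second (\<open>a50 = b41 = 0\<close>)
  it is reversible under \<open>\<phi> \<mapsto> \<pi> - \<phi>\<close>. Both yield a periodic solution \<open>r(\<phi>)\<close> through every point near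
  the origin.
\<close>

section \<open>Generalized trigonometric functions\<close>

text \<open>The divergence of the field is (2 a22 + 3 b13) x y^2 + (5 a50 + b41) x^4. Order 0
  detects its x^4 term. Once that term vanishes, P splits into a Hamiltonian part -Q'/13 and a
  divergence part \<delta> C S^2, where 13 is the weighted degree of the perturbing Hamiltonian.
  Integration by parts then turns each later coefficient into the mean of a multiple of \<delta> C
  S^2. Orders 1 and 3 have mean zero because their integrands are odd in \<phi>. At even orders the
  reflection pi - \<phi> amounts to a change of sign of B, so only odd powers of B survive; hence
  the factor B at order 2 and the linear and cubic terms at order 4. The iterated primitives
  entering there are kept as abstract functions, so the last mean is not evaluated: an inequality
  for one primitive gives its sign. For sufficiency, a closed curve given by a periodic r(\<phi>)
  must be shown to be a full orbit around the origin. The signed radial distance to the curve does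
  both: a Gronwall estimate for it shows that no solution leaves the curve, and its sign separates
  inside from outside.\<close>

lemma gauge_unique:
  fixes c s w v :: real
  assumes "c^2 + s^2 = 1" "w > 0" "v > 0" "w^3 * c^6 + w^2 * s^4 = 1" "v^3 * c^6 + v^2 * s^4 = 1"
  shows "w = v"
proof -
  have *: "a^3 * c^6 + a^2 * s^4 < b^3 * c^6 + b^2 * s^4" if "0 < a" "a < b" for a b :: real
  proof (cases "c = 0")
    case True
    with assms(1) have "s^4 > 0" by auto
    then show ?thesis using True that by (simp add: power_strict_mono)
  next
    case False
    have "a^2 * s^4 \<le> b^2 * s^4" using that by (intro mult_right_mono power_mono) auto
    moreover have "a^3 * c^6 < b^3 * c^6" using that False
      by (intro mult_strict_right_mono power_strict_mono) auto
    ultimately show ?thesis by linarith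
  qed
  show ?thesis using *[of w v] *[of v w] assms by (cases w v rule: linorder_cases) auto
qed

text \<open>One of c^2 and s^2 is at least 1/2, so the expression is at least 1 at w = 2, and the
  intermediate value theorem applies on [0, 2].\<close>

lemma gauge_exists:
  fixes c s :: real
  assumes "c^2 + s^2 = 1"
  shows "\<exists>w>0. w^3 * c^6 + w^2 * s^4 = 1"
proof -
  have "c^2 \<ge> 1/2 \<or> s^2 \<ge> 1/2" using assms by linarith
  then have "8 * (c^2)^3 + 4 * (s^2)^2 \<ge> 1"
  proof
    assume "c^2 \<ge> 1/2"
    then have "(1/2)^3 \<le> (c^2)^3" by (intro power_mono) auto
    then have "1 \<le> 8 * (c^2)^3" by (simp add: power3_eq_cube)
    then show ?thesis by (smt (verit) zero_le_power2)
  next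
    assume "s^2 \<ge> 1/2"
    then have "(1/2)^2 \<le> (s^2)^2" by (intro power_mono) auto
    then have "1 \<le> 4 * (s^2)^2" by (simp add: power2_eq_square)
    moreover have "0 \<le> (c^2)^3" by simp
    ultimately show ?thesis by linarith
  qed
  then have 2: "(2::real)^3 * c^6 + 2^2 * s^4 \<ge> 1" by (simp flip: power_mult)
  have "\<exists>w\<ge>0. w \<le> 2 \<and> w^3 * c^6 + w^2 * s^4 = 1"
    by (rule IVT') (use 2 in \<open>auto intro!: continuous_intros\<close>)
  then obtain w where w: "w \<ge> 0" "w^3 * c^6 + w^2 * s^4 = 1" by blast
  then have "w \<noteq> 0" by auto
  with w show ?thesis by (metis less_eq_real_def)
qed

text \<open>The square of the distance from the origin to the curve x^6 + y^4 = 1 along the ray of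
  angle \<phi>. With the ordinary polar angle as parameter the period is exactly 2 pi, and the
  reflections of the plane act by - \<phi> and pi - \<phi>.\<close>

definition gauge2 :: "real \<Rightarrow> real" where
  "gauge2 \<phi> = (SOME w. w > 0 \<and> w^3 * cos \<phi> ^ 6 + w^2 * sin \<phi> ^ 4 = 1)"

lemma gauge2: "gauge2 \<phi> > 0" "gauge2 \<phi> ^ 3 * cos \<phi> ^ 6 + gauge2 \<phi> ^ 2 * sin \<phi> ^ 4 = 1"
proof -
  have "\<exists>w. w > 0 \<and> w^3 * cos \<phi> ^ 6 + w^2 * sin \<phi> ^ 4 = 1"
    using gauge_exists[of "cos \<phi>" "sin \<phi>"] by auto
  then have "gauge2 \<phi> > 0 \<and> gauge2 \<phi> ^ 3 * cos \<phi> ^ 6 + gauge2 \<phi> ^ 2 * sin \<phi> ^ 4 = 1"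
    unfolding gauge2_def by (rule someI_ex)
  then show "gauge2 \<phi> > 0" "gauge2 \<phi> ^ 3 * cos \<phi> ^ 6 + gauge2 \<phi> ^ 2 * sin \<phi> ^ 4 = 1" by auto
qed

lemma gauge2_eqI:
  assumes "w > 0" "w^3 * cos \<phi> ^ 6 + w^2 * sin \<phi> ^ 4 = 1"
  shows "gauge2 \<phi> = w"
  by (rule gauge_unique[of "cos \<phi>" "sin \<phi>"]) (use assms gauge2 in auto)

lemma gauge2_symm [simp]:
  "gauge2 (\<phi> + 2 * pi) = gauge2 \<phi>" "gauge2 (- \<phi>) = gauge2 \<phi>" "gauge2 (pi - \<phi>) = gauge2 \<phi>"
  by (rule gauge2_eqI; use gauge2[of \<phi>] in \<open>simp add: cos_add sin_add cos_diff sin_diff\<close>)+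

text \<open>Divided difference in w, at fixed \<phi>, of the equation defining the gauge. Its
  positivity does the work of the implicit function theorem.\<close>

definition gauge_slope :: "real \<Rightarrow> real \<Rightarrow> real" where
  "gauge_slope \<phi>0 \<phi> = (gauge2 \<phi>^2 + gauge2 \<phi> * gauge2 \<phi>0 + gauge2 \<phi>0 ^2) * cos \<phi> ^ 6
     + (gauge2 \<phi> + gauge2 \<phi>0) * sin \<phi> ^ 4"

lemma gauge2_diff:
  "(gauge2 \<phi> - gauge2 \<phi>0) * gauge_slope \<phi>0 \<phi> =
     - (gauge2 \<phi>0 ^ 3 * (cos \<phi> ^ 6 - cos \<phi>0 ^ 6) + gauge2 \<phi>0 ^ 2 * (sin \<phi> ^ 4 - sin \<phi>0 ^ 4))"
  using gauge2(2)[of \<phi>] gauge2(2)[of \<phi>0] unfolding gauge_slope_def by algebra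

text \<open>The bound is free of \<open>gauge2 \<phi>\<close>, so it is available before continuity
  of the gauge is known.\<close>

lemma gauge_slope_ge: "gauge_slope \<phi>0 \<phi> \<ge> min (gauge2 \<phi>0 ^ 2) (gauge2 \<phi>0) * (cos \<phi> ^ 6 + sin \<phi> ^ 4)"
proof -
  let ?w = "gauge2 \<phi>0" and ?m = "min (gauge2 \<phi>0 ^ 2) (gauge2 \<phi>0)"
  have "?m * cos \<phi> ^ 6 \<le> (gauge2 \<phi>^2 + gauge2 \<phi> * ?w + ?w ^2) * cos \<phi> ^ 6"
    using gauge2(1)[of \<phi>] gauge2(1)[of \<phi>0] by (intro mult_right_mono) (auto simp: min_le_iff_disj)
  moreover have "?m * sin \<phi> ^ 4 \<le> (gauge2 \<phi> + ?w) * sin \<phi> ^ 4"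
    using gauge2(1)[of \<phi>] by (intro mult_right_mono) (auto simp: min_le_iff_disj)
  ultimately show ?thesis unfolding gauge_slope_def by (simp add: algebra_simps)
qed

lemma cos6_sin4_pos: "cos (\<phi>::real) ^ 6 + sin \<phi> ^ 4 > 0"
proof (cases "cos \<phi> = 0")
  case True
  then have "sin \<phi> \<noteq> 0" by (metis sin_cos_squared_add zero_neq_one add_0 zero_power2)
  then show ?thesis by (simp add: True)
next
  case False
  then have "cos \<phi> ^ 6 > 0" by (simp add: zero_less_power_eq)
  then show ?thesis by (smt (verit) zero_le_even_power even_numeral)
qed

lemma gauge_slope_pos: "gauge_slope \<phi>0 \<phi> > 0"
  using gauge_slope_ge[of \<phi>0 \<phi>] cos6_sin4_pos[of \<phi>] gauge2(1)[of \<phi>0]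
  by (smt (verit) mult_pos_pos zero_less_power)

lemma isCont_gauge2: "isCont gauge2 \<phi>0"
proof -
  let ?n = "\<lambda>\<phi>. - (gauge2 \<phi>0 ^ 3 * (cos \<phi> ^ 6 - cos \<phi>0 ^ 6) + gauge2 \<phi>0 ^ 2 * (sin \<phi> ^ 4 - sin \<phi>0 ^ 4))"
  let ?d = "\<lambda>\<phi>. min (gauge2 \<phi>0 ^ 2) (gauge2 \<phi>0) * (cos \<phi> ^ 6 + sin \<phi> ^ 4)"
  have dpos: "?d \<phi> > 0" for \<phi> using cos6_sin4_pos[of \<phi>] gauge2(1)[of \<phi>0] by simp
  have "isCont (\<lambda>\<phi>. ?n \<phi> / ?d \<phi>) \<phi>0" using dpos[of \<phi>0] by (intro continuous_intros) auto
  then have lim: "((\<lambda>\<phi>. \<bar>?n \<phi> / ?d \<phi>\<bar>) \<longlongrightarrow> 0) (at \<phi>0)"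
    unfolding isCont_def by (intro tendsto_rabs_zero) simp
  have "\<bar>gauge2 \<phi> - gauge2 \<phi>0\<bar> \<le> \<bar>?n \<phi> / ?d \<phi>\<bar>" for \<phi>
  proof -
    have "\<bar>gauge2 \<phi> - gauge2 \<phi>0\<bar> * ?d \<phi> \<le> \<bar>gauge2 \<phi> - gauge2 \<phi>0\<bar> * gauge_slope \<phi>0 \<phi>"
      by (intro mult_left_mono gauge_slope_ge) auto
    also have "\<dots> = \<bar>(gauge2 \<phi> - gauge2 \<phi>0) * gauge_slope \<phi>0 \<phi>\<bar>"
      using gauge_slope_pos[of \<phi>0 \<phi>] by (simp add: abs_mult)
    also have "\<dots> = \<bar>?n \<phi>\<bar>" by (simp only: gauge2_diff)
    finally have "\<bar>gauge2 \<phi> - gauge2 \<phi>0\<bar> * ?d \<phi> \<le> \<bar>?n \<phi>\<bar>" .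
    then have "\<bar>gauge2 \<phi> - gauge2 \<phi>0\<bar> \<le> \<bar>?n \<phi>\<bar> / ?d \<phi>"
      using dpos[of \<phi>] by (simp only: pos_le_divide_eq)
    also have "\<dots> = \<bar>?n \<phi> / ?d \<phi>\<bar>" using dpos[of \<phi>] by (simp only: abs_divide abs_of_pos)
    finally show ?thesis .
  qed
  then have ev: "\<forall>\<^sub>F \<phi> in at \<phi>0. norm (gauge2 \<phi> - gauge2 \<phi>0) \<le> \<bar>?n \<phi> / ?d \<phi>\<bar>"
    unfolding real_norm_def by (intro always_eventually allI)
  have "((\<lambda>\<phi>. gauge2 \<phi> - gauge2 \<phi>0) \<longlongrightarrow> 0) (at \<phi>0)"
    by (rule Lim_null_comparison[OF ev lim])
  then show ?thesis unfolding isCont_def by (simp add: LIM_zero_iff)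
qed

lemma gauge2_differentiable: "\<exists>D. (gauge2 has_real_derivative D) (at \<phi>0)"
proof -
  let ?g = "\<lambda>\<phi>. gauge2 \<phi>0 ^ 3 * cos \<phi> ^ 6 + gauge2 \<phi>0 ^ 2 * sin \<phi> ^ 4"
  have "\<exists>D. (?g has_real_derivative D) (at \<phi>0)" by (auto intro!: exI derivative_eq_intros)
  then obtain D where "(?g has_real_derivative D) (at \<phi>0)" by blast
  then have "((\<lambda>\<phi>. (?g \<phi> - ?g \<phi>0) / (\<phi> - \<phi>0)) \<longlongrightarrow> D) (at \<phi>0)"
    by (simp add: has_field_derivative_iff)
  moreover have "isCont (gauge_slope \<phi>0) \<phi>0"
    unfolding gauge_slope_def by (intro continuous_intros isCont_gauge2)
  then have "(gauge_slope \<phi>0 \<longlongrightarrow> gauge_slope \<phi>0 \<phi>0) (at \<phi>0)" by (simp add: isCont_def)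
  ultimately have "((\<lambda>\<phi>. - ((?g \<phi> - ?g \<phi>0) / (\<phi> - \<phi>0)) / gauge_slope \<phi>0 \<phi>) \<longlongrightarrow> - D / gauge_slope \<phi>0 \<phi>0) (at \<phi>0)"
    using gauge_slope_pos[of \<phi>0 \<phi>0] by (intro tendsto_intros) auto
  moreover have "- ((?g \<phi> - ?g \<phi>0) / (\<phi> - \<phi>0)) / gauge_slope \<phi>0 \<phi> = (gauge2 \<phi> - gauge2 \<phi>0) / (\<phi> - \<phi>0)" for \<phi>
  proof -
    have *: "gauge2 \<phi> - gauge2 \<phi>0 = - (?g \<phi> - ?g \<phi>0) / gauge_slope \<phi>0 \<phi>"
      using gauge2_diff[of \<phi> \<phi>0] gauge_slope_pos[of \<phi>0 \<phi>] by (simp add: field_simps)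
    have "- (a / x) / y = (- a / y) / x" for a x y :: real by (simp add: mult.commute)
    then show ?thesis unfolding * by blast
  qed
  ultimately show ?thesis by (auto simp: has_field_derivative_iff)
qed

lemma two_plus_pow_pos: "2 + (x::real) ^ 6 > 0"
  using zero_le_even_power[of 6 x] by (simp add: add_pos_nonneg)

section \<open>The functions C and S and their derivatives\<close>

definition qcos :: "real \<Rightarrow> real" where "qcos \<phi> = sqrt (gauge2 \<phi>) * cos \<phi>"
definition qsin :: "real \<Rightarrow> real" where "qsin \<phi> = sqrt (gauge2 \<phi>) * sin \<phi>"
text \<open>This is d\<theta>/d\<phi> for the time \<theta> of x' = -2 y^3, y' = 3 x^5: there C S' -
  S C' = 3 C^6 + 2 S^4 = 2 + C^6, which also equals \<open>gauge2\<close> times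
  d\<phi>/d\<theta>.\<close>

definition qspeed :: "real \<Rightarrow> real" where "qspeed \<phi> = gauge2 \<phi> / (2 + qcos \<phi> ^ 6)"

lemma qcos_qsin_pow: "qcos \<phi> ^ 6 + qsin \<phi> ^ 4 = 1"
proof -
  have "sqrt (gauge2 \<phi>) ^ 6 = (sqrt (gauge2 \<phi>) ^ 2) ^ 3" by (simp flip: power_mult)
  also have "\<dots> = gauge2 \<phi> ^ 3" using gauge2(1)[of \<phi>] by simp
  finally have 1: "sqrt (gauge2 \<phi>) ^ 6 = gauge2 \<phi> ^ 3" .
  have "sqrt (gauge2 \<phi>) ^ 4 = (sqrt (gauge2 \<phi>) ^ 2) ^ 2" by (simp flip: power_mult)
  also have "\<dots> = gauge2 \<phi> ^ 2" using gauge2(1)[of \<phi>] by simp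
  finally have 2: "sqrt (gauge2 \<phi>) ^ 4 = gauge2 \<phi> ^ 2" .
  show ?thesis using gauge2(2)[of \<phi>] by (simp add: qcos_def qsin_def power_mult_distrib 1 2)
qed

lemma qtrig_symm [simp]:
  "qcos (\<phi> + 2 * pi) = qcos \<phi>" "qcos (- \<phi>) = qcos \<phi>" "qcos (pi - \<phi>) = - qcos \<phi>"
  "qsin (\<phi> + 2 * pi) = qsin \<phi>" "qsin (- \<phi>) = - qsin \<phi>" "qsin (pi - \<phi>) = qsin \<phi>"
  "qspeed (\<phi> + 2 * pi) = qspeed \<phi>" "qspeed (- \<phi>) = qspeed \<phi>" "qspeed (pi - \<phi>) = qspeed \<phi>"
  by (simp_all add: qcos_def qsin_def qspeed_def)

lemma qspeed_pos: "qspeed \<phi> > 0"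
  unfolding qspeed_def using gauge2(1)[of \<phi>] two_plus_pow_pos[of "qcos \<phi>"]
  by (intro divide_pos_pos) auto

lemma qcos_squared: "qcos \<phi> ^ 2 + qsin \<phi> ^ 2 = gauge2 \<phi>"
  using gauge2(1)[of \<phi>] by (simp add: qcos_def qsin_def power_mult_distrib flip: distrib_left)

text \<open>The two derivatives solve a linear system. One equation (\<open>e1\<close>) is the
  derivative of C^6 + S^4 = 1; the other (\<open>e2\<close>) is C S' - S C' = C^2 + S^2, valid for
  any curve parametrized by its polar angle.\<close>

lemma qtrig_derivs:
  "(qcos has_real_derivative qspeed \<phi> * (- 2 * qsin \<phi> ^ 3)) (at \<phi>)" (is ?c)
  "(qsin has_real_derivative qspeed \<phi> * (3 * qcos \<phi> ^ 5)) (at \<phi>)" (is ?s)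
proof -
  obtain D where D: "(gauge2 has_real_derivative D) (at \<phi>)" using gauge2_differentiable by blast
  have pos: "gauge2 \<phi> > 0" by (rule gauge2)
  define E where "E = D * (inverse (sqrt (gauge2 \<phi>)) / 2)"
  let ?c' = "E * cos \<phi> - sqrt (gauge2 \<phi>) * sin \<phi>" and ?s' = "E * sin \<phi> + sqrt (gauge2 \<phi>) * cos \<phi>"
  have c: "(qcos has_real_derivative ?c') (at \<phi>)"
    unfolding qcos_def[abs_def] E_def using pos
    by (auto intro!: derivative_eq_intros D simp: field_simps)
  have s: "(qsin has_real_derivative ?s') (at \<phi>)"
    unfolding qsin_def[abs_def] E_def using pos
    by (auto intro!: derivative_eq_intros D simp: field_simps)
  have "((\<lambda>\<phi>. qcos \<phi> ^ 6 + qsin \<phi> ^ 4) has_real_derivative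
      6 * qcos \<phi> ^ 5 * ?c' + 4 * qsin \<phi> ^ 3 * ?s') (at \<phi>)"
    by (auto intro!: derivative_eq_intros c s)
  moreover have "((\<lambda>\<phi>. qcos \<phi> ^ 6 + qsin \<phi> ^ 4) has_real_derivative 0) (at \<phi>)"
    by (simp add: qcos_qsin_pow)
  ultimately have e1: "6 * qcos \<phi> ^ 5 * ?c' + 4 * qsin \<phi> ^ 3 * ?s' = 0" by (rule DERIV_unique)
  have sq: "sqrt (gauge2 \<phi>) * sqrt (gauge2 \<phi>) = gauge2 \<phi>" using pos by simp
  have "qcos \<phi> * ?s' - qsin \<phi> * ?c' = (sqrt (gauge2 \<phi>) * sqrt (gauge2 \<phi>)) * (cos \<phi> ^ 2 + sin \<phi> ^ 2)"
    unfolding qcos_def qsin_def by algebra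
  then have e2: "qcos \<phi> * ?s' - qsin \<phi> * ?c' = gauge2 \<phi>" using sq by simp
  let ?d = "2 + qcos \<phi> ^ 6"
  have dpos: "?d > 0" by (rule two_plus_pow_pos)
  have h: "qcos \<phi> ^ 6 + qsin \<phi> ^ 4 = 1" by (rule qcos_qsin_pow)
  have "?c' * ?d = gauge2 \<phi> * (- 2 * qsin \<phi> ^ 3)" using e1 e2 h by algebra
  then have "?c' = qspeed \<phi> * (- 2 * qsin \<phi> ^ 3)" unfolding qspeed_def using dpos
    by (simp add: field_simps)
  with c show ?c by metis
  have "?s' * ?d = gauge2 \<phi> * (3 * qcos \<phi> ^ 5)" using e1 e2 h by algebra
  then have "?s' = qspeed \<phi> * (3 * qcos \<phi> ^ 5)" unfolding qspeed_def using dpos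
    by (simp add: field_simps)
  with s show ?s by metis
qed

lemma continuous_qtrig:
  "continuous_on UNIV qcos" "continuous_on UNIV qsin" "continuous_on UNIV qspeed"
proof -
  show c: "continuous_on UNIV qcos" "continuous_on UNIV qsin"
    by (intro continuous_at_imp_continuous_on ballI DERIV_isCont[OF qtrig_derivs(1)] DERIV_isCont[OF qtrig_derivs(2)])+
  have g: "continuous_on UNIV gauge2"
    by (intro continuous_at_imp_continuous_on ballI isCont_gauge2)
  have "2 + qcos \<phi> ^ 6 \<noteq> 0" for \<phi> using two_plus_pow_pos[of "qcos \<phi>"] by linarith
  then show "continuous_on UNIV qspeed" unfolding qspeed_def[abs_def]
    by (intro continuous_intros c g) auto
qed

lemma qtrig_unique:
  assumes "X ^ 6 + Y ^ 4 = 1" "X = \<rho> * cos \<phi>" "Y = \<rho> * sin \<phi>" "\<rho> > 0"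
  shows "X = qcos \<phi>" "Y = qsin \<phi>"
proof -
  have "(\<rho>^2)^3 * cos \<phi> ^ 6 + (\<rho>^2)^2 * sin \<phi> ^ 4 = 1"
    using assms(1) unfolding assms(2,3) by algebra
  then have "gauge2 \<phi> = \<rho>^2" using assms(4) by (intro gauge2_eqI) auto
  then have "sqrt (gauge2 \<phi>) = \<rho>" using assms(4) by simp
  then show "X = qcos \<phi>" "Y = qsin \<phi>" unfolding qcos_def qsin_def assms(2,3) by simp_all
qed

section \<open>Periodic functions and their primitives\<close>

definition per :: "(real \<Rightarrow> real) \<Rightarrow> bool" where
  "per f \<longleftrightarrow> (\<forall>\<phi>. f (\<phi> + 2 * pi) = f \<phi>)"

text \<open>Differentiation with respect to \<theta>, pulled back to \<phi>. In this form C and S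
  obey the polynomial rules of the leading system.\<close>

definition tder :: "(real \<Rightarrow> real) \<Rightarrow> (real \<Rightarrow> real) \<Rightarrow> bool" where
  "tder G g \<longleftrightarrow> (\<forall>\<phi>. (G has_real_derivative qspeed \<phi> * g \<phi>) (at \<phi>))"

text \<open>The integral of g over one turn with respect to \<theta>, as the increment of a
  primitive. Exact derivatives of periodic functions then have value 0 at once.\<close>

definition circ :: "(real \<Rightarrow> real) \<Rightarrow> real \<Rightarrow> bool" where
  "circ g k \<longleftrightarrow> (\<exists>G. tder G g \<and> (\<forall>\<phi>. G (\<phi> + 2 * pi) = G \<phi> + k))"

lemma tderD: "tder G g \<Longrightarrow> (G has_real_derivative qspeed \<phi> * g \<phi>) (at \<phi>)"
  by (simp add: tder_def)

lemma tder_cong: "tder G g \<Longrightarrow> (\<And>\<phi>. g \<phi> = h \<phi>) \<Longrightarrow> tder G h"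
  by (simp add: tder_def)

lemma tder_continuous: "tder G g \<Longrightarrow> continuous_on UNIV G"
  by (intro continuous_at_imp_continuous_on ballI DERIV_isCont[OF tderD])

lemma tder_qtrig: "tder qcos (\<lambda>\<phi>. - 2 * qsin \<phi> ^ 3)" "tder qsin (\<lambda>\<phi>. 3 * qcos \<phi> ^ 5)"
  using qtrig_derivs by (simp_all add: tder_def)

lemma tder_const: "tder (\<lambda>\<phi>. c) (\<lambda>\<phi>. 0)"
  by (simp add: tder_def)

lemma tder_add: "tder F f \<Longrightarrow> tder G g \<Longrightarrow> tder (\<lambda>\<phi>. F \<phi> + G \<phi>) (\<lambda>\<phi>. f \<phi> + g \<phi>)"
  unfolding tder_def by (auto intro!: derivative_eq_intros simp: algebra_simps)

lemma tder_diff: "tder F f \<Longrightarrow> tder G g \<Longrightarrow> tder (\<lambda>\<phi>. F \<phi> - G \<phi>) (\<lambda>\<phi>. f \<phi> - g \<phi>)"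
  unfolding tder_def by (auto intro!: derivative_eq_intros simp: algebra_simps)

lemma tder_mult: "tder F f \<Longrightarrow> tder G g \<Longrightarrow> tder (\<lambda>\<phi>. F \<phi> * G \<phi>) (\<lambda>\<phi>. f \<phi> * G \<phi> + F \<phi> * g \<phi>)"
  unfolding tder_def by (auto intro!: derivative_eq_intros simp: algebra_simps)

lemma tder_power: "tder F f \<Longrightarrow> tder (\<lambda>\<phi>. F \<phi> ^ n) (\<lambda>\<phi>. real n * F \<phi> ^ (n - 1) * f \<phi>)"
  unfolding tder_def by (auto intro!: derivative_eq_intros simp: algebra_simps)

lemmas tder_intros = tder_add tder_diff tder_mult tder_power tder_const tder_qtrig

lemma per_intros [intro]:
  "per (\<lambda>\<phi>. c)" "per qcos" "per qsin" "per qspeed"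
  "per f \<Longrightarrow> per g \<Longrightarrow> per (\<lambda>\<phi>. f \<phi> + g \<phi>)"
  "per f \<Longrightarrow> per g \<Longrightarrow> per (\<lambda>\<phi>. f \<phi> - g \<phi>)"
  "per f \<Longrightarrow> per (\<lambda>\<phi>. - f \<phi>)"
  "per f \<Longrightarrow> per g \<Longrightarrow> per (\<lambda>\<phi>. f \<phi> * g \<phi>)"
  "per f \<Longrightarrow> per g \<Longrightarrow> per (\<lambda>\<phi>. f \<phi> / g \<phi>)"
  "per f \<Longrightarrow> per (\<lambda>\<phi>. f \<phi> ^ n)"
  by (simp_all add: per_def)

lemma per_int:
  assumes "per f"
  shows "f (\<phi> + 2 * pi * of_int n) = f \<phi>"
proof -
  have nat: "f (\<phi> + 2 * pi * of_nat k) = f \<phi>" for \<phi> k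
  proof (induction k)
    case (Suc k)
    have "f (\<phi> + 2 * pi * of_nat (Suc k)) = f ((\<phi> + 2 * pi * of_nat k) + 2 * pi)"
      by (simp add: algebra_simps)
    also have "\<dots> = f \<phi>" using assms Suc by (simp add: per_def)
    finally show ?case .
  qed simp
  show ?thesis
  proof (cases "n \<ge> 0")
    case True
    then show ?thesis using nat[of \<phi> "nat n"] by simp
  next
    case False
    then show ?thesis using nat[of "\<phi> + 2 * pi * of_int n" "nat (- n)"] by simp
  qed
qed

lemma per_reduce: "\<exists>n. \<phi> - 2 * pi * of_int n \<in> {a..a + 2 * pi}"
proof -
  define n where "n = \<lfloor>(\<phi> - a) / (2 * pi)\<rfloor>"
  have "of_int n \<le> (\<phi> - a) / (2 * pi)" "(\<phi> - a) / (2 * pi) < of_int n + 1"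
    unfolding n_def by linarith+
  then have "of_int n * (2 * pi) \<le> \<phi> - a" "\<phi> - a < (of_int n + 1) * (2 * pi)"
    by (simp_all add: pos_le_divide_eq pos_divide_less_eq)
  then show ?thesis by (intro exI[of _ n]) (auto simp: algebra_simps)
qed

lemma per_reduceE:
  assumes "per f"
  obtains \<psi> where "\<psi> \<in> {a..a + 2 * pi}" "f \<phi> = f \<psi>"
proof -
  obtain n where "\<phi> - 2 * pi * of_int n \<in> {a..a + 2 * pi}" using per_reduce by blast
  with per_int[OF assms, of "\<phi> - 2 * pi * of_int n" n] that show thesis by simp
qed

lemma per_bounded:
  assumes "per f" "continuous_on UNIV f"
  obtains K where "K > 0" "\<And>\<phi>. \<bar>f \<phi>\<bar> \<le> K"
proof -
  have "compact (f ` {0..0 + 2 * pi})"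
    by (intro compact_continuous_image continuous_on_subset[OF assms(2)]) auto
  then obtain K where K: "K > 0" "\<And>x. x \<in> f ` {0..0 + 2 * pi} \<Longrightarrow> norm x \<le> K"
    using compact_imp_bounded bounded_pos by metis
  have "\<bar>f \<phi>\<bar> \<le> K" for \<phi>
    using per_reduceE[OF assms(1), of 0 \<phi>] K(2) by (metis imageI real_norm_def)
  with K(1) show thesis by (rule that)
qed

lemma primitive_exists:
  assumes "continuous_on UNIV (f :: real \<Rightarrow> real)"
  shows "\<exists>F. F a = 0 \<and> (\<forall>x. (F has_real_derivative f x) (at x))"
proof -
  have "\<exists>F. \<forall>x::real. (-\<infinity>::ereal) < x \<longrightarrow> x < (\<infinity>::ereal) \<longrightarrow> (F has_vector_derivative f x) (at x)"
    by (rule einterval_antiderivative) (use assms in \<open>auto simp: continuous_on_eq_continuous_at\<close>)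
  then obtain F where F: "\<And>x. (F has_real_derivative f x) (at x)"
    by (auto simp: has_real_derivative_iff_has_vector_derivative)
  show ?thesis
    by (rule exI[of _ "\<lambda>x. F x - F a"]) (auto intro!: derivative_eq_intros F)
qed

lemma tder_exists:
  assumes "continuous_on UNIV g"
  shows "\<exists>G. G a = 0 \<and> tder G g"
  unfolding tder_def by (rule primitive_exists) (intro continuous_intros continuous_qtrig assms)

lemma deriv_zero_const:
  assumes "\<And>x. (f has_real_derivative 0) (at x)"
  shows "f x = f (y::real)"
  using DERIV_isconst_all[of f x y] assms by blast

lemma tder_shift:
  assumes "tder G g" "per g"
  obtains k where "\<And>\<phi>. G (\<phi> + 2 * pi) = G \<phi> + k"
proof -
  have "((\<lambda>\<phi>. G (\<phi> + 2 * pi) - G \<phi>) has_real_derivative 0) (at \<phi>)" for \<phi>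
  proof -
    have "((\<lambda>\<phi>. G (\<phi> + 2 * pi)) has_real_derivative (qspeed (\<phi> + 2 * pi) * g (\<phi> + 2 * pi)) * 1) (at \<phi>)"
      by (rule DERIV_chain2[OF tderD[OF assms(1)]]) (auto intro!: derivative_eq_intros)
    then have "((\<lambda>\<phi>. G (\<phi> + 2 * pi)) has_real_derivative qspeed \<phi> * g \<phi>) (at \<phi>)"
      using assms(2) by (simp add: per_def)
    from DERIV_diff[OF this tderD[OF assms(1)]] show ?thesis by simp
  qed
  from deriv_zero_const[of "\<lambda>\<phi>. G (\<phi> + 2 * pi) - G \<phi>", OF this, of _ 0] have
    "G (\<phi> + 2 * pi) = G \<phi> + (G (0 + 2 * pi) - G 0)" for \<phi> by (simp add: algebra_simps)
  then show thesis by (rule that)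
qed

lemma tder_odd:
  assumes "tder G g" "\<And>\<phi>. g (- \<phi>) = - g \<phi>"
  shows "G (- \<phi>) = G \<phi>"
proof -
  have "((\<lambda>\<phi>. G (- \<phi>) - G \<phi>) has_real_derivative 0) (at \<phi>)" for \<phi>
  proof -
    have "((\<lambda>\<phi>. G (- \<phi>)) has_real_derivative (qspeed (- \<phi>) * g (- \<phi>)) * (- 1)) (at \<phi>)"
      by (rule DERIV_chain2[OF tderD[OF assms(1)]]) (auto intro!: derivative_eq_intros)
    then have "((\<lambda>\<phi>. G (- \<phi>)) has_real_derivative qspeed \<phi> * g \<phi>) (at \<phi>)"
      using assms(2) by simp
    from DERIV_diff[OF this tderD[OF assms(1)]] show ?thesis by simp
  qed
  from deriv_zero_const[of "\<lambda>\<phi>. G (- \<phi>) - G \<phi>", OF this, of \<phi> 0] show ?thesis by simp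
qed

lemma tder_even:
  assumes "tder G g" "\<And>\<phi>. g (- \<phi>) = g \<phi>" "G 0 = 0"
  shows "G (- \<phi>) = - G \<phi>"
proof -
  have "((\<lambda>\<phi>. G (- \<phi>) + G \<phi>) has_real_derivative 0) (at \<phi>)" for \<phi>
  proof -
    have "((\<lambda>\<phi>. G (- \<phi>)) has_real_derivative (qspeed (- \<phi>) * g (- \<phi>)) * (- 1)) (at \<phi>)"
      by (rule DERIV_chain2[OF tderD[OF assms(1)]]) (auto intro!: derivative_eq_intros)
    then have "((\<lambda>\<phi>. G (- \<phi>)) has_real_derivative - (qspeed \<phi> * g \<phi>)) (at \<phi>)"
      using assms(2) by simp
    from DERIV_add[OF this tderD[OF assms(1)]] show ?thesis by simp
  qed
  from deriv_zero_const[of "\<lambda>\<phi>. G (- \<phi>) + G \<phi>", OF this, of \<phi> 0] show ?thesis using assms(3) by simp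
qed

lemma tder_refl:
  assumes "tder G g" "\<And>\<phi>. g (pi - \<phi>) = - g \<phi>"
  shows "G (pi - \<phi>) = G \<phi>"
proof -
  have "((\<lambda>\<phi>. G (pi - \<phi>) - G \<phi>) has_real_derivative 0) (at \<phi>)" for \<phi>
  proof -
    have "((\<lambda>\<phi>. G (pi - \<phi>)) has_real_derivative (qspeed (pi - \<phi>) * g (pi - \<phi>)) * (- 1)) (at \<phi>)"
      by (rule DERIV_chain2[OF tderD[OF assms(1)]]) (auto intro!: derivative_eq_intros)
    then have "((\<lambda>\<phi>. G (pi - \<phi>)) has_real_derivative qspeed \<phi> * g \<phi>) (at \<phi>)"
      using assms(2) by simp
    from DERIV_diff[OF this tderD[OF assms(1)]] show ?thesis by simp
  qed
  from deriv_zero_const[of "\<lambda>\<phi>. G (pi - \<phi>) - G \<phi>", OF this, of \<phi> "pi / 2"] show ?thesis by simp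
qed

lemma tder_odd_per:
  assumes "tder G g" "per g" "\<And>\<phi>. g (- \<phi>) = - g \<phi>"
  shows "per G"
proof -
  obtain k where k: "\<And>\<phi>. G (\<phi> + 2 * pi) = G \<phi> + k" using tder_shift assms by blast
  have "k = 0" using k[of "- pi"] tder_odd[OF assms(1,3), of pi] by simp
  with k show ?thesis by (simp add: per_def)
qed

text \<open>The angles -pi/2 and -pi/2 + 2 pi are exchanged by the reflection, so the increment over
  one turn is 0.\<close>

lemma tder_refl_per:
  assumes "tder G g" "per g" "\<And>\<phi>. g (pi - \<phi>) = - g \<phi>"
  shows "per G"
proof -
  obtain k where k: "\<And>\<phi>. G (\<phi> + 2 * pi) = G \<phi> + k" using tder_shift assms by blast
  have "k = 0" using k[of "- pi / 2"] tder_refl[OF assms(1,3), of "- pi / 2"]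
    by (simp add: algebra_simps)
  with k show ?thesis by (simp add: per_def)
qed

lemma circ_exists: "continuous_on UNIV g \<Longrightarrow> per g \<Longrightarrow> \<exists>k. circ g k"
  unfolding circ_def by (metis tder_exists tder_shift)

lemma circ_add: "circ f j \<Longrightarrow> circ g k \<Longrightarrow> circ (\<lambda>\<phi>. f \<phi> + g \<phi>) (j + k)"
  unfolding circ_def by (elim exE conjE, rule exI, rule conjI, rule tder_add) auto

lemma circ_cmult:
  assumes "circ f j"
  shows "circ (\<lambda>\<phi>. c * f \<phi>) (c * j)"
proof -
  obtain G where G: "tder G f" "\<And>\<phi>. G (\<phi> + 2 * pi) = G \<phi> + j" using assms by (auto simp: circ_def)
  have "tder (\<lambda>\<phi>. c * G \<phi>) (\<lambda>\<phi>. c * f \<phi>)"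
    by (rule tder_cong[OF tder_mult[OF tder_const G(1)]]) simp
  moreover have "c * G (\<phi> + 2 * pi) = c * G \<phi> + c * j" for \<phi> unfolding G(2) by (simp add: algebra_simps)
  ultimately show ?thesis unfolding circ_def by blast
qed

lemma circ_tder: "tder G g \<Longrightarrow> per G \<Longrightarrow> circ g 0"
  unfolding circ_def per_def by auto

lemma circ_refl:
  assumes "continuous_on UNIV g" "per g" "\<And>\<phi>. g (pi - \<phi>) = - g \<phi>"
  shows "circ g 0"
proof -
  obtain G where G: "tder G g" using tder_exists[OF assms(1)] by blast
  show ?thesis by (rule circ_tder[OF G tder_refl_per[OF G assms(2,3)]])
qed

lemma circ_cong: "circ f k \<Longrightarrow> (\<And>\<phi>. f \<phi> = g \<phi>) \<Longrightarrow> j = k \<Longrightarrow> circ g j"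
  unfolding circ_def tder_def by simp

lemma tder_mono:
  assumes "tder G g" "\<And>\<phi>. g \<phi> \<ge> 0" "a \<le> b"
  shows "G a \<le> G b"
proof (rule DERIV_nonneg_imp_nondecreasing[OF assms(3)])
  fix x
  have "0 \<le> qspeed x * g x" using assms(2) qspeed_pos[of x] by simp
  with tderD[OF assms(1)] show "\<exists>y. (G has_real_derivative y) (at x) \<and> 0 \<le> y" by blast
qed

lemma circ_pos:
  assumes "circ g k" "\<And>\<phi>. g \<phi> \<ge> 0" "g \<phi>0 > 0" "continuous_on UNIV g"
  shows "k > 0"
proof -
  obtain G where G: "tder G g" "\<And>\<phi>. G (\<phi> + 2 * pi) = G \<phi> + k" using assms(1) by (auto simp: circ_def)
  have mono: "G a \<le> G b" if "a \<le> b" for a b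
    by (rule tder_mono[OF G(1) assms(2) that])
  have "qspeed \<phi>0 * g \<phi>0 > 0" using qspeed_pos assms(3) by simp
  then obtain d where d: "d > 0" "\<And>h. 0 < h \<Longrightarrow> h < d \<Longrightarrow> G \<phi>0 < G (\<phi>0 + h)"
    using DERIV_pos_inc_right[OF tderD[OF G(1)]] by blast
  define h where "h = min (d / 2) pi"
  have h: "0 < h" "h < d" "h \<le> 2 * pi" using d(1) pi_gt_zero by (auto simp: h_def min_def)
  have "G \<phi>0 < G (\<phi>0 + h)" using h d by auto
  also have "\<dots> \<le> G (\<phi>0 + 2 * pi)" using h by (intro mono) auto
  finally show ?thesis using G(2)[of \<phi>0] by simp
qed

text \<open>The function k / j * h has the same integral over one turn as g, so the difference
  integrates to a periodic function.\<close>

lemma circ_tder_exists: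
  assumes "circ g k" "continuous_on UNIV g" "circ h j" "j > 0"
  shows "\<exists>G. tder G (\<lambda>\<phi>. k / j * h \<phi> - g \<phi>) \<and> per G"
proof -
  have "circ (\<lambda>\<phi>. k / j * h \<phi> + (-1) * g \<phi>) (k / j * j + (-1) * k)"
    by (intro circ_add circ_cmult assms)
  then show ?thesis using assms(4) by (auto simp: circ_def per_def)
qed

section \<open>Quasi-polar coordinates\<close>

text \<open>For the weights 2 of x and 3 of y, the two leading terms raise the weight by 7 and all
  the other terms raise it by 8.\<close>

definition emb :: "real \<Rightarrow> real \<Rightarrow> real \<times> real" where
  "emb \<phi> r = (r^2 * qcos \<phi>, r^3 * qsin \<phi>)"

definition qnorm :: "real \<times> real \<Rightarrow> real" where
  "qnorm p = root 12 (fst p ^ 6 + snd p ^ 4)"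

lemma qnorm_nonneg: "qnorm p \<ge> 0"
  by (simp add: qnorm_def)

lemma qnorm_pow: "qnorm p ^ 12 = fst p ^ 6 + snd p ^ 4"
  unfolding qnorm_def by (rule real_root_pow_pos2) auto

lemma fst_snd_pow_pos: "p \<noteq> 0 \<Longrightarrow> (fst p :: real) ^ 6 + (snd p :: real) ^ 4 > 0"
  by (cases p) (auto simp: zero_prod_def add_pos_nonneg add_nonneg_pos)

lemma qnorm_pos: "p \<noteq> 0 \<Longrightarrow> qnorm p > 0"
  using fst_snd_pow_pos[of p] by (simp add: qnorm_def)

lemma qnorm_0 [simp]: "qnorm 0 = 0"
  by (simp add: qnorm_def)

lemma continuous_qnorm: "continuous_on UNIV qnorm"
  unfolding qnorm_def by (intro continuous_intros)

lemma qnorm_emb [simp]: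
  assumes "r \<ge> 0"
  shows "qnorm (emb \<phi> r) = r"
proof -
  have "(r^2 * qcos \<phi>)^6 + (r^3 * qsin \<phi>)^4 = r^12 * (qcos \<phi>^6 + qsin \<phi>^4)" by algebra
  then show ?thesis using assms by (simp add: qnorm_def emb_def qcos_qsin_pow real_root_power_cancel)
qed

lemma emb_nonzero: "r > 0 \<Longrightarrow> emb \<phi> r \<noteq> 0"
  using qnorm_emb[of r \<phi>] by (metis less_eq_real_def less_irrefl qnorm_0)

lemma emb_exists:
  assumes "p \<noteq> 0"
  obtains \<phi> where "p = emb \<phi> (qnorm p)"
proof -
  let ?r = "qnorm p"
  have r: "?r > 0" by (rule qnorm_pos[OF assms])
  let ?X = "fst p / ?r^2" and ?Y = "snd p / ?r^3"
  have "?X^6 + ?Y^4 = (fst p ^ 6 + snd p ^ 4) / ?r^12"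
    by (simp add: power_divide add_divide_distrib flip: power_mult)
  also have "\<dots> = 1" unfolding qnorm_pow[symmetric] using r by simp
  finally have XY: "?X^6 + ?Y^4 = 1" .
  obtain \<rho> \<phi> where \<rho>: "?X = \<rho> * cos \<phi>" "?Y = \<rho> * sin \<phi>" "\<rho> \<ge> 0"
  proof -
    define w where "w = Complex ?X ?Y"
    have "w = rcis (cmod w) (Arg w)" by (simp add: rcis_cmod_Arg)
    then have "Re w = cmod w * cos (Arg w)" "Im w = cmod w * sin (Arg w)" by (metis Re_rcis, metis Im_rcis)
    moreover have "Re w = ?X" "Im w = ?Y" by (simp_all add: w_def)
    ultimately show thesis using that[of "cmod w" "Arg w"] by (metis norm_ge_zero)
  qed
  have "\<rho> \<noteq> 0" using \<rho> XY by auto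
  then have "?X = qcos \<phi>" "?Y = qsin \<phi>" using qtrig_unique[OF XY \<rho>(1,2)] \<rho>(3) by auto
  then have "fst p = ?r^2 * qcos \<phi>" "snd p = ?r^3 * qsin \<phi>" using r by (simp_all add: field_simps)
  then have "p = emb \<phi> ?r" unfolding emb_def by (metis prod.collapse)
  then show thesis by (rule that)
qed

lemma emb_eqD:
  assumes "emb \<phi> r = emb \<psi> s" "r > 0" "s > 0"
  shows "r = s" "\<exists>n::int. \<phi> = \<psi> + 2 * pi * of_int n"
proof -
  show rs: "r = s" using qnorm_emb[of r \<phi>] qnorm_emb[of s \<psi>] assms by simp
  then have e: "qcos \<phi> = qcos \<psi>" "qsin \<phi> = qsin \<psi>" using assms by (auto simp: emb_def)
  \<comment> \<open>The gauge is C^2 + S^2, hence determined by the point; dividing by its root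
    leaves cosine and sine.\<close>
  then have "gauge2 \<phi> = gauge2 \<psi>" by (metis qcos_squared)
  with e gauge2(1)[of \<psi>] have "sin \<phi> = sin \<psi> \<and> cos \<phi> = cos \<psi>" by (auto simp: qcos_def qsin_def)
  then show "\<exists>n::int. \<phi> = \<psi> + 2 * pi * of_int n" by (simp add: sin_cos_eq_iff)
qed

lemma emb_per: "emb (\<phi> + 2 * pi) r = emb \<phi> r"
  by (simp add: emb_def)

lemma per_emb:
  assumes "per f" "emb \<phi> r = emb \<psi> s" "r > 0" "s > 0"
  shows "f \<phi> = f \<psi>"
  using emb_eqD(2)[OF assms(2-4)] per_int[OF assms(1)] by auto

lemma qnorm_differentiable:
  assumes "p \<noteq> 0"
  shows "\<exists>D. (qnorm has_derivative D) (at p)"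
proof -
  have "\<exists>D. ((\<lambda>p::real\<times>real. fst p ^ 6 + snd p ^ 4) has_derivative D) (at p)"
    by (auto intro!: exI derivative_eq_intros)
  then obtain D where D: "((\<lambda>p::real\<times>real. fst p ^ 6 + snd p ^ 4) has_derivative D) (at p)" by blast
  from DERIV_compose_FDERIV[OF DERIV_real_root[of 12] this] fst_snd_pow_pos[OF assms]
  show ?thesis unfolding qnorm_def[abs_def] by auto
qed

text \<open>Local differentiable branches of the angle \<open>\<phi>\<close> in \<open>p = emb \<phi> (qnorm p)\<close>: rotate the
  plane by \<open>- \<phi>0\<close> and take the arc tangent.\<close>

lemma angle_branch:
  assumes "r0 > 0"
  obtains A A' where "A (emb \<phi>0 r0) = \<phi>0" "(A has_derivative A') (at (emb \<phi>0 r0))"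
    "\<forall>\<^sub>F p in nhds (emb \<phi>0 r0). p = emb (A p) (qnorm p)"
proof -
  define p0 where "p0 = emb \<phi>0 r0"
  have p0: "p0 \<noteq> 0" "qnorm p0 = r0" using assms by (simp_all add: p0_def emb_nonzero)
  define X Y where "X = (\<lambda>p. fst p / qnorm p ^ 2)" and "Y = (\<lambda>p. snd p / qnorm p ^ 3)"
  define a b where "a = (\<lambda>p. X p * cos \<phi>0 + Y p * sin \<phi>0)" and "b = (\<lambda>p. Y p * cos \<phi>0 - X p * sin \<phi>0)"
  define A where "A = (\<lambda>p. \<phi>0 + arctan (b p / a p))"
  have XY0: "X p0 = qcos \<phi>0" "Y p0 = qsin \<phi>0"
    using assms p0(2) by (simp_all add: X_def Y_def p0_def emb_def)
  have "a p0 = sqrt (gauge2 \<phi>0) * (cos \<phi>0 ^ 2 + sin \<phi>0 ^ 2)"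
    unfolding a_def XY0 qcos_def qsin_def by algebra
  then have a0: "a p0 > 0" using gauge2(1)[of \<phi>0] by simp
  have b0: "b p0 = 0" unfolding b_def XY0 qcos_def qsin_def by algebra
  obtain D where D: "(qnorm has_derivative D) (at p0)" using qnorm_differentiable[OF p0(1)] by blast
  have XYd: "\<exists>D. (X has_derivative D) (at p0)" "\<exists>D. (Y has_derivative D) (at p0)"
    unfolding X_def Y_def using p0 assms by (auto intro!: exI derivative_eq_intros D)
  then obtain DX DY where XY': "(X has_derivative DX) (at p0)" "(Y has_derivative DY) (at p0)" by blast
  have ad: "(a has_derivative (\<lambda>h. DX h * cos \<phi>0 + DY h * sin \<phi>0)) (at p0)"
    unfolding a_def by (auto intro!: derivative_eq_intros XY')
  have "\<exists>D. ((\<lambda>p. b p / a p) has_derivative D) (at p0)"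
    unfolding b_def using a0 by (auto intro!: exI derivative_eq_intros XY' ad)
  then obtain E where E: "((\<lambda>p. b p / a p) has_derivative E) (at p0)" by blast
  from DERIV_compose_FDERIV[OF DERIV_arctan this]
  have "((\<lambda>p. arctan (b p / a p)) has_derivative (\<lambda>x. E x * inverse (1 + (b p0 / a p0)\<^sup>2))) (at p0)" .
  from has_derivative_add[OF has_derivative_const[of \<phi>0] this]
  obtain A' where A': "(A has_derivative A') (at p0)" unfolding A_def by blast
  have A0: "A p0 = \<phi>0" by (simp add: A_def b0)
  have "isCont a p0" by (rule has_derivative_continuous[OF ad])
  then have "(a \<longlongrightarrow> a p0) (nhds p0)" by (simp add: isCont_def tendsto_at_iff_tendsto_nhds)
  then have "\<forall>\<^sub>F p in nhds p0. a p > 0" using a0 by (rule order_tendstoD)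
  moreover have "\<forall>\<^sub>F p in nhds p0. p \<noteq> 0" using p0(1) by (rule t1_space_nhds)
  ultimately have "\<forall>\<^sub>F p in nhds p0. p = emb (A p) (qnorm p)"
  proof eventually_elim
    case (elim p)
    let ?r = "qnorm p"
    have r: "?r > 0" by (rule qnorm_pos[OF elim(2)])
    \<comment> \<open>This is the root of a^2 + b^2, in the form in which cosine and sine of an arc
      tangent appear; a > 0 fixes the sign.\<close>
    define \<rho> where "\<rho> = sqrt (1 + (b p / a p)^2) * a p"
    have s1: "sqrt (1 + (b p / a p)^2) > 0" by (smt (verit) real_sqrt_gt_zero zero_le_power2)
    have \<rho>: "\<rho> > 0" using elim s1 by (simp add: \<rho>_def)
    define \<alpha> where "\<alpha> = arctan (b p / a p)"
    have cs: "\<rho> * cos \<alpha> = a p" "\<rho> * sin \<alpha> = b p"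
      using elim s1 by (simp_all add: \<rho>_def \<alpha>_def cos_arctan sin_arctan)
    have A: "A p = \<phi>0 + \<alpha>" by (simp add: A_def \<alpha>_def)
    have one: "cos \<phi>0 ^ 2 + sin \<phi>0 ^ 2 = 1" by simp
    have "\<rho> * cos (A p) = a p * cos \<phi>0 - b p * sin \<phi>0"
      unfolding A cos_add cs[symmetric] by algebra
    also have "\<dots> = X p" unfolding a_def b_def using one by algebra
    finally have x: "X p = \<rho> * cos (A p)" by simp
    have "\<rho> * sin (A p) = b p * cos \<phi>0 + a p * sin \<phi>0"
      unfolding A sin_add cs[symmetric] by algebra
    also have "\<dots> = Y p" unfolding a_def b_def using one by algebra
    finally have y: "Y p = \<rho> * sin (A p)" by simp
    have "X p ^6 + Y p ^4 = (fst p ^ 6 + snd p ^ 4) / ?r^12"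
      by (simp add: X_def Y_def power_divide add_divide_distrib flip: power_mult)
    also have "\<dots> = 1" unfolding qnorm_pow[symmetric] using r by simp
    finally have XY: "X p^6 + Y p^4 = 1" .
    have "X p = qcos (A p)" "Y p = qsin (A p)" using qtrig_unique[OF XY x y \<rho>] by auto
    then have "fst p = ?r^2 * qcos (A p)" "snd p = ?r^3 * qsin (A p)"
      using r by (simp_all add: X_def Y_def field_simps)
    then show ?case unfolding emb_def by (metis prod.collapse)
  qed
  with A0 A' show thesis unfolding p0_def by (rule that)
qed

text \<open>Near \<open>t0\<close> the curve equals its own polar expression, so its velocity can be
  computed in two ways: directly, and by the chain rule through a local branch of the angle.\<close>

lemma polar_curve:
  assumes "(z has_vector_derivative v) (at t0)" "z t0 = emb \<phi>0 r0" "r0 > 0"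
  obtains a D \<rho> where "a t0 = \<phi>0" "(a has_real_derivative D) (at t0)"
    "((\<lambda>t. qnorm (z t)) has_real_derivative \<rho>) (at t0)"
    "\<forall>\<^sub>F t in nhds t0. z t = emb (a t) (qnorm (z t))"
    "fst v = 2 * r0 * \<rho> * qcos \<phi>0 - 2 * r0^2 * qsin \<phi>0 ^ 3 * qspeed \<phi>0 * D"
    "snd v = 3 * r0^2 * \<rho> * qsin \<phi>0 + 3 * r0^3 * qcos \<phi>0 ^ 5 * qspeed \<phi>0 * D"
proof -
  obtain A A' where A: "A (emb \<phi>0 r0) = \<phi>0" "(A has_derivative A') (at (emb \<phi>0 r0))"
    "\<forall>\<^sub>F p in nhds (emb \<phi>0 r0). p = emb (A p) (qnorm p)" using angle_branch[OF assms(3)] by blast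
  obtain N where N: "(qnorm has_derivative N) (at (emb \<phi>0 r0))"
    using qnorm_differentiable[OF emb_nonzero[OF assms(3)]] by blast
  have zd: "(z has_derivative (\<lambda>h. h *\<^sub>R v)) (at t0)" using assms(1) by (simp add: has_vector_derivative_def)
  have comp: "((\<lambda>t. f (z t)) has_real_derivative f' v) (at t0)"
    if f: "(f has_derivative f') (at (emb \<phi>0 r0))" for f :: "real \<times> real \<Rightarrow> real" and f'
  proof -
    have "((\<lambda>t. f (z t)) has_derivative (\<lambda>h. f' (h *\<^sub>R v))) (at t0)"
      by (rule has_derivative_compose[OF zd]) (use f assms(2) in simp)
    moreover have "f' (h *\<^sub>R v) = f' v * h" for h
      using linear_cmul[OF has_derivative_linear[OF f]] by simp
    ultimately show ?thesis by (simp add: has_field_derivative_def)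
  qed
  define a where "a = (\<lambda>t. A (z t))"
  define R where "R = (\<lambda>t. qnorm (z t))"
  have ad: "(a has_real_derivative A' v) (at t0)" unfolding a_def by (rule comp[OF A(2)])
  have Rd: "(R has_real_derivative N v) (at t0)" unfolding R_def by (rule comp[OF N])
  have a0: "a t0 = \<phi>0" using A(1) assms(2) by (simp add: a_def)
  have R0: "R t0 = r0" using assms by (simp add: R_def)
  have "isCont z t0" using has_derivative_continuous[OF zd] .
  then have "filterlim z (nhds (z t0)) (nhds t0)"
    unfolding isCont_def tendsto_at_iff_tendsto_nhds .
  then have "filterlim z (nhds (emb \<phi>0 r0)) (nhds t0)" by (simp only: assms(2))
  from eventually_compose_filterlim[OF A(3) this]
  have ev: "\<forall>\<^sub>F t in nhds t0. z t = emb (a t) (R t)" by (simp add: a_def R_def)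
  have C: "((\<lambda>t. qcos (a t)) has_real_derivative (qspeed \<phi>0 * (- 2 * qsin \<phi>0 ^ 3)) * A' v) (at t0)"
    by (rule DERIV_chain2[OF _ ad]) (simp only: a0 qtrig_derivs)
  have S: "((\<lambda>t. qsin (a t)) has_real_derivative (qspeed \<phi>0 * (3 * qcos \<phi>0 ^ 5)) * A' v) (at t0)"
    by (rule DERIV_chain2[OF _ ad]) (simp only: a0 qtrig_derivs)
  have z': "((\<lambda>t. fst (z t)) has_real_derivative fst v) (at t0)" "((\<lambda>t. snd (z t)) has_real_derivative snd v) (at t0)"
    using comp[OF has_derivative_fst[OF has_derivative_ident]]
      comp[OF has_derivative_snd[OF has_derivative_ident]] by simp_all
  have c': "((\<lambda>t. R t ^2 * qcos (a t)) has_real_derivative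
      2 * r0 * N v * qcos \<phi>0 - 2 * r0^2 * qsin \<phi>0 ^ 3 * qspeed \<phi>0 * A' v) (at t0)"
    by (auto intro!: derivative_eq_intros C Rd simp: R0 a0)
  have s': "((\<lambda>t. R t ^3 * qsin (a t)) has_real_derivative
      3 * r0^2 * N v * qsin \<phi>0 + 3 * r0^3 * qcos \<phi>0 ^ 5 * qspeed \<phi>0 * A' v) (at t0)"
    by (auto intro!: derivative_eq_intros S Rd simp: R0 a0)
  have e: "\<forall>\<^sub>F t in nhds t0. fst (z t) = R t ^2 * qcos (a t)" "\<forall>\<^sub>F t in nhds t0. snd (z t) = R t ^3 * qsin (a t)"
    using ev by (eventually_elim, simp add: emb_def)+
  have "fst v = 2 * r0 * N v * qcos \<phi>0 - 2 * r0^2 * qsin \<phi>0 ^ 3 * qspeed \<phi>0 * A' v"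
    "snd v = 3 * r0^2 * N v * qsin \<phi>0 + 3 * r0^3 * qcos \<phi>0 ^ 5 * qspeed \<phi>0 * A' v"
    by (rule DERIV_unique[OF z'(1)], subst DERIV_cong_ev[OF refl e(1) refl], rule c')
       (rule DERIV_unique[OF z'(2)], subst DERIV_cong_ev[OF refl e(2) refl], rule s')
  then show thesis using that[OF a0 ad Rd[unfolded R_def] ev[unfolded R_def]] by blast
qed

section \<open>A criterion for the absence of a center\<close>

locale qh_field =
  fixes a22 a50 b13 b41 :: real
begin

abbreviation F :: "real \<times> real \<Rightarrow> real \<times> real" where
  "F \<equiv> planar_field a22 a50 b13 b41"

definition X :: "real \<Rightarrow> real" where
  "X \<phi> = a22 * qcos \<phi> ^ 2 * qsin \<phi> ^ 2 + a50 * qcos \<phi> ^ 5"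

definition Y :: "real \<Rightarrow> real" where
  "Y \<phi> = b13 * qcos \<phi> * qsin \<phi> ^ 3 + b41 * qcos \<phi> ^ 4 * qsin \<phi>"

text \<open>\<open>P\<close> and \<open>Q\<close> are the radial and angular components of the
  perturbation (X, Y): they solve X = 2 P C + Q C', Y = 3 P S + Q S', whose determinant is 6 (C^6 +
  S^4) = 6.\<close>

definition P :: "real \<Rightarrow> real" where
  "P \<phi> = (3 * qcos \<phi> ^ 5 * X \<phi> + 2 * qsin \<phi> ^ 3 * Y \<phi>) / 6"

definition Q :: "real \<Rightarrow> real" where
  "Q \<phi> = (2 * qcos \<phi> * Y \<phi> - 3 * qsin \<phi> * X \<phi>) / 6"

lemma continuous_PQ: "continuous_on UNIV P" "continuous_on UNIV Q"
  unfolding P_def Q_def X_def Y_def by (intro continuous_intros continuous_qtrig; simp)+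

lemma per_PQ: "per P" "per Q"
  unfolding per_def P_def Q_def X_def Y_def by simp_all

lemma field_emb:
  "F (emb \<phi> r) = (- 2 * r^9 * qsin \<phi> ^ 3 + r^10 * X \<phi>, 3 * r^10 * qcos \<phi> ^ 5 + r^11 * Y \<phi>)"
proof -
  have "- 2 * (r^3 * qsin \<phi>) ^ 3 + a22 * (r^2 * qcos \<phi>) ^ 2 * (r^3 * qsin \<phi>) ^ 2 + a50 * (r^2 * qcos \<phi>) ^ 5
      = - 2 * r^9 * qsin \<phi> ^ 3 + r^10 * X \<phi>" unfolding X_def by algebra
  moreover have "3 * (r^2 * qcos \<phi>) ^ 5 + b13 * (r^2 * qcos \<phi>) * (r^3 * qsin \<phi>) ^ 3
      + b41 * (r^2 * qcos \<phi>) ^ 4 * (r^3 * qsin \<phi>) = 3 * r^10 * qcos \<phi> ^ 5 + r^11 * Y \<phi>"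
    unfolding Y_def by algebra
  ultimately show ?thesis by (simp add: planar_field_def emb_def)
qed

lemma polar_solution:
  assumes "(z has_vector_derivative F (z t0)) (at t0)" "z t0 = emb \<phi>0 r0" "r0 > 0"
  obtains a where "a t0 = \<phi>0"
    "(a has_real_derivative r0^7 * (1 + r0 * Q \<phi>0) / qspeed \<phi>0) (at t0)"
    "((\<lambda>t. qnorm (z t)) has_real_derivative r0^9 * P \<phi>0) (at t0)"
    "\<forall>\<^sub>F t in nhds t0. z t = emb (a t) (qnorm (z t))"
proof -
  obtain a D \<rho> where a: "a t0 = \<phi>0" "(a has_real_derivative D) (at t0)"
    "((\<lambda>t. qnorm (z t)) has_real_derivative \<rho>) (at t0)"
    "\<forall>\<^sub>F t in nhds t0. z t = emb (a t) (qnorm (z t))"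
    "fst (F (z t0)) = 2 * r0 * \<rho> * qcos \<phi>0 - 2 * r0^2 * qsin \<phi>0 ^ 3 * qspeed \<phi>0 * D"
    "snd (F (z t0)) = 3 * r0^2 * \<rho> * qsin \<phi>0 + 3 * r0^3 * qcos \<phi>0 ^ 5 * qspeed \<phi>0 * D"
    by (rule polar_curve[OF assms])
  let ?C = "qcos \<phi>0" and ?S = "qsin \<phi>0"
  have e1: "2 * r0 * \<rho> * ?C - 2 * r0^2 * ?S ^ 3 * qspeed \<phi>0 * D = - 2 * r0^9 * ?S ^ 3 + r0^10 * X \<phi>0"
    and e2: "3 * r0^2 * \<rho> * ?S + 3 * r0^3 * ?C ^ 5 * qspeed \<phi>0 * D = 3 * r0^10 * ?C ^ 5 + r0^11 * Y \<phi>0"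
    using a(5,6) unfolding assms(2) field_emb by simp_all
  have h: "?C ^ 6 + ?S ^ 4 = 1" by (rule qcos_qsin_pow)
  have "6 * r0^2 * \<rho> = r0^11 * (3 * ?C^5 * X \<phi>0 + 2 * ?S^3 * Y \<phi>0)" using e1 e2 h by algebra
  then have "r0^2 * \<rho> = r0^2 * (r0^9 * P \<phi>0)" unfolding P_def by algebra
  then have \<rho>: "\<rho> = r0^9 * P \<phi>0"
    by (rule mult_left_cancel[THEN iffD1, rotated]) (use assms(3) in simp)
  have "6 * r0^3 * (qspeed \<phi>0 * D) = 6 * r0^10 + r0^11 * (2 * ?C * Y \<phi>0 - 3 * ?S * X \<phi>0)"
    using e1 e2 h by algebra
  then have "r0^3 * (qspeed \<phi>0 * D) = r0^3 * (r0^7 * (1 + r0 * Q \<phi>0))" unfolding Q_def by algebra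
  then have "qspeed \<phi>0 * D = r0^7 * (1 + r0 * Q \<phi>0)"
    by (rule mult_left_cancel[THEN iffD1, rotated]) (use assms(3) in simp)
  then have D: "D = r0^7 * (1 + r0 * Q \<phi>0) / qspeed \<phi>0" using qspeed_pos[of \<phi>0] by (simp add: field_simps)
  from a(1) a(2)[unfolded D] a(3)[unfolded \<rho>] a(4) show thesis by (rule that)
qed

text \<open>\<open>L\<close> is \<open>1/r\<close> plus a bounded function, and its derivative along solutions is
  \<open>r\<^sup>n\<^sup>+\<^sup>7 (V + O(r))\<close>. So a solution starting close to the origin gets trapped, forwards or
  backwards in time, in a region where \<open>L\<close> is strictly monotone, and cannot be periodic.\<close>

lemma not_center_if_lyapunov:
  fixes G g :: "nat \<Rightarrow> real \<Rightarrow> real"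
  assumes G: "\<And>k. k \<le> n \<Longrightarrow> tder (G k) (g k)" "\<And>k. k \<le> n \<Longrightarrow> per (G k)"
    and cont: "continuous_on UNIV (g n)" and per: "per (g n)"
    and c: "\<And>\<phi> r. - P \<phi> * (1 - (\<Sum>k\<le>n. real k * G k \<phi> * r ^ (k + 1))) + (1 + r * Q \<phi>) * (\<Sum>k\<le>n. g k \<phi> * r ^ k)
        = V * r ^ n + r ^ (n + 1) * (Q \<phi> * g n \<phi> + real n * P \<phi> * G n \<phi>)"
    and V: "V \<noteq> 0"
  shows "\<not> center_at_origin F"
proof
  assume "center_at_origin F"
  then obtain U where U: "0 \<in> interior U"
    "\<And>p. p \<in> U \<Longrightarrow> p \<noteq> 0 \<Longrightarrow> closed_orbit F (orbit F p) \<and> 0 \<in> inside (orbit F p)"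
    unfolding center_at_origin_def by blast
  define H where "H = (\<lambda>\<phi> r. \<Sum>k\<le>n. G k \<phi> * r ^ k)"
  have contG: "continuous_on UNIV (G k)" if "k \<le> n" for k using tder_continuous G that by blast
  have "per (\<lambda>\<phi>. Q \<phi> * g n \<phi> + real n * P \<phi> * G n \<phi>)"
    using G(2)[of n] per per_PQ by (simp add: per_def)
  then obtain K where K: "K > 0" "\<And>\<phi>. \<bar>Q \<phi> * g n \<phi> + real n * P \<phi> * G n \<phi>\<bar> \<le> K"
    by (rule per_bounded) (auto intro!: continuous_intros continuous_PQ contG cont)
  obtain B where B: "B > 0" "\<And>\<phi> r. 0 \<le> r \<Longrightarrow> r \<le> 1 \<Longrightarrow> \<bar>H \<phi> r\<bar> \<le> B"
  proof -
    have "\<exists>b>0. \<forall>\<phi>. \<bar>G k \<phi>\<bar> \<le> b" if "k \<le> n" for k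
      by (rule per_bounded[OF G(2)[OF that] contG[OF that]]) blast
    then obtain b where b: "\<And>k. k \<le> n \<Longrightarrow> b k > 0 \<and> (\<forall>\<phi>. \<bar>G k \<phi>\<bar> \<le> b k)" by metis
    have "\<bar>H \<phi> r\<bar> \<le> (\<Sum>k\<le>n. b k)" if "0 \<le> r" "r \<le> 1" for \<phi> r
    proof -
      have "\<bar>H \<phi> r\<bar> \<le> (\<Sum>k\<le>n. \<bar>G k \<phi> * r ^ k\<bar>)" unfolding H_def by (rule sum_abs)
      also have "\<dots> \<le> (\<Sum>k\<le>n. b k)"
      proof (rule sum_mono)
        fix k assume k: "k \<in> {..n}"
        have "\<bar>G k \<phi>\<bar> * r ^ k \<le> b k * 1"
          using b[of k] k that by (intro mult_mono power_le_one) auto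
        then show "\<bar>G k \<phi> * r ^ k\<bar> \<le> b k" using that by (simp add: abs_mult)
      qed
      finally show ?thesis .
    qed
    moreover have "(\<Sum>k\<le>n. b k) > 0" using b by (intro sum_pos) auto
    ultimately show thesis by (rule that[rotated])
  qed
  \<comment> \<open>Below the radius r1 the remainder, at most r K in size, cannot change the sign
    given by V.\<close>
  define r1 where "r1 = min 1 (\<bar>V\<bar> / (2 * K))"
  have r1: "0 < r1" "r1 \<le> 1" "r1 * K < \<bar>V\<bar>"
    using V K(1) by (auto simp: r1_def min_def field_simps)
  define \<sigma> where "\<sigma> = sgn V"
  have \<sigma>: "\<sigma> * V = \<bar>V\<bar>" "\<bar>\<sigma>\<bar> = 1" using V by (auto simp: \<sigma>_def sgn_if)
  \<comment> \<open>Starting at radius at most r2, L is at least 1/r2 - B = 1/r1 + B + 1, which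
    exceeds every value (at most 1/r1 + B) that it can have at radius r1.\<close>
  define r2 where "r2 = 1 / (1 / r1 + 2 * B + 1)"
  have r2: "0 < r2" "1 / r2 = 1 / r1 + 2 * B + 1" using r1 B(1) by (auto simp: r2_def add_pos_pos)
  have r21: "r2 < r1"
  proof -
    have "1 / r1 < 1 / r2" using r2 B(1) by simp
    then show ?thesis using inverse_less_imp_less[of r1 r2] r1(1) by (simp add: inverse_eq_divide)
  qed
  have "\<exists>r>0. r \<le> r2 \<and> emb 0 r \<in> U"
  proof -
    have "((\<lambda>r. emb 0 r) \<longlongrightarrow> emb 0 0) (at_right 0)" unfolding emb_def by (intro tendsto_intros)
    then have "\<forall>\<^sub>F r in at_right 0. emb 0 r \<in> interior U"
      by (rule topological_tendstoD) (use U(1) in \<open>auto simp: emb_def zero_prod_def\<close>)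
    moreover have "\<forall>\<^sub>F r in at_right 0. 0 < r \<and> r < r2"
      using r2(1) by (auto simp: eventually_at_right_field intro!: exI[of _ r2])
    ultimately have "\<forall>\<^sub>F r in at_right (0::real). r > 0 \<and> r \<le> r2 \<and> emb 0 r \<in> U"
      by eventually_elim (use interior_subset in auto)
    then show ?thesis using eventually_happens' trivial_limit_at_right_real by blast
  qed
  then obtain r where r: "0 < r" "r \<le> r2" "emb 0 r \<in> U" by blast
  define p where "p = emb 0 r"
  have orb: "closed_orbit F (orbit F p)" "0 \<in> inside (orbit F p)"
    using U(2)[OF r(3)] emb_nonzero[OF r(1)] by (auto simp: p_def)
  obtain z T where z: "solution_on F UNIV z" "T > 0" "\<And>t. z (t + T) = z t" "orbit F p = range z"
    using orb(1) unfolding closed_orbit_def by metis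
  have nz: "z t \<noteq> 0" for t
  proof
    assume "z t = 0"
    then have "0 \<in> orbit F p" using z(4) by (metis rangeI)
    moreover have "0 \<notin> orbit F p" using orb(2) inside_no_overlap[of "orbit F p"] by blast
    ultimately show False by simp
  qed
  \<comment> \<open>A solution through p exists because the orbit is nonempty: without one, the
    union defining it would be empty.\<close>
  have "z 0 \<in> orbit F p" using z(4) by simp
  then obtain y I where "0 \<in> I" "y 0 = p" "open I" "is_interval I" "solution_on F I y"
    unfolding orbit_def by blast
  then have "p \<in> orbit F p" unfolding orbit_def by (intro UnionI[of "y ` I"]) auto
  then obtain s0 where s0: "z s0 = p" using z(4) by auto
  \<comment> \<open>Time runs backwards when V < 0, so that L increases along w in either
    case.\<close>
  define w where "w = (\<lambda>t. z (s0 + \<sigma> * t))"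
  define ang where "ang = (\<lambda>p. SOME \<phi>. p = emb \<phi> (qnorm p))"
  have ang: "p = emb (ang p) (qnorm p)" if "p \<noteq> 0" for p
    unfolding ang_def by (rule someI_ex) (use emb_exists[OF that] in blast)
  define L where "L = (\<lambda>p. 1 / qnorm p + H (ang p) (qnorm p))"
  \<comment> \<open>The angle is determined only up to multiples of 2 pi. Periodicity of the
    \<open>G k\<close> makes L independent of the choice, so that it can be differentiated with a
    smooth branch.\<close>
  have LH: "L q = 1 / qnorm q + H \<phi> (qnorm q)" if "q = emb \<phi> (qnorm q)" "q \<noteq> 0" for q \<phi>
  proof -
    have "G k (ang q) = G k \<phi>" if k: "k \<le> n" for k
      by (rule per_emb[OF G(2)[OF k], of _ "qnorm q" _ "qnorm q"])
         (use that \<open>q = _\<close> \<open>q \<noteq> 0\<close> ang[of q] qnorm_pos[of q] in auto)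
    then show ?thesis by (simp add: L_def H_def)
  qed
  have Lw: "\<exists>D. ((\<lambda>t. L (w t)) has_real_derivative D) (at t) \<and> (qnorm (w t) < r1 \<longrightarrow> D > 0)" for t
  proof -
    define t' where "t' = s0 + \<sigma> * t"
    define \<phi>0 where "\<phi>0 = ang (z t')"
    define r0 where "r0 = qnorm (z t')"
    have r0: "r0 > 0" "z t' = emb \<phi>0 r0" using nz[of t'] ang qnorm_pos by (auto simp: r0_def \<phi>0_def)
    have "(z has_vector_derivative F (z t')) (at t')" using z(1) by (simp add: solution_on_def)
    from polar_solution[OF this r0(2,1)] obtain a where a: "a t' = \<phi>0"
      "(a has_real_derivative r0^7 * (1 + r0 * Q \<phi>0) / qspeed \<phi>0) (at t')"
      "((\<lambda>t. qnorm (z t)) has_real_derivative r0^9 * P \<phi>0) (at t')"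
      "\<forall>\<^sub>F t in nhds t'. z t = emb (a t) (qnorm (z t))" by blast
    define R where "R = (\<lambda>t. qnorm (z t))"
    have R: "(R has_real_derivative r0^9 * P \<phi>0) (at t')" "R t' = r0" using a(3) by (simp_all add: R_def r0_def)
    have Ga: "((\<lambda>t. G k (a t)) has_real_derivative g k \<phi>0 * (r0^7 * (1 + r0 * Q \<phi>0))) (at t')" if "k \<le> n" for k
    proof -
      have "((\<lambda>t. G k (a t)) has_real_derivative
          (qspeed \<phi>0 * g k \<phi>0) * (r0^7 * (1 + r0 * Q \<phi>0) / qspeed \<phi>0)) (at t')"
        by (rule DERIV_chain2[OF _ a(2)]) (use tderD[OF G(1)[OF that], of \<phi>0] a(1) in simp)
      then show ?thesis using qspeed_pos[of \<phi>0] by simp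
    qed
    have summand: "((\<lambda>t. G k (a t) * R t ^ k) has_real_derivative
        r0^7 * ((1 + r0 * Q \<phi>0) * (g k \<phi>0 * r0 ^ k) + P \<phi>0 * (real k * G k \<phi>0 * r0 ^ (k + 1)))) (at t')"
      if "k \<le> n" for k
    proof -
      have d: "((\<lambda>t. G k (a t) * R t ^ k) has_real_derivative
        g k \<phi>0 * (r0^7 * (1 + r0 * Q \<phi>0)) * r0 ^ k + (real k * r0 ^ (k - 1) * (r0^9 * P \<phi>0)) * G k \<phi>0) (at t')"
        by (rule derivative_eq_intros Ga[OF that] R refl)+ (simp add: R a(1))
      have e: "real k * r0 ^ (k - 1) * (r0^9 * P \<phi>0) = r0^7 * (P \<phi>0 * (real k * r0 ^ (k + 1)))"
      proof (cases k)
        case (Suc j)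
        have 9: "r0 ^ 9 = r0 ^ 7 * r0 ^ 2" by algebra
        have "real (Suc j) * r0 ^ j * (r0 ^ 9 * P \<phi>0) = r0 ^ 7 * (P \<phi>0 * (real (Suc j) * (r0 ^ j * r0 ^ 2)))"
          unfolding 9 by (simp only: ac_simps)
        then show ?thesis unfolding Suc by (simp only: power_add[symmetric]) simp
      qed simp
      show ?thesis using d unfolding e by (simp add: algebra_simps)
    qed
    have "((\<lambda>t. 1 / R t + (\<Sum>k\<le>n. G k (a t) * R t ^ k)) has_real_derivative
      - (r0^7 * P \<phi>0) + (\<Sum>k\<le>n. r0^7 * ((1 + r0 * Q \<phi>0) * (g k \<phi>0 * r0 ^ k) + P \<phi>0 * (real k * G k \<phi>0 * r0 ^ (k + 1))))) (at t')"
    proof (intro DERIV_add DERIV_sum summand)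
      have "((\<lambda>t. 1 / R t) has_real_derivative - (r0^9 * P \<phi>0) / r0^2) (at t')"
        using R r0(1) by (auto intro!: derivative_eq_intros simp: power2_eq_square)
      then show "((\<lambda>t. 1 / R t) has_real_derivative - (r0^7 * P \<phi>0)) (at t')"
        using r0(1) by (simp add: power_numeral_reduce field_simps)
    qed auto
    moreover have "- (r0^7 * P \<phi>0) + (\<Sum>k\<le>n. r0^7 * ((1 + r0 * Q \<phi>0) * (g k \<phi>0 * r0 ^ k) + P \<phi>0 * (real k * G k \<phi>0 * r0 ^ (k + 1))))
      = r0^7 * (- P \<phi>0 * (1 - (\<Sum>k\<le>n. real k * G k \<phi>0 * r0 ^ (k + 1))) + (1 + r0 * Q \<phi>0) * (\<Sum>k\<le>n. g k \<phi>0 * r0 ^ k))"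
      by (simp add: sum.distrib flip: sum_distrib_left) (simp add: algebra_simps)
    ultimately have d: "((\<lambda>t. 1 / R t + H (a t) (R t)) has_real_derivative
      r0^7 * (V * r0 ^ n + r0 ^ (n + 1) * (Q \<phi>0 * g n \<phi>0 + real n * P \<phi>0 * G n \<phi>0))) (at t')" (is "(_ has_real_derivative ?E) _")
      unfolding H_def by (simp only: c)
    have ev: "\<forall>\<^sub>F t in nhds t'. L (z t) = 1 / R t + H (a t) (R t)"
      using a(4) by eventually_elim (use LH nz in \<open>auto simp: R_def\<close>)
    have "((\<lambda>t. L (z t)) has_real_derivative ?E) (at t')"
      by (subst DERIV_cong_ev[OF refl ev refl]) (rule d)
    then have "((\<lambda>t. L (z (s0 + \<sigma> * t))) has_real_derivative ?E * \<sigma>) (at t)"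
      unfolding t'_def by (rule DERIV_chain2) (auto intro!: derivative_eq_intros)
    moreover have "?E * \<sigma> > 0" if "qnorm (w t) < r1"
    proof -
      have "r0 < r1" using that by (simp add: w_def r0_def t'_def)
      let ?q = "Q \<phi>0 * g n \<phi>0 + real n * P \<phi>0 * G n \<phi>0"
      have "\<bar>\<sigma> * (r0 * ?q)\<bar> = r0 * \<bar>?q\<bar>" using \<sigma>(2) r0(1) by (simp add: abs_mult)
      also have "\<dots> \<le> r1 * K" using \<open>r0 < r1\<close> r0(1) K by (intro mult_mono) auto
      finally have "\<sigma> * V + \<sigma> * (r0 * ?q) > 0" using r1(3) \<sigma>(1) by linarith
      then have "r0^7 * r0^n * (\<sigma> * V + \<sigma> * (r0 * ?q)) > 0" using r0(1) by simp
      then show ?thesis by (simp add: algebra_simps)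
    qed
    ultimately show ?thesis unfolding w_def by blast
  qed
  have qw: "qnorm (w t) > 0" for t by (simp add: w_def nz qnorm_pos)
  have Lb: "\<bar>L (w t) - 1 / qnorm (w t)\<bar> \<le> B" if "qnorm (w t) \<le> 1" for t
    unfolding L_def using B(2)[OF _ that] qw[of t] by simp
  have contw: "continuous_on UNIV (\<lambda>t. qnorm (w t))"
  proof -
    have "continuous_on UNIV z" using z(1) unfolding solution_on_def
      by (intro continuous_at_imp_continuous_on) (auto intro: has_vector_derivative_continuous)
    then show ?thesis unfolding w_def
      by (intro continuous_on_compose2[OF continuous_qnorm] continuous_on_compose2[OF \<open>continuous_on UNIV z\<close>])
         (auto intro!: continuous_intros)
  qed
  have w0: "qnorm (w 0) = r" using s0 r(1) by (simp add: w_def p_def)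
  have L0: "L (w 0) \<ge> 1 / r1 + B + 1"
  proof -
    have "1 / r2 \<le> 1 / r" using r r2 by (intro divide_left_mono) auto
    moreover have "L (w 0) \<ge> 1 / r - B" using Lb[of 0] w0 r r21 r1 by auto
    ultimately show ?thesis using r2(2) by linarith
  qed
  have incr: "L (w a) < L (w b)" if "a < b" "\<And>t. a < t \<Longrightarrow> t < b \<Longrightarrow> qnorm (w t) < r1" for a b
  proof (rule DERIV_pos_imp_increasing_open[OF that(1)])
    show "\<exists>y. ((\<lambda>t. L (w t)) has_real_derivative y) (at t) \<and> 0 < y" if "a < t" "t < b" for t
      using Lw[of t] \<open>\<And>t. a < t \<Longrightarrow> t < b \<Longrightarrow> qnorm (w t) < r1\<close>[OF that] by blast
    show "continuous_on {a..b} (\<lambda>t. L (w t))"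
      using Lw by (intro continuous_at_imp_continuous_on) (blast intro: DERIV_isCont)
  qed
  have trapped: "qnorm (w t) < r1" if "t \<ge> 0" for t
  proof (rule ccontr)
    assume neg: "\<not> qnorm (w t) < r1"
    \<comment> \<open>The least element of this set is the first time at which radius r1 is reached.
      Until then L has increased, yet at radius r1 it is below its initial value.\<close>
    define A where "A = {0..t} \<inter> {s. r1 \<le> qnorm (w s)}"
    have "compact A" unfolding A_def
      by (intro compact_Int_closed compact_Icc closed_Collect_le continuous_intros contw)
    moreover have "t \<in> A" using neg that by (simp add: A_def)
    then have "A \<noteq> {}" by blast
    ultimately obtain s where s: "s \<in> A" "\<And>u. u \<in> A \<Longrightarrow> s \<le> u" using compact_attains_inf[of A] by metis
    have sr: "r1 \<le> qnorm (w s)" "0 \<le> s" "s \<le> t" using s(1) by (auto simp: A_def)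
    have "s \<noteq> 0"
    proof
      assume "s = 0"
      with sr(1) w0 r(2) r21 show False by simp
    qed
    then have s0: "0 < s" using sr by auto
    have below: "qnorm (w u) < r1" if "0 \<le> u" "u < s" for u
    proof (rule ccontr)
      assume "\<not> qnorm (w u) < r1"
      then have "u \<in> A" using that sr by (simp add: A_def)
      with s(2)[of u] that show False by simp
    qed
    have "qnorm (w s) = r1"
    proof -
      have "((\<lambda>t. qnorm (w t)) \<longlongrightarrow> qnorm (w s)) (at_left s)"
        using contw by (auto simp: continuous_on_def intro: tendsto_within_subset)
      moreover have "\<forall>\<^sub>F u in at_left s. qnorm (w u) \<le> r1"
        using s0 below by (auto simp: eventually_at_left_field intro!: exI[of _ 0] less_imp_le)
      ultimately have "qnorm (w s) \<le> r1"
        by (intro tendsto_upperbound) auto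
      with sr show ?thesis by simp
    qed
    then have "L (w s) \<le> 1 / r1 + B" using Lb[of s] r1 by auto
    moreover have "L (w 0) < L (w s)" by (rule incr[OF s0]) (use below in auto)
    ultimately show False using L0 by linarith
  qed
  have "L (w 0) < L (w T)" by (rule incr[OF z(2)]) (use trapped in auto)
  moreover have "w T = w 0"
  proof (cases "\<sigma> = 1")
    case True
    then show ?thesis using z(3)[of s0] by (simp add: w_def)
  next
    case False
    then have "\<sigma> = -1" using \<sigma>(2) by (auto simp: abs_if split: if_splits)
    then show ?thesis using z(3)[of "s0 - T"] by (simp add: w_def)
  qed
  ultimately show False by simp
qed

end

section \<open>Means over one turn and the recursion for the coefficients\<close>

lemma qtrig_pi4: "qcos (pi / 4) > 0" "qsin (pi / 4) > 0"
  using gauge2(1)[of "pi / 4"] by (simp_all add: qcos_def qsin_def cos_45 sin_45)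

lemma circ_monomial_pos:
  assumes "even a" "even b"
  obtains I where "circ (\<lambda>\<phi>. qcos \<phi> ^ a * qsin \<phi> ^ b) I" "I > 0"
proof -
  have cont: "continuous_on UNIV (\<lambda>\<phi>. qcos \<phi> ^ a * qsin \<phi> ^ b)" by (intro continuous_intros continuous_qtrig)
  have "per (\<lambda>\<phi>. qcos \<phi> ^ a * qsin \<phi> ^ b)" by (simp add: per_def)
  from circ_exists[OF cont this] obtain I where I: "circ (\<lambda>\<phi>. qcos \<phi> ^ a * qsin \<phi> ^ b) I" ..
  then have "I > 0"
    by (rule circ_pos[of _ _ "pi / 4"]) (use assms qtrig_pi4 cont in \<open>auto simp: zero_le_even_power\<close>)
  with I show thesis by (rule that)
qed

lemma circ_one: obtains j where "circ (\<lambda>\<phi>. 1) j" "j > 0"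
  using circ_monomial_pos[of 0 0] by auto

text \<open>V is the mean of g: its integral divided by the length of one turn in the time
  \<theta>.\<close>

lemma periodic_primitive:
  assumes "circ g k" "continuous_on UNIV g" "k \<noteq> 0"
  obtains G V where "tder G (\<lambda>\<phi>. V - g \<phi>)" "per G" "V \<noteq> 0"
proof -
  obtain j where j: "circ (\<lambda>\<phi>. 1) j" "j > 0" by (rule circ_one)
  from circ_tder_exists[OF assms(1,2) j] obtain G where "tder G (\<lambda>\<phi>. k / j - g \<phi>)" "per G" by auto
  with j(2) assms(3) show thesis by (intro that[of G "k / j"]) auto
qed

context qh_field
begin

text \<open>Comparing powers of r in the derivative of 1/r + \<Sum> \<open>G k\<close> r^k
  determines \<open>g (Suc k)\<close> from \<open>g k\<close> and \<open>G k\<close>. The process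
  continues as long as the primitives are periodic; V enters at order n as the mean that prevents
  this.\<close>

lemma not_center_if_recursion:
  fixes G g :: "nat \<Rightarrow> real \<Rightarrow> real"
  assumes G: "\<And>k. k \<le> n \<Longrightarrow> tder (G k) (g k)" "\<And>k. k \<le> n \<Longrightarrow> per (G k)"
    and cont: "continuous_on UNIV (g n)" and per: "per (g n)"
    and g0: "\<And>\<phi>. g 0 \<phi> = P \<phi> + (if n = 0 then V else 0)"
    and gS: "\<And>k \<phi>. k < n \<Longrightarrow> g (Suc k) \<phi> = (if Suc k = n then V else 0) - (Q \<phi> * g k \<phi> + real k * P \<phi> * G k \<phi>)"
    and V: "V \<noteq> 0"
  shows "\<not> center_at_origin F"
proof (rule not_center_if_lyapunov[where n = n and G = G and g = g and V = V, OF G cont per _ V])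
  fix \<phi> r
  \<comment> \<open>Truncation at order m leaves only the products of order m + 1, which the next
    \<open>g\<close> cancels, up to V when m + 1 = n.\<close>
  have *: "- P \<phi> * (1 - (\<Sum>k\<le>m. real k * G k \<phi> * r ^ (k + 1))) + (1 + r * Q \<phi>) * (\<Sum>k\<le>m. g k \<phi> * r ^ k)
      = (if m = n then V * r ^ n else 0) + r ^ (m + 1) * (Q \<phi> * g m \<phi> + real m * P \<phi> * G m \<phi>)"
    if "m \<le> n" for m using that
  proof (induction m)
    case 0
    then show ?case using g0[of \<phi>] by (auto simp: algebra_simps)
  next
    case (Suc m)
    have e: "g (Suc m) \<phi> = (if Suc m = n then V else 0) - (Q \<phi> * g m \<phi> + real m * P \<phi> * G m \<phi>)"
      by (rule gS) (use Suc.prems in simp)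
    let ?L = "\<lambda>m. - P \<phi> * (1 - (\<Sum>k\<le>m. real k * G k \<phi> * r ^ (k + 1))) + (1 + r * Q \<phi>) * (\<Sum>k\<le>m. g k \<phi> * r ^ k)"
    have "?L (Suc m) = ?L m + P \<phi> * (real (Suc m) * G (Suc m) \<phi> * r ^ (Suc m + 1)) + (1 + r * Q \<phi>) * (g (Suc m) \<phi> * r ^ Suc m)"
      by (simp add: algebra_simps)
    also have "?L m = r ^ Suc m * (Q \<phi> * g m \<phi> + real m * P \<phi> * G m \<phi>)"
      using Suc by simp
    also have "\<dots> = r ^ Suc m * ((if Suc m = n then V else 0) - g (Suc m) \<phi>)" using e by simp
    finally show ?case by (auto simp: algebra_simps)
  qed
  show "- P \<phi> * (1 - (\<Sum>k\<le>n. real k * G k \<phi> * r ^ (k + 1))) + (1 + r * Q \<phi>) * (\<Sum>k\<le>n. g k \<phi> * r ^ k)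
      = V * r ^ n + r ^ (n + 1) * (Q \<phi> * g n \<phi> + real n * P \<phi> * G n \<phi>)"
    using *[of n] by simp
qed auto

text \<open>The terms of P that are odd under pi - \<phi> have mean zero. The derivative of C^5 S
  replaces C^10 by 10/3 C^4 S^4 in the mean, and (5 a50 + b41) / 3 times the integral of C^4 S^4
  remains.\<close>

lemma not_center_order0:
  assumes "5 * a50 + b41 \<noteq> 0"
  shows "\<not> center_at_origin F"
proof -
  obtain I where I: "circ (\<lambda>\<phi>. qcos \<phi> ^ 4 * qsin \<phi> ^ 4) I" "I > 0"
    by (rule circ_monomial_pos[of 4 4]) auto
  have t: "tder (\<lambda>\<phi>. qcos \<phi> ^ 5 * qsin \<phi>) (\<lambda>\<phi>. 3 * qcos \<phi> ^ 10 - 10 * qcos \<phi> ^ 4 * qsin \<phi> ^ 4)"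
    by (rule tder_cong, (rule tder_intros)+) (simp, algebra)
  have c1: "circ (\<lambda>\<phi>. 3 * qcos \<phi> ^ 10 - 10 * qcos \<phi> ^ 4 * qsin \<phi> ^ 4) 0"
    by (rule circ_tder[OF t]) (simp add: per_def)
  have c2: "circ (\<lambda>\<phi>. 3 * a22 * qcos \<phi> ^ 7 * qsin \<phi> ^ 2 + 2 * b13 * qcos \<phi> * qsin \<phi> ^ 6) 0"
    by (rule circ_refl) (auto intro!: continuous_intros continuous_qtrig simp: per_def)
  have "circ (\<lambda>\<phi>. - P \<phi>) (- (5 * a50 + b41) / 3 * I)"
    by (rule circ_cong[OF circ_add[OF circ_add[OF circ_cmult[OF c1, of "- a50 / 6"] circ_cmult[OF c2, of "- 1 / 6"]]
        circ_cmult[OF I(1), of "- (5 * a50 + b41) / 3"]]])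
       (simp_all add: P_def X_def Y_def, algebra)
  moreover have "continuous_on UNIV (\<lambda>\<phi>. - P \<phi>)" by (intro continuous_intros continuous_PQ)
  moreover have "- (5 * a50 + b41) / 3 * I \<noteq> 0" using assms I(2) by simp
  ultimately obtain G V where G: "tder G (\<lambda>\<phi>. V - (- P \<phi>))" "per G" "V \<noteq> 0"
    by (rule periodic_primitive)
  show ?thesis
    by (rule not_center_if_recursion[of 0 "\<lambda>_. G" "\<lambda>_ \<phi>. V + P \<phi>" V])
       (use G per_PQ in \<open>auto intro!: continuous_intros continuous_PQ simp: per_def\<close>)
qed

section \<open>Normal form of P and Q after order 0\<close>

definition \<beta> :: real where "\<beta> = (2 * b13 - 3 * a22) / 6"
text \<open>The coefficient (2 b41 - 3 a50) / 6 of C^5 S in Q, taken at a50 = - b41 / 5.\<close>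

definition B :: real where "B = 13 * b41 / 30"
text \<open>A thirteenth of the coefficient of x y^2 in the divergence.\<close>

definition \<delta> :: real where "\<delta> = (2 * a22 + 3 * b13) / 13"

definition Q' :: "real \<Rightarrow> real" where
  "Q' \<phi> = \<beta> * (9 * qcos \<phi> ^ 7 * qsin \<phi> ^ 2 - 4 * qcos \<phi> * qsin \<phi> ^ 6)
     + B * (3 * qcos \<phi> ^ 10 - 10 * qcos \<phi> ^ 4 * qsin \<phi> ^ 4)"

lemma Q_alt:
  assumes "5 * a50 + b41 = 0"
  shows "Q \<phi> = \<beta> * (qcos \<phi> ^ 2 * qsin \<phi> ^ 3) + B * (qcos \<phi> ^ 5 * qsin \<phi>)"
proof -
  have "a50 = - b41 / 5" using assms by simp
  then show ?thesis unfolding Q_def X_def Y_def \<beta>_def B_def by (simp add: field_simps) algebra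
qed

text \<open>The area element is 6 r^4 dr d\<theta>, so the divergence of the field is r^8 (13 P +
  Q'). Under the hypothesis it equals 13 \<delta> x y^2 = 13 \<delta> r^8 C S^2.\<close>

lemma P_alt:
  assumes "5 * a50 + b41 = 0"
  shows "P \<phi> = - Q' \<phi> / 13 + \<delta> * (qcos \<phi> * qsin \<phi> ^ 2)"
proof -
  have a: "b41 = - 5 * a50" using assms by simp
  have "78 * (P \<phi> - (- Q' \<phi> / 13 + \<delta> * (qcos \<phi> * qsin \<phi> ^ 2))) = 0"
    unfolding P_def X_def Y_def Q'_def \<beta>_def B_def \<delta>_def using qcos_qsin_pow[of \<phi>] a
    by (simp add: field_simps) algebra
  then show ?thesis by simp
qed

lemma tder_Q:
  assumes "5 * a50 + b41 = 0"
  shows "tder Q Q'"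
proof -
  have *: "Q = (\<lambda>\<phi>. \<beta> * (qcos \<phi> ^ 2 * qsin \<phi> ^ 3) + B * (qcos \<phi> ^ 5 * qsin \<phi>))"
    using Q_alt[OF assms] by blast
  show ?thesis unfolding *
    by (rule tder_cong, (rule tder_intros)+) (simp add: Q'_def, algebra)
qed

end

section \<open>The coefficients of order 0, 2 and 4\<close>

lemma primitive_M:
  obtains M where "tder M (\<lambda>\<phi>. qcos \<phi> * qsin \<phi> ^ 2)" "M 0 = 0" "per M"
    "\<And>\<phi>. M (- \<phi>) = - M \<phi>" "\<And>\<phi>. M (pi - \<phi>) = M \<phi>"
proof -
  have "continuous_on UNIV (\<lambda>\<phi>. qcos \<phi> * qsin \<phi> ^ 2)" by (intro continuous_intros continuous_qtrig)
  from tder_exists[OF this, of 0] obtain M where M: "M 0 = 0" "tder M (\<lambda>\<phi>. qcos \<phi> * qsin \<phi> ^ 2)" by blast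
  show thesis
    by (rule that[OF M(2,1) tder_refl_per[OF M(2)] tder_even[OF M(2)] tder_refl[OF M(2)]])
       (use M in \<open>simp_all add: per_def\<close>)
qed

lemma primitive_E:
  obtains E where "tder E (\<lambda>\<phi>. qcos \<phi> ^ 3 * qsin \<phi> ^ 5)" "per E" "\<And>\<phi>. E (pi - \<phi>) = E \<phi>"
proof -
  have "continuous_on UNIV (\<lambda>\<phi>. qcos \<phi> ^ 3 * qsin \<phi> ^ 5)" by (intro continuous_intros continuous_qtrig)
  from tder_exists[OF this, of 0] obtain E where E: "E 0 = 0" "tder E (\<lambda>\<phi>. qcos \<phi> ^ 3 * qsin \<phi> ^ 5)" by blast
  show thesis
    by (rule that[OF E(2) tder_refl_per[OF E(2)] tder_refl[OF E(2)]])
       (simp_all add: per_def)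
qed

text \<open>The two reflections and the period carry every angle into the first quarter.\<close>

lemma symmetric_nonneg:
  assumes "per f" "\<And>\<phi>. f (- \<phi>) = f \<phi>" "\<And>\<phi>. f (pi - \<phi>) = f \<phi>"
    and pos: "\<And>\<phi>. 0 \<le> \<phi> \<Longrightarrow> \<phi> \<le> pi / 2 \<Longrightarrow> f \<phi> \<ge> 0"
  shows "f \<phi> \<ge> (0::real)"
proof -
  have 1: "f \<phi> \<ge> 0" if "0 \<le> \<phi>" "\<phi> \<le> pi" for \<phi>
    using pos[of \<phi>] pos[of "pi - \<phi>"] assms(3)[of \<phi>] that by (cases "\<phi> \<le> pi / 2") auto
  obtain \<psi> where \<psi>: "\<psi> \<in> {- pi..- pi + 2 * pi}" "f \<phi> = f \<psi>" by (rule per_reduceE[OF assms(1)])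
  then show ?thesis using 1[of \<psi>] 1[of "- \<psi>"] assms(2)[of \<psi>] by (cases "\<psi> \<ge> 0") auto
qed

text \<open>On the first quarter S^3 / (9 C^4) - M starts at 0 and has \<theta>-derivative 8 S^6 /
  (9 C^5) \<ge> 0. Multiplying by 9 C^4 S clears the denominator and makes both sides invariant
  under the two reflections.\<close>

lemma primitive_M_bound:
  assumes M: "tder M (\<lambda>\<phi>. qcos \<phi> * qsin \<phi> ^ 2)" "M 0 = 0" "per M"
    "\<And>\<phi>. M (- \<phi>) = - M \<phi>" "\<And>\<phi>. M (pi - \<phi>) = M \<phi>"
  shows "9 * (M \<phi> * qsin \<phi> * qcos \<phi> ^ 4) \<le> qsin \<phi> ^ 4"
proof -
  have "0 \<le> qsin \<phi> ^ 4 - 9 * (M \<phi> * qsin \<phi> * qcos \<phi> ^ 4)"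
  proof (rule symmetric_nonneg[where f = "\<lambda>\<phi>. qsin \<phi> ^ 4 - 9 * (M \<phi> * qsin \<phi> * qcos \<phi> ^ 4)"])
    fix \<phi> :: real assume \<phi>: "0 \<le> \<phi>" "\<phi> \<le> pi / 2"
    show "0 \<le> qsin \<phi> ^ 4 - 9 * (M \<phi> * qsin \<phi> * qcos \<phi> ^ 4)"
    proof (cases "\<phi> = pi / 2")
      case True
      have "qcos \<phi> = 0" unfolding qcos_def True cos_pi_half by simp
      then show ?thesis by simp
    next
      case False
      define h where "h = (\<lambda>\<phi>. qsin \<phi> ^ 3 / (9 * qcos \<phi> ^ 4) - M \<phi>)"
      have pos: "qcos x > 0" "qsin x \<ge> 0" if "0 \<le> x" "x \<le> \<phi>" for x
        using that \<phi> False gauge2(1)[of x] cos_gt_zero_pi[of x] sin_ge_zero[of x] by (auto simp: qcos_def qsin_def)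
      have "h 0 \<le> h \<phi>"
      proof (rule DERIV_nonneg_imp_nondecreasing[OF \<phi>(1)])
        fix x assume x: "0 \<le> x" "x \<le> \<phi>"
        let ?C = "qcos x" and ?S = "qsin x" and ?k = "qspeed x"
        have C: "?C > 0" "?S \<ge> 0" by (rule pos[OF x])+
        have "(h has_real_derivative (((3 * ?S^2 * (?k * (3 * ?C^5))) * (9 * ?C^4) - ?S^3 * (9 * (4 * ?C^3 * (?k * (-2 * ?S^3)))))
          / (9 * ?C^4)^2) - ?k * (?C * ?S^2)) (at x)"
          unfolding h_def using C
          by (auto intro!: derivative_eq_intros qtrig_derivs tderD[OF M(1)] simp: power2_eq_square)
        moreover have "(((3 * ?S^2 * (?k * (3 * ?C^5))) * (9 * ?C^4) - ?S^3 * (9 * (4 * ?C^3 * (?k * (-2 * ?S^3)))))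
          / (9 * ?C^4)^2) - ?k * (?C * ?S^2) = ?k * (8 * ?S^6 / (9 * ?C^5))"
          using C by (simp add: divide_simps) algebra
        moreover have "?k * (8 * ?S^6 / (9 * ?C^5)) \<ge> 0" using C qspeed_pos[of x] by simp
        ultimately show "\<exists>y. (h has_real_derivative y) (at x) \<and> 0 \<le> y" by auto
      qed
      then have "M \<phi> \<le> qsin \<phi> ^ 3 / (9 * qcos \<phi> ^ 4)" by (simp add: h_def M(2) qsin_def)
      then have "M \<phi> * (9 * qcos \<phi> ^ 4) \<le> qsin \<phi> ^ 3" using pos[of \<phi>] \<phi> by (simp add: pos_le_divide_eq)
      then have "M \<phi> * (9 * qcos \<phi> ^ 4) * qsin \<phi> \<le> qsin \<phi> ^ 3 * qsin \<phi>"
        using pos[of \<phi>] \<phi> by (intro mult_right_mono) auto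
      also have "\<dots> = qsin \<phi> ^ 4" by algebra
      finally show ?thesis by (simp add: algebra_simps)
    qed
  qed (use M in \<open>simp_all add: per_def\<close>)
  then show ?thesis by simp
qed

context qh_field
begin

abbreviation m :: "real \<Rightarrow> real" where "m \<phi> \<equiv> qcos \<phi> * qsin \<phi> ^ 2"

text \<open>This is what remains of -Q P once the exact part Q Q'/13 is split off. The primitive is
  periodic with E for all parameters, so order 1 gives no condition.\<close>

lemma tder_gamma1:
  assumes "5 * a50 + b41 = 0" "tder E (\<lambda>\<phi>. qcos \<phi> ^ 3 * qsin \<phi> ^ 5)"
  shows "tder (\<lambda>\<phi>. \<delta> * (B / 14 * qcos \<phi> ^ 7 - \<beta> * E \<phi>)) (\<lambda>\<phi>. - \<delta> * m \<phi> * Q \<phi>)"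
  by (rule tder_cong, (rule tder_intros assms(2))+) (simp add: Q_alt[OF assms(1)] field_simps, algebra)

text \<open>In the mean of \<open>h\<close> only the terms linear in B survive, the others being odd
  under pi - \<phi>. The derivative of C^9 S^3 replaces C^8 S^2 by 3 C^8 S^6, whence 3 \<delta>/14
  against 27 \<beta>/13.\<close>

lemma not_center_order2:
  assumes div0: "5 * a50 + b41 = 0" and nz: "B \<noteq> 0" "\<delta> \<noteq> 0" "3 * \<delta> / 14 - 27 * \<beta> / 13 \<noteq> 0"
  shows "\<not> center_at_origin F"
proof -
  obtain M where M: "tder M m" "per M" by (rule primitive_M)
  obtain E where E: "tder E (\<lambda>\<phi>. qcos \<phi> ^ 3 * qsin \<phi> ^ 5)" "per E" "\<And>\<phi>. E (pi - \<phi>) = E \<phi>"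
    using primitive_E by blast
  obtain I where I: "circ (\<lambda>\<phi>. qcos \<phi> ^ 8 * qsin \<phi> ^ 6) I" "I > 0"
    by (rule circ_monomial_pos[of 8 6]) auto
  define \<gamma>1 where "\<gamma>1 = (\<lambda>\<phi>. \<delta> * (B / 14 * qcos \<phi> ^ 7 - \<beta> * E \<phi>))"
  have \<gamma>1: "tder \<gamma>1 (\<lambda>\<phi>. - \<delta> * m \<phi> * Q \<phi>)" "per \<gamma>1"
    unfolding \<gamma>1_def by (rule tder_gamma1[OF div0 E(1)]) (use E(2) in \<open>simp add: per_def\<close>)
  note Q = tder_Q[OF div0] and Palt = P_alt[OF div0]
  note conts = continuous_PQ continuous_qtrig tder_continuous[OF \<gamma>1(1)] tder_continuous[OF E(1)]
  define h where "h = (\<lambda>\<phi>. \<delta> * m \<phi> * \<gamma>1 \<phi> - 27 / 26 * \<delta> * m \<phi> * Q \<phi> ^ 2)"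
  have conth: "continuous_on UNIV h" unfolding h_def by (intro continuous_intros conts)
  have t: "tder (\<lambda>\<phi>. qcos \<phi> ^ 9 * qsin \<phi> ^ 3) (\<lambda>\<phi>. 9 * qcos \<phi> ^ 8 * qsin \<phi> ^ 2 - 27 * qcos \<phi> ^ 8 * qsin \<phi> ^ 6)"
    apply (rule tder_cong, (rule tder_intros)+)
    subgoal for \<phi> using qcos_qsin_pow[of \<phi>] by (simp, algebra)
    done
  have c1: "circ (\<lambda>\<phi>. 9 * qcos \<phi> ^ 8 * qsin \<phi> ^ 2 - 27 * qcos \<phi> ^ 8 * qsin \<phi> ^ 6) 0"
    by (rule circ_tder[OF t]) (simp add: per_def)
  let ?odd = "\<lambda>\<phi>. \<delta>\<^sup>2 * \<beta> * m \<phi> * E \<phi> + 27 / 26 * \<delta> * m \<phi> *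
      (\<beta>\<^sup>2 * (qcos \<phi> ^ 2 * qsin \<phi> ^ 3)\<^sup>2 + B\<^sup>2 * (qcos \<phi> ^ 5 * qsin \<phi>)\<^sup>2)"
  have c2: "circ ?odd 0"
    by (rule circ_refl) (use E(2,3) in \<open>auto intro!: continuous_intros conts simp: per_def power_mult_distrib\<close>)
  have hc: "circ h (\<delta> * B * (3 * \<delta> / 14 - 27 * \<beta> / 13) * I)"
  proof (rule circ_cong[OF circ_add[OF circ_add[OF circ_cmult[OF c1, of "\<delta>\<^sup>2 * B / 126"] circ_cmult[OF c2, of "- 1"]]
        circ_cmult[OF I(1), of "\<delta> * B * (3 * \<delta> / 14 - 27 * \<beta> / 13)"]]])
    fix \<phi>
    show "\<delta>\<^sup>2 * B / 126 * (9 * qcos \<phi> ^ 8 * (qsin \<phi>)\<^sup>2 - 27 * qcos \<phi> ^ 8 * qsin \<phi> ^ 6) + - 1 * ?odd \<phi> +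
        \<delta> * B * (3 * \<delta> / 14 - 27 * \<beta> / 13) * (qcos \<phi> ^ 8 * qsin \<phi> ^ 6) = h \<phi>"
      unfolding h_def \<gamma>1_def Q_alt[OF div0] by (simp add: field_simps) algebra
  qed simp
  have "\<delta> * B * (3 * \<delta> / 14 - 27 * \<beta> / 13) * I \<noteq> 0" using nz I(2) by simp
  from periodic_primitive[OF hc conth this] obtain \<gamma>2 V
    where \<gamma>2: "tder \<gamma>2 (\<lambda>\<phi>. V - h \<phi>)" "per \<gamma>2" and V: "V \<noteq> 0" by metis
  \<comment> \<open>The coefficients come from integration by parts: terms containing Q' are
    absorbed into total derivatives, so that apart from V only multiples of \<delta> C S^2 are left
    for the derivatives of \<gamma>1 and \<gamma>2.\<close>
  define G0 where "G0 = (\<lambda>\<phi>. \<delta> * M \<phi> - 1 / 13 * Q \<phi>)"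
  define G1 where "G1 = (\<lambda>\<phi>. 1 / 26 * Q \<phi> ^ 2 + \<gamma>1 \<phi>)"
  define G2 where "G2 = (\<lambda>\<phi>. 1 / 13 * Q \<phi> * \<gamma>1 \<phi> - 25 / 1014 * Q \<phi> ^ 3 + \<gamma>2 \<phi>)"
  define g2 where "g2 = (\<lambda>\<phi>. V - (Q \<phi> * (- Q \<phi> * P \<phi>) + P \<phi> * G1 \<phi>))"
  have t0: "tder G0 P" unfolding G0_def
    by (rule tder_cong, (rule tder_intros Q M)+) (simp add: Palt)
  have t1: "tder G1 (\<lambda>\<phi>. - Q \<phi> * P \<phi>)" unfolding G1_def
    by (rule tder_cong, (rule tder_intros Q \<gamma>1)+) (simp add: Palt field_simps)
  have t2: "tder G2 g2" unfolding G2_def g2_def G1_def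
    by (rule tder_cong, (rule tder_intros Q \<gamma>1 \<gamma>2)+) (simp add: Palt h_def field_simps, algebra)
  have p: "per G0" "per G1" "per G2" "per g2"
    using M(2) \<gamma>1(2) \<gamma>2(2) per_PQ by (simp_all add: per_def G0_def G1_def G2_def g2_def)
  have cg: "continuous_on UNIV g2" unfolding g2_def G1_def by (intro continuous_intros conts)
  have le2: "k = 0 \<or> k = 1 \<or> k = 2" if "k \<le> 2" for k :: nat using that by auto
  show ?thesis
  proof (rule not_center_if_recursion[where n = 2 and V = V
        and G = "\<lambda>k. if k = 0 then G0 else if k = 1 then G1 else G2"
        and g = "\<lambda>k. if k = 0 then P else if k = 1 then (\<lambda>\<phi>. - Q \<phi> * P \<phi>) else g2"])
    fix k \<phi> assume "k < (2::nat)"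
    then have "k = 0 \<or> k = 1" by auto
    then show "(if Suc k = 0 then P else if Suc k = 1 then (\<lambda>\<phi>. - Q \<phi> * P \<phi>) else g2) \<phi> =
      (if Suc k = 2 then V else 0) - (Q \<phi> * (if k = 0 then P else if k = 1 then (\<lambda>\<phi>. - Q \<phi> * P \<phi>) else g2) \<phi>
       + real k * P \<phi> * (if k = 0 then G0 else if k = 1 then G1 else G2) \<phi>)"
      by (auto simp: g2_def)
  qed (use le2 t0 t1 t2 p cg V in auto)
qed

end

text \<open>All variables but the parameters are values at one angle, with g that of \<gamma>3. The
  first summand collects even powers of B and is odd under pi - \<phi>. The second is the derivative
  of 3 \<delta> M \<gamma>3: an integration by parts trades \<gamma>3 for the explicit
  \<open>g3\<close>. The last collects odd powers of B.\<close>

lemma order4_parity_split: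
  fixes C S M E K \<beta> B \<delta> g :: real
  defines "Q \<equiv> \<beta> * (C^2 * S^3) + B * (C^5 * S)" and "m \<equiv> C * S^2"
  defines "\<gamma>1 \<equiv> \<delta> * (B / 14 * C ^ 7 - \<beta> * E)" and "\<gamma>2 \<equiv> K - \<beta> * \<delta> * B / 13 * (C ^ 9 * S ^ 3)"
  defines "g3 \<equiv> \<delta> * m * Q * \<gamma>1 - 2 * \<delta> * m * \<gamma>2 - 560 / 507 * \<delta> * m * Q ^ 3"
  shows "3 * \<delta> * m * g + 27 / 26 * \<delta> * m * Q ^ 2 * \<gamma>1 - 2 * \<delta> * m * Q * \<gamma>2 - 63017 / 52728 * \<delta> * m * Q ^ 4 =
   \<delta> * m * (
      27 / 26 * \<delta> * (B\<^sup>2 * \<beta> / 7 * (C ^ 14 * S ^ 4) - (\<beta>\<^sup>2 * (C ^ 4 * S ^ 6) + B\<^sup>2 * (C ^ 10 * S ^ 2)) * \<beta> * E)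
      - 2 * (\<beta> * (C ^ 2 * S ^ 3) * K - B\<^sup>2 * \<beta> * \<delta> / 13 * (C ^ 14 * S ^ 4))
      - 63017 / 52728 * (\<beta>^4 * (C ^ 8 * S ^ 12) + 6 * \<beta>\<^sup>2 * B\<^sup>2 * (C ^ 14 * S ^ 8) + B^4 * (C ^ 20 * S ^ 4))
      - 3 * \<delta>\<^sup>2 * M * (B\<^sup>2 / 14 * (C ^ 12 * S) - \<beta>\<^sup>2 * (C ^ 2 * S ^ 3) * E)
      + 6 * \<delta> * M * K
      + 560 / 169 * \<delta> * M * (\<beta>^3 * (C ^ 6 * S ^ 9) + 3 * \<beta> * B\<^sup>2 * (C ^ 12 * S ^ 5))) +
   3 * \<delta> * (m * g + M * g3) +
   \<delta> * m * (
      27 / 26 * \<delta> * ((\<beta>\<^sup>2 * (C ^ 4 * S ^ 6) + B\<^sup>2 * (C ^ 10 * S ^ 2)) * (B / 14 * C ^ 7) - 2 * \<beta>\<^sup>2 * B * (C ^ 7 * S ^ 4) * E)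
      - 2 * (B * (C ^ 5 * S) * K - \<beta>\<^sup>2 * \<delta> * B / 13 * (C ^ 11 * S ^ 6))
      - 63017 / 13182 * (\<beta>^3 * B * (C ^ 11 * S ^ 10) + \<beta> * B^3 * (C ^ 17 * S ^ 6))
      - 3 * \<delta>\<^sup>2 * M * \<beta> * B * (C ^ 9 * S ^ 3 / 14 - C ^ 5 * S * E)
      - 6 / 13 * \<delta>\<^sup>2 * \<beta> * B * M * (C ^ 9 * S ^ 3)
      + 560 / 169 * \<delta> * M * (3 * \<beta>\<^sup>2 * B * (C ^ 9 * S ^ 7) + B^3 * (C ^ 15 * S ^ 3)))"
  unfolding g3_def \<gamma>1_def \<gamma>2_def m_def Q_def by (simp add: field_simps, algebra)

text \<open>All brackets on the right but the last are combinations of the \<theta>-derivatives of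
  C^9 S^3 E, C^13 S^9, C^7 E M, C^11 S^6 M, C^7 K and C^19 S^5, with coefficients that absorb
  everything linear in B. The cubic remainder pairs M C^16 S^5 with C^12 S^8 / 9 in order that
  \<open>primitive_M_bound\<close> applies.\<close>

lemma order4_exact_part:
  fixes C S M E K \<beta> B \<delta> g :: real
  assumes "\<delta> = 126 / 13 * \<beta>" "C^6 + S^4 = 1"
  defines "m \<equiv> C * S^2"
  defines "K' \<equiv> m * (27 / 26 * \<delta> * (\<beta>\<^sup>2 * (C ^ 4 * S ^ 6) + B\<^sup>2 * (C ^ 10 * S ^ 2)) + \<delta>\<^sup>2 * \<beta> * E)"
  shows "\<delta> * m * (
      27 / 26 * \<delta> * ((\<beta>\<^sup>2 * (C ^ 4 * S ^ 6) + B\<^sup>2 * (C ^ 10 * S ^ 2)) * (B / 14 * C ^ 7) - 2 * \<beta>\<^sup>2 * B * (C ^ 7 * S ^ 4) * E)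
      - 2 * (B * (C ^ 5 * S) * K - \<beta>\<^sup>2 * \<delta> * B / 13 * (C ^ 11 * S ^ 6))
      - 63017 / 13182 * (\<beta>^3 * B * (C ^ 11 * S ^ 10) + \<beta> * B^3 * (C ^ 17 * S ^ 6))
      - 3 * \<delta>\<^sup>2 * M * \<beta> * B * (C ^ 9 * S ^ 3 / 14 - C ^ 5 * S * E)
      - 6 / 13 * \<delta>\<^sup>2 * \<beta> * B * M * (C ^ 9 * S ^ 3)
      + 560 / 169 * \<delta> * M * (3 * \<beta>\<^sup>2 * B * (C ^ 9 * S ^ 7) + B^3 * (C ^ 15 * S ^ 3))) =
     B * \<beta>^4 * (
        15876 / 2197 * (C ^ 12 * S ^ 8 + (9 * C ^ 14 * S ^ 2 - 18 * C ^ 8 * S ^ 6) * E)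
      + 24969 / 28561 * (27 * C ^ 18 * S ^ 8 - 26 * C ^ 12 * S ^ 12)
      - 428652 / 2197 * (C ^ 10 * S ^ 5 * M + C ^ 8 * S ^ 2 * E - 14 * C ^ 6 * S ^ 3 * E * M)
      - 666792 / 28561 * (C ^ 12 * S ^ 8 + (18 * C ^ 16 * S ^ 5 - 22 * C ^ 10 * S ^ 9) * M))
      + 18 / 13 * \<beta> * B * (C ^ 7 * K' - 14 * C ^ 6 * S ^ 3 * K)
      - B^3 * \<beta>^2 * (5103 / 10985 * (15 * C ^ 24 * S ^ 4 - 38 * C ^ 18 * S ^ 8)
      + 493920 / 371293 * (27 * C ^ 18 * S ^ 8 - 26 * C ^ 12 * S ^ 12)) +
     \<beta>\<^sup>2 * B ^ 3 * (8890560 / 28561 * (M * C ^ 16 * S ^ 5 - C ^ 12 * S ^ 8 / 9)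
      - 836976 / 1856465 * (C ^ 18 * S ^ 8))"
  using assms(1,2) unfolding K'_def m_def by algebra

context qh_field
begin

text \<open>The mean of order 4 is a nonzero multiple of \<beta>^2 B^3 times the integral of a
  function \<open>W\<close> that is nonpositive and not identically zero.\<close>

lemma not_center_order4:
  assumes div0: "5 * a50 + b41 = 0" and nz: "B \<noteq> 0" "\<beta> \<noteq> 0" and \<delta>: "\<delta> = 126 / 13 * \<beta>"
  shows "\<not> center_at_origin F"
proof -
  obtain M where M: "tder M m" "M 0 = 0" "per M" "\<And>\<phi>. M (- \<phi>) = - M \<phi>" "\<And>\<phi>. M (pi - \<phi>) = M \<phi>"
    using primitive_M by blast
  obtain E where E: "tder E (\<lambda>\<phi>. qcos \<phi> ^ 3 * qsin \<phi> ^ 5)" "per E" "\<And>\<phi>. E (pi - \<phi>) = E \<phi>"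
    using primitive_E by blast
  have E_even: "E (- \<phi>) = E \<phi>" for \<phi> by (rule tder_odd[OF E(1)]) simp
  define \<gamma>1 where "\<gamma>1 = (\<lambda>\<phi>. \<delta> * (B / 14 * qcos \<phi> ^ 7 - \<beta> * E \<phi>))"
  have \<gamma>1: "tder \<gamma>1 (\<lambda>\<phi>. - \<delta> * m \<phi> * Q \<phi>)" "per \<gamma>1"
    unfolding \<gamma>1_def by (rule tder_gamma1[OF div0 E(1)]) (use E(2) in \<open>simp add: per_def\<close>)
  note Q = tder_Q[OF div0] and Palt = P_alt[OF div0] and Qalt = Q_alt[OF div0]
  note conts = continuous_PQ continuous_qtrig tder_continuous[OF \<gamma>1(1)] tder_continuous[OF E(1)] tder_continuous[OF M(1)]
  define K' where "K' = (\<lambda>\<phi>. m \<phi> * (27 / 26 * \<delta> * (\<beta>\<^sup>2 * (qcos \<phi> ^ 4 * qsin \<phi> ^ 6)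
      + B\<^sup>2 * (qcos \<phi> ^ 10 * qsin \<phi> ^ 2)) + \<delta>\<^sup>2 * \<beta> * E \<phi>))"
  have "continuous_on UNIV K'" unfolding K'_def by (intro continuous_intros conts)
  then obtain K where K: "K 0 = 0" "tder K K'" using tder_exists by blast
  have K_odd: "K (- \<phi>) = - K \<phi>" for \<phi>
    by (rule tder_even[OF K(2) _ K(1)]) (simp add: K'_def E_even)
  have K'_refl: "K' (pi - \<phi>) = - K' \<phi>" for \<phi> by (simp add: K'_def E)
  have K_refl: "K (pi - \<phi>) = K \<phi>" for \<phi> by (rule tder_refl[OF K(2) K'_refl])
  have K_per: "per K" by (rule tder_refl_per[OF K(2) _ K'_refl]) (use E(2) in \<open>simp add: per_def K'_def\<close>)
  \<comment> \<open>K takes the even powers of B. The linear part of the derivative is a multiple of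
    27 C^8 S^6 - 9 C^8 S^2, minus the derivative of C^9 S^3, precisely on the line \<delta> = 126/13
    \<beta>.\<close>
  define \<gamma>2 where "\<gamma>2 = (\<lambda>\<phi>. K \<phi> - \<beta> * \<delta> * B / 13 * (qcos \<phi> ^ 9 * qsin \<phi> ^ 3))"
  have \<gamma>2: "tder \<gamma>2 (\<lambda>\<phi>. 27 / 26 * \<delta> * m \<phi> * Q \<phi> ^ 2 - \<delta> * m \<phi> * \<gamma>1 \<phi>)" "per \<gamma>2"
  proof -
    show "tder \<gamma>2 (\<lambda>\<phi>. 27 / 26 * \<delta> * m \<phi> * Q \<phi> ^ 2 - \<delta> * m \<phi> * \<gamma>1 \<phi>)" unfolding \<gamma>2_def
      apply (rule tder_cong, (rule tder_intros K)+)
      subgoal for \<phi> using qcos_qsin_pow[of \<phi>] unfolding Qalt \<gamma>1_def K'_def \<delta> by (simp add: field_simps, algebra)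
      done
    show "per \<gamma>2" using K_per by (simp add: per_def \<gamma>2_def)
  qed
  note conts = conts tder_continuous[OF \<gamma>2(1)] tder_continuous[OF K(2)]
  define g3 where "g3 = (\<lambda>\<phi>. \<delta> * m \<phi> * Q \<phi> * \<gamma>1 \<phi> - 2 * \<delta> * m \<phi> * \<gamma>2 \<phi> - 560 / 507 * \<delta> * m \<phi> * Q \<phi> ^ 3)"
  have "continuous_on UNIV g3" unfolding g3_def by (intro continuous_intros conts)
  then obtain \<gamma>3 where \<gamma>3: "tder \<gamma>3 g3" using tder_exists by blast
  \<comment> \<open>\<open>g3\<close> is odd under - \<phi>, so there is no obstruction at order
    3.\<close>
  have per3: "per \<gamma>3"
  proof (rule tder_odd_per[OF \<gamma>3])
    show "per g3" using \<gamma>1(2) \<gamma>2(2) per_PQ(2) by (simp add: per_def g3_def)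
    fix \<phi>
    have "Q (- \<phi>) = - Q \<phi>" "\<gamma>1 (- \<phi>) = \<gamma>1 \<phi>" "\<gamma>2 (- \<phi>) = - \<gamma>2 \<phi>"
      by (simp_all add: Qalt \<gamma>1_def \<gamma>2_def E_even K_odd)
    then show "g3 (- \<phi>) = - g3 \<phi>" by (simp add: g3_def)
  qed
  note conts = conts tder_continuous[OF \<gamma>3]
  define h where "h = (\<lambda>\<phi>. 3 * \<delta> * m \<phi> * \<gamma>3 \<phi> + 27 / 26 * \<delta> * m \<phi> * Q \<phi> ^ 2 * \<gamma>1 \<phi>
      - 2 * \<delta> * m \<phi> * Q \<phi> * \<gamma>2 \<phi> - 63017 / 52728 * \<delta> * m \<phi> * Q \<phi> ^ 4)"
  have conth: "continuous_on UNIV h" unfolding h_def by (intro continuous_intros conts)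
  define Z where "Z = (\<lambda>\<phi>. 3 * \<delta> * (M \<phi> * \<gamma>3 \<phi>) + B * \<beta>^4 * (15876 / 2197 * (qcos \<phi> ^ 9 * qsin \<phi> ^ 3 * E \<phi>)
      + 24969 / 28561 * (qcos \<phi> ^ 13 * qsin \<phi> ^ 9) - 428652 / 2197 * (qcos \<phi> ^ 7 * E \<phi> * M \<phi>)
      - 666792 / 28561 * (qcos \<phi> ^ 11 * qsin \<phi> ^ 6 * M \<phi>)) + 18 / 13 * \<beta> * B * (qcos \<phi> ^ 7 * K \<phi>)
      - B^3 * \<beta>^2 * (5103 / 10985 * (qcos \<phi> ^ 19 * qsin \<phi> ^ 5) + 493920 / 371293 * (qcos \<phi> ^ 13 * qsin \<phi> ^ 9)))"
  define Z' where "Z' = (\<lambda>\<phi>. 3 * \<delta> * (m \<phi> * \<gamma>3 \<phi> + M \<phi> * g3 \<phi>) + B * \<beta>^4 * (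
        15876 / 2197 * (qcos \<phi> ^ 12 * qsin \<phi> ^ 8 + (9 * qcos \<phi> ^ 14 * qsin \<phi> ^ 2 - 18 * qcos \<phi> ^ 8 * qsin \<phi> ^ 6) * E \<phi>)
      + 24969 / 28561 * (27 * qcos \<phi> ^ 18 * qsin \<phi> ^ 8 - 26 * qcos \<phi> ^ 12 * qsin \<phi> ^ 12)
      - 428652 / 2197 * (qcos \<phi> ^ 10 * qsin \<phi> ^ 5 * M \<phi> + qcos \<phi> ^ 8 * qsin \<phi> ^ 2 * E \<phi> - 14 * qcos \<phi> ^ 6 * qsin \<phi> ^ 3 * E \<phi> * M \<phi>)
      - 666792 / 28561 * (qcos \<phi> ^ 12 * qsin \<phi> ^ 8 + (18 * qcos \<phi> ^ 16 * qsin \<phi> ^ 5 - 22 * qcos \<phi> ^ 10 * qsin \<phi> ^ 9) * M \<phi>))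
      + 18 / 13 * \<beta> * B * (qcos \<phi> ^ 7 * K' \<phi> - 14 * qcos \<phi> ^ 6 * qsin \<phi> ^ 3 * K \<phi>)
      - B^3 * \<beta>^2 * (5103 / 10985 * (15 * qcos \<phi> ^ 24 * qsin \<phi> ^ 4 - 38 * qcos \<phi> ^ 18 * qsin \<phi> ^ 8)
      + 493920 / 371293 * (27 * qcos \<phi> ^ 18 * qsin \<phi> ^ 8 - 26 * qcos \<phi> ^ 12 * qsin \<phi> ^ 12)))"
  have tZ: "tder Z Z'" unfolding Z_def
    by (rule tder_cong, (rule tder_intros M E K \<gamma>3)+) (simp add: Z'_def, algebra)
  have cZ: "circ Z' 0"
    by (rule circ_tder[OF tZ]) (use M E K_per per3 in \<open>simp add: per_def Z_def\<close>)
  define W where "W = (\<lambda>\<phi>. 8890560 / 28561 * (M \<phi> * qcos \<phi> ^ 16 * qsin \<phi> ^ 5 - qcos \<phi> ^ 12 * qsin \<phi> ^ 8 / 9)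
      - 836976 / 1856465 * (qcos \<phi> ^ 18 * qsin \<phi> ^ 8))"
  \<comment> \<open>The bound on M is multiplied by the nonnegative C^12 S^4; what is left is a
    strictly negative multiple of C^18 S^8.\<close>
  have W_le: "W \<phi> \<le> - (836976 / 1856465) * (qcos \<phi> ^ 18 * qsin \<phi> ^ 8)" for \<phi>
  proof -
    have "9 * (M \<phi> * qsin \<phi> * qcos \<phi> ^ 4) * (qcos \<phi> ^ 12 * qsin \<phi> ^ 4) \<le> qsin \<phi> ^ 4 * (qcos \<phi> ^ 12 * qsin \<phi> ^ 4)"
      by (rule mult_right_mono[OF primitive_M_bound[OF M]]) (simp add: zero_le_even_power)
    moreover have "9 * (M \<phi> * qsin \<phi> * qcos \<phi> ^ 4) * (qcos \<phi> ^ 12 * qsin \<phi> ^ 4) = 9 * (M \<phi> * qcos \<phi> ^ 16 * qsin \<phi> ^ 5)"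
      "qsin \<phi> ^ 4 * (qcos \<phi> ^ 12 * qsin \<phi> ^ 4) = qcos \<phi> ^ 12 * qsin \<phi> ^ 8" by algebra+
    ultimately have "M \<phi> * qcos \<phi> ^ 16 * qsin \<phi> ^ 5 - qcos \<phi> ^ 12 * qsin \<phi> ^ 8 / 9 \<le> 0" by linarith
    then have "8890560 / 28561 * (M \<phi> * qcos \<phi> ^ 16 * qsin \<phi> ^ 5 - qcos \<phi> ^ 12 * qsin \<phi> ^ 8 / 9) \<le> 0"
      by (intro mult_nonneg_nonpos) simp_all
    then show ?thesis unfolding W_def by simp
  qed
  have contW: "continuous_on UNIV W" unfolding W_def by (intro continuous_intros conts) auto
  have "per W" using M(3) by (simp add: per_def W_def)
  then obtain kW where kW: "circ W kW" using circ_exists[OF contW] by blast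
  have "- 1 * kW > 0"
  proof (rule circ_pos[OF circ_cmult[OF kW]])
    show "- 1 * W \<phi> \<ge> 0" for \<phi>
      using W_le[of \<phi>] zero_le_even_power[of 18 "qcos \<phi>"] zero_le_even_power[of 8 "qsin \<phi>"]
      by (smt (verit) even_numeral mult_nonneg_nonneg mult_minus_left divide_nonneg_pos)
    have "qcos (pi / 4) ^ 18 * qsin (pi / 4) ^ 8 > 0" using qtrig_pi4 by simp
    then show "- 1 * W (pi / 4) > 0" using W_le[of "pi / 4"] by linarith
    show "continuous_on UNIV (\<lambda>\<phi>. - 1 * W \<phi>)" by (intro continuous_intros contW)
  qed
  then have kW0: "kW \<noteq> 0" by simp
  let ?C = qcos and ?S = qsin
  define od where "od = (\<lambda>\<phi>. \<delta> * m \<phi> * (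
      27 / 26 * \<delta> * (B\<^sup>2 * \<beta> / 7 * (?C \<phi> ^ 14 * ?S \<phi> ^ 4) - (\<beta>\<^sup>2 * (?C \<phi> ^ 4 * ?S \<phi> ^ 6) + B\<^sup>2 * (?C \<phi> ^ 10 * ?S \<phi> ^ 2)) * \<beta> * E \<phi>)
      - 2 * (\<beta> * (?C \<phi> ^ 2 * ?S \<phi> ^ 3) * K \<phi> - B\<^sup>2 * \<beta> * \<delta> / 13 * (?C \<phi> ^ 14 * ?S \<phi> ^ 4))
      - 63017 / 52728 * (\<beta>^4 * (?C \<phi> ^ 8 * ?S \<phi> ^ 12) + 6 * \<beta>\<^sup>2 * B\<^sup>2 * (?C \<phi> ^ 14 * ?S \<phi> ^ 8) + B^4 * (?C \<phi> ^ 20 * ?S \<phi> ^ 4))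
      - 3 * \<delta>\<^sup>2 * M \<phi> * (B\<^sup>2 / 14 * (?C \<phi> ^ 12 * ?S \<phi>) - \<beta>\<^sup>2 * (?C \<phi> ^ 2 * ?S \<phi> ^ 3) * E \<phi>)
      + 6 * \<delta> * M \<phi> * K \<phi>
      + 560 / 169 * \<delta> * M \<phi> * (\<beta>^3 * (?C \<phi> ^ 6 * ?S \<phi> ^ 9) + 3 * \<beta> * B\<^sup>2 * (?C \<phi> ^ 12 * ?S \<phi> ^ 5))))"
  have "circ od 0"
  proof (rule circ_refl)
    show "continuous_on UNIV od" unfolding od_def by (intro continuous_intros conts)
    show "per od" using M(3) E(2) K_per by (simp add: per_def od_def)
    show "od (pi - \<phi>) = - od \<phi>" for \<phi> by (simp add: od_def M E K_refl)
  qed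
  have regroup: "x = y + (a + b + c - d) + e" if "x = y + a + f" "f = b + c - d + e" for x y a b c d e f :: real
    using that by simp
  have h_eq: "h \<phi> = od \<phi> + Z' \<phi> + \<beta>\<^sup>2 * B ^ 3 * W \<phi>" for \<phi>
    unfolding Z'_def W_def
  proof (rule regroup)
    show "h \<phi> = od \<phi> + 3 * \<delta> * (m \<phi> * \<gamma>3 \<phi> + M \<phi> * g3 \<phi>) + \<delta> * m \<phi> * (
      27 / 26 * \<delta> * ((\<beta>\<^sup>2 * (?C \<phi> ^ 4 * ?S \<phi> ^ 6) + B\<^sup>2 * (?C \<phi> ^ 10 * ?S \<phi> ^ 2)) * (B / 14 * ?C \<phi> ^ 7) - 2 * \<beta>\<^sup>2 * B * (?C \<phi> ^ 7 * ?S \<phi> ^ 4) * E \<phi>)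
      - 2 * (B * (?C \<phi> ^ 5 * ?S \<phi>) * K \<phi> - \<beta>\<^sup>2 * \<delta> * B / 13 * (?C \<phi> ^ 11 * ?S \<phi> ^ 6))
      - 63017 / 13182 * (\<beta>^3 * B * (?C \<phi> ^ 11 * ?S \<phi> ^ 10) + \<beta> * B^3 * (?C \<phi> ^ 17 * ?S \<phi> ^ 6))
      - 3 * \<delta>\<^sup>2 * M \<phi> * \<beta> * B * (?C \<phi> ^ 9 * ?S \<phi> ^ 3 / 14 - ?C \<phi> ^ 5 * ?S \<phi> * E \<phi>)
      - 6 / 13 * \<delta>\<^sup>2 * \<beta> * B * M \<phi> * (?C \<phi> ^ 9 * ?S \<phi> ^ 3)
      + 560 / 169 * \<delta> * M \<phi> * (3 * \<beta>\<^sup>2 * B * (?C \<phi> ^ 9 * ?S \<phi> ^ 7) + B^3 * (?C \<phi> ^ 15 * ?S \<phi> ^ 3)))"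
      unfolding h_def od_def g3_def \<gamma>1_def \<gamma>2_def Qalt by (rule order4_parity_split)
  qed (unfold K'_def, rule order4_exact_part[OF \<delta> qcos_qsin_pow])
  have hc: "circ h (\<beta>\<^sup>2 * B ^ 3 * kW)"
    by (rule circ_cong[OF circ_add[OF circ_add[OF \<open>circ od 0\<close> cZ] circ_cmult[OF kW, of "\<beta>\<^sup>2 * B ^ 3"]]])
       (simp_all add: h_eq)
  have "\<beta>\<^sup>2 * B ^ 3 * kW \<noteq> 0" using nz kW0 by simp
  from periodic_primitive[OF hc conth this] obtain \<gamma>4 V
    where \<gamma>4: "tder \<gamma>4 (\<lambda>\<phi>. V - h \<phi>)" "per \<gamma>4" and V: "V \<noteq> 0" by metis
  define G0 where "G0 = (\<lambda>\<phi>. \<delta> * M \<phi> - 1 / 13 * Q \<phi>)"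
  define G1 where "G1 = (\<lambda>\<phi>. 1 / 26 * Q \<phi> ^ 2 + \<gamma>1 \<phi>)"
  define G2 where "G2 = (\<lambda>\<phi>. 1 / 13 * Q \<phi> * \<gamma>1 \<phi> - 25 / 1014 * Q \<phi> ^ 3 + \<gamma>2 \<phi>)"
  define G3 where "G3 = (\<lambda>\<phi>. 925 / 52728 * Q \<phi> ^ 4 - 11 / 338 * Q \<phi> ^ 2 * \<gamma>1 \<phi> + 2 / 13 * Q \<phi> * \<gamma>2 \<phi> + \<gamma>3 \<phi>)"
  define G4 where "G4 = (\<lambda>\<phi>. 253 / 13182 * Q \<phi> ^ 3 * \<gamma>1 \<phi> - 9065 / 685464 * Q \<phi> ^ 5
      - 10 / 169 * Q \<phi> ^ 2 * \<gamma>2 \<phi> + 3 / 13 * Q \<phi> * \<gamma>3 \<phi> + \<gamma>4 \<phi>)"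
  define g2 where "g2 = (\<lambda>\<phi>. - (Q \<phi> * (- Q \<phi> * P \<phi>) + P \<phi> * G1 \<phi>))"
  define g3' where "g3' = (\<lambda>\<phi>. - (Q \<phi> * g2 \<phi> + 2 * P \<phi> * G2 \<phi>))"
  define g4 where "g4 = (\<lambda>\<phi>. V - (Q \<phi> * g3' \<phi> + 3 * P \<phi> * G3 \<phi>))"
  have t0: "tder G0 P" unfolding G0_def
    by (rule tder_cong, (rule tder_intros Q M)+) (simp add: Palt)
  have t1: "tder G1 (\<lambda>\<phi>. - Q \<phi> * P \<phi>)" unfolding G1_def
    by (rule tder_cong, (rule tder_intros Q \<gamma>1)+) (simp add: Palt field_simps)
  have t2: "tder G2 g2" unfolding G2_def g2_def G1_def
    by (rule tder_cong, (rule tder_intros Q \<gamma>1 \<gamma>2)+) (simp add: Palt field_simps, algebra)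
  have t3: "tder G3 g3'" unfolding G3_def g3'_def g2_def G2_def G1_def
    by (rule tder_cong, (rule tder_intros Q \<gamma>1 \<gamma>2 \<gamma>3)+) (simp add: Palt g3_def field_simps, algebra)
  have t4: "tder G4 g4" unfolding G4_def g4_def g3'_def g2_def G3_def G2_def G1_def
    by (rule tder_cong, (rule tder_intros Q \<gamma>1 \<gamma>2 \<gamma>3 \<gamma>4)+) (simp add: Palt g3_def h_def field_simps, algebra)
  have p: "per G0" "per G1" "per G2" "per G3" "per G4" "per g4"
    using M(3) \<gamma>1(2) \<gamma>2(2) per3 \<gamma>4(2) per_PQ
    by (simp_all add: per_def G0_def G1_def G2_def G3_def G4_def g4_def g3'_def g2_def)
  have cg: "continuous_on UNIV g4" unfolding g4_def g3'_def g2_def G3_def G2_def G1_def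
    by (intro continuous_intros conts)
  let ?G = "\<lambda>k::nat. if k = 0 then G0 else if k = 1 then G1 else if k = 2 then G2 else if k = 3 then G3 else G4"
  let ?g = "\<lambda>k::nat. if k = 0 then P else if k = 1 then (\<lambda>\<phi>. - Q \<phi> * P \<phi>) else if k = 2 then g2 else if k = 3 then g3' else g4"
  have le4: "k = 0 \<or> k = 1 \<or> k = 2 \<or> k = 3 \<or> k = 4" if "k \<le> 4" for k :: nat using that by auto
  show ?thesis
  proof (rule not_center_if_recursion[where n = 4 and V = V and G = ?G and g = ?g])
    show "tder (?G k) (?g k)" if "k \<le> 4" for k using le4[OF that] t0 t1 t2 t3 t4 by auto
    show "per (?G k)" if "k \<le> 4" for k using le4[OF that] p by auto
    show "?g (Suc k) \<phi> = (if Suc k = 4 then V else 0) - (Q \<phi> * ?g k \<phi> + real k * P \<phi> * ?G k \<phi>)"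
      if "k < 4" for k \<phi>
    proof -
      have "k = 0 \<or> k = 1 \<or> k = 2 \<or> k = 3" using that by auto
      then show ?thesis by (auto simp: g2_def g3'_def g4_def)
    qed
  qed (use p cg V in auto)
qed

end

section \<open>Closed orbits from periodic solutions\<close>

text \<open>f^2 exp (-2 K t) is nonincreasing and f^2 exp (2 K t) nondecreasing; the first settles t
  \<ge> t0 and the second t \<le> t0.\<close>

lemma gronwall_zero:
  fixes f :: "real \<Rightarrow> real"
  assumes d: "\<And>t. a < t \<Longrightarrow> t < b \<Longrightarrow> \<exists>D. (f has_real_derivative D) (at t) \<and> \<bar>D\<bar> \<le> K * \<bar>f t\<bar>"
    and t: "a < t0" "t0 < b" "f t0 = 0" "a < t" "t < b"
  shows "f t = 0"
proof -
  have key: "\<exists>E. ((\<lambda>s. f s ^ 2 * exp (c * s)) has_real_derivative E) (at s) \<and> (c = - 2 * K \<longrightarrow> E \<le> 0) \<and> (c = 2 * K \<longrightarrow> E \<ge> 0)"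
    if s: "a < s" "s < b" for s c
  proof -
    obtain D where D: "(f has_real_derivative D) (at s)" "\<bar>D\<bar> \<le> K * \<bar>f s\<bar>" using d[OF s] by blast
    have "((\<lambda>s. f s ^ 2 * exp (c * s)) has_real_derivative exp (c * s) * (2 * (f s * D) + c * f s ^ 2)) (at s)"
      by (auto intro!: derivative_eq_intros D(1) simp: algebra_simps)
    moreover have "\<bar>f s * D\<bar> \<le> K * f s ^ 2"
    proof -
      have "\<bar>f s * D\<bar> \<le> \<bar>f s\<bar> * (K * \<bar>f s\<bar>)"
        unfolding abs_mult by (rule mult_left_mono[OF D(2)]) simp
      also have "\<dots> = K * \<bar>f s\<bar> ^ 2" by algebra
      finally show ?thesis by simp
    qed
    then have "2 * (f s * D) + (- 2 * K) * f s ^ 2 \<le> 0" "2 * (f s * D) + (2 * K) * f s ^ 2 \<ge> 0" by linarith+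
    ultimately show ?thesis
      by (intro exI[of _ "exp (c * s) * (2 * (f s * D) + c * f s ^ 2)"] conjI impI)
         (auto simp: mult_le_0_iff zero_le_mult_iff)
  qed
  have "f t ^ 2 \<le> 0"
  proof (cases "t0 \<le> t")
    case True
    have "f t ^ 2 * exp (- 2 * K * t) \<le> f t0 ^ 2 * exp (- 2 * K * t0)"
    proof (rule DERIV_nonpos_imp_nonincreasing[OF True])
      fix x assume "t0 \<le> x" "x \<le> t"
      then have "a < x" "x < b" using t by auto
      from key[OF this, of "- 2 * K"]
      show "\<exists>y. ((\<lambda>s. f s ^ 2 * exp (- 2 * K * s)) has_real_derivative y) (at x) \<and> y \<le> 0" by blast
    qed
    then show ?thesis using t(3) by (simp add: mult_le_0_iff)
  next
    case False
    then have "t \<le> t0" by simp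
    then have "f t ^ 2 * exp (2 * K * t) \<le> f t0 ^ 2 * exp (2 * K * t0)"
    proof (rule DERIV_nonneg_imp_nondecreasing)
      fix x assume "t \<le> x" "x \<le> t0"
      then have "a < x" "x < b" using t by auto
      from key[OF this, of "2 * K"]
      show "\<exists>y. ((\<lambda>s. f s ^ 2 * exp (2 * K * s)) has_real_derivative y) (at x) \<and> 0 \<le> y" by blast
    qed
    then show ?thesis using t(3) by (simp add: mult_le_0_iff)
  qed
  then show ?thesis by simp
qed

context qh_field
begin

definition polar_orbit :: "real \<Rightarrow> (real \<Rightarrow> real) \<Rightarrow> bool" where
  "polar_orbit r1 R \<longleftrightarrow> tder R (\<lambda>\<phi>. R \<phi> ^ 2 * P \<phi> / (1 + R \<phi> * Q \<phi>)) \<and> per R \<and> (\<forall>\<phi>. 0 < R \<phi> \<and> R \<phi> \<le> r1)"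

definition orbit_curve :: "(real \<Rightarrow> real) \<Rightarrow> (real \<times> real) set" where
  "orbit_curve R = range (\<lambda>\<phi>. emb \<phi> (R \<phi>))"

lemma polar_orbitD:
  assumes "polar_orbit r1 R"
  shows "tder R (\<lambda>\<phi>. R \<phi> ^ 2 * P \<phi> / (1 + R \<phi> * Q \<phi>))" "per R" "0 < R \<phi>" "R \<phi> \<le> r1"
  using assms by (auto simp: polar_orbit_def)

lemma PQ_XY: "2 * P \<phi> * qcos \<phi> - 2 * Q \<phi> * qsin \<phi> ^ 3 = X \<phi>" "3 * P \<phi> * qsin \<phi> + 3 * Q \<phi> * qcos \<phi> ^ 5 = Y \<phi>"
proof -
  have h: "qcos \<phi> ^ 6 + qsin \<phi> ^ 4 = 1" by (rule qcos_qsin_pow)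
  have "6 * P \<phi> = 3 * qcos \<phi> ^ 5 * X \<phi> + 2 * qsin \<phi> ^ 3 * Y \<phi>" "6 * Q \<phi> = 2 * qcos \<phi> * Y \<phi> - 3 * qsin \<phi> * X \<phi>"
    by (simp_all add: P_def Q_def)
  with h have "6 * (2 * P \<phi> * qcos \<phi> - 2 * Q \<phi> * qsin \<phi> ^ 3) = 6 * X \<phi>"
    "6 * (3 * P \<phi> * qsin \<phi> + 3 * Q \<phi> * qcos \<phi> ^ 5) = 6 * Y \<phi>" by algebra+
  then show "2 * P \<phi> * qcos \<phi> - 2 * Q \<phi> * qsin \<phi> ^ 3 = X \<phi>" "3 * P \<phi> * qsin \<phi> + 3 * Q \<phi> * qcos \<phi> ^ 5 = Y \<phi>"
    by simp_all
qed

context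
  fixes r1 :: real and R :: "real \<Rightarrow> real"
  assumes r1: "r1 > 0" "\<And>\<phi>. 4 * r1 * \<bar>Q \<phi>\<bar> \<le> 1" and R: "polar_orbit r1 R"
begin

lemma rQ_small:
  assumes "0 \<le> r" "r \<le> 2 * r1"
  shows "\<bar>r * Q \<phi>\<bar> \<le> 1 / 2"
proof -
  have "\<bar>r * Q \<phi>\<bar> \<le> 2 * r1 * \<bar>Q \<phi>\<bar>" using assms by (simp add: abs_mult mult_right_mono)
  then show ?thesis using r1(2)[of \<phi>] by linarith
qed

lemma RQ_pos: "1 + R \<phi> * Q \<phi> \<ge> 1 / 2"
  using rQ_small[of "R \<phi>" \<phi>] polar_orbitD(3,4)[OF R, of \<phi>] by linarith

lemma continuous_curve: "continuous_on UNIV (\<lambda>\<phi>. emb \<phi> (R \<phi>))"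
  unfolding emb_def by (intro continuous_intros continuous_qtrig tder_continuous[OF polar_orbitD(1)[OF R]])

lemma curve_eq: "orbit_curve R = (\<lambda>\<phi>. emb \<phi> (R \<phi>)) ` {0..0 + 2 * pi}"
proof -
  have "emb \<phi> (R \<phi>) \<in> (\<lambda>\<phi>. emb \<phi> (R \<phi>)) ` {0..0 + 2 * pi}" for \<phi>
  proof -
    obtain n where n: "\<phi> - 2 * pi * of_int n \<in> {0..0 + 2 * pi}" using per_reduce by blast
    have "R (\<phi> - 2 * pi * of_int n) = R \<phi>" using per_int[OF polar_orbitD(2)[OF R], of "\<phi> - 2 * pi * of_int n" n] by simp
    moreover have "per qcos" "per qsin" by auto
    then have "qcos (\<phi> - 2 * pi * of_int n) = qcos \<phi>" "qsin (\<phi> - 2 * pi * of_int n) = qsin \<phi>"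
      using per_int[of qcos "\<phi> - 2 * pi * of_int n" n] per_int[of qsin "\<phi> - 2 * pi * of_int n" n] by simp_all
    ultimately show ?thesis using n by (intro image_eqI[of _ _ "\<phi> - 2 * pi * of_int n"]) (simp_all add: emb_def)
  qed
  then show ?thesis unfolding orbit_curve_def by blast
qed

lemma closed_curve: "closed (orbit_curve R)"
  unfolding curve_eq by (intro compact_imp_closed compact_continuous_image continuous_on_subset[OF continuous_curve]) auto

lemma curve_memD:
  assumes "p \<in> orbit_curve R" "p = emb \<phi> r" "r > 0"
  shows "r = R \<phi>"
proof -
  obtain \<psi> where \<psi>: "p = emb \<psi> (R \<psi>)" using assms(1) by (auto simp: orbit_curve_def)
  have "R \<psi> > 0" by (rule polar_orbitD[OF R])
  with \<psi> assms show ?thesis using emb_eqD(1)[of \<phi> r \<psi> "R \<psi>"] per_emb[OF polar_orbitD(2)[OF R], of \<phi> r \<psi> "R \<psi>"] by simp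
qed

lemma zero_notin_curve: "0 \<notin> orbit_curve R"
proof
  assume "0 \<in> orbit_curve R"
  then obtain \<phi> where "0 = emb \<phi> (R \<phi>)" by (auto simp: orbit_curve_def)
  with emb_nonzero[OF polar_orbitD(3)[OF R, of \<phi>]] show False by metis
qed

lemma curve_closed_orbit:
  obtains z T where "solution_on F UNIV z" "T > 0" "\<And>t. z (t + T) = z t" "\<exists>t. z t \<noteq> z 0" "orbit_curve R = range z"
proof -
  let ?\<Omega> = "\<lambda>\<phi>. R \<phi> ^ 7 * (1 + R \<phi> * Q \<phi>) / qspeed \<phi>"
  have Rpos: "R \<phi> > 0" for \<phi> by (rule polar_orbitD[OF R])
  have \<Omega>: "?\<Omega> \<phi> > 0" for \<phi>
    using Rpos[of \<phi>] RQ_pos[of \<phi>] qspeed_pos[of \<phi>] by (intro divide_pos_pos mult_pos_pos) auto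
  have nz: "R \<phi> \<noteq> 0" "1 + R \<phi> * Q \<phi> \<noteq> 0" "qspeed \<phi> \<noteq> 0" for \<phi>
    using Rpos[of \<phi>] RQ_pos[of \<phi>] qspeed_pos[of \<phi>] by linarith+
  have Rcont: "continuous_on UNIV R" by (rule tder_continuous[OF polar_orbitD(1)[OF R]])
  have cont: "continuous_on UNIV (\<lambda>\<phi>. 1 / ?\<Omega> \<phi>)"
    by (intro continuous_intros continuous_qtrig continuous_PQ Rcont) (simp_all add: nz)
  \<comment> \<open>Time as a function of the angle along the curve, since \<open>?\<Omega>\<close>
    is d\<phi>/dt. Its inverse \<psi> gives the solution and its increment over one turn the
    period.\<close>
  obtain \<tau> where \<tau>: "\<tau> 0 = 0" "\<And>\<phi>. (\<tau> has_real_derivative 1 / ?\<Omega> \<phi>) (at \<phi>)"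
    using primitive_exists[OF cont, of 0] by blast
  have mono: "\<tau> x < \<tau> y" if "x < y" for x y
    by (rule DERIV_pos_imp_increasing[OF that]) (use \<tau>(2) \<Omega> in \<open>metis zero_less_divide_1_iff\<close>)
  define g where "g = (\<lambda>\<phi>. 1 / ?\<Omega> \<phi> / qspeed \<phi>)"
  have "tder \<tau> g" unfolding tder_def g_def using \<tau>(2) by (simp add: nz)
  moreover have "per g" using polar_orbitD(2)[OF R] per_PQ by (simp add: per_def g_def)
  ultimately obtain T where T: "\<And>\<phi>. \<tau> (\<phi> + 2 * pi) = \<tau> \<phi> + T" by (rule tder_shift) blast
  have T0: "T > 0" using T[of 0] mono[of 0 "2 * pi"] \<tau>(1) by simp
  \<comment> \<open>Removing the linear growth leaves a periodic function. This gives the values of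
    \<tau> at all multiples of 2 pi, hence surjectivity.\<close>
  have "per (\<lambda>\<phi>. \<tau> \<phi> - T * \<phi> / (2 * pi))" unfolding per_def T by (simp add: field_simps)
  from per_int[OF this, of 0] have \<tau>n: "\<tau> (2 * pi * of_int n) = T * of_int n" for n using \<tau>(1) by simp
  have \<tau>cont: "continuous_on UNIV \<tau>" by (intro continuous_at_imp_continuous_on ballI DERIV_isCont[OF \<tau>(2)])
  have surj: "\<exists>x. \<tau> x = y" for y
  proof -
    define n where "n = \<lceil>\<bar>y\<bar> / T\<rceil>"
    have "\<bar>y\<bar> / T \<le> of_int n" unfolding n_def by (rule le_of_int_ceiling)
    then have n: "\<bar>y\<bar> \<le> T * of_int n" using T0 by (simp add: pos_divide_le_eq mult.commute)
    then have n0: "of_int n \<ge> (0::real)" using T0 by (smt (verit) mult_pos_neg)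
    have "\<exists>x\<ge>2 * pi * of_int (- n). x \<le> 2 * pi * of_int n \<and> \<tau> x = y"
      by (rule IVT') (use n n0 pi_gt_zero \<tau>n[of n] \<tau>n[of "- n"] in \<open>auto intro: continuous_on_subset[OF \<tau>cont]\<close>)
    then show ?thesis by blast
  qed
  have inj: "x = y" if "\<tau> x = \<tau> y" for x y using mono[of x y] mono[of y x] that by (cases x y rule: linorder_cases) auto
  define \<psi> where "\<psi> = inv \<tau>"
  have \<psi>: "\<tau> (\<psi> t) = t" "\<psi> (\<tau> x) = x" for t x
    unfolding \<psi>_def using surj inj by (metis f_inv_into_f rangeI, metis inv_f_f injI)
  have \<psi>': "(\<psi> has_real_derivative ?\<Omega> (\<psi> t)) (at t)" for t
  proof -
    have "isCont \<psi> (\<tau> (\<psi> t))"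
      by (rule isCont_inverse_function[of 1]) (use \<psi> DERIV_isCont[OF \<tau>(2)] in auto)
    then have c: "isCont \<psi> t" by (simp add: \<psi>)
    have "(\<psi> has_real_derivative inverse (1 / ?\<Omega> (\<psi> t))) (at t)"
      by (rule DERIV_inverse_function[OF \<tau>(2), of _ _ "t - 1" "t + 1"]) (use \<Omega>[of "\<psi> t"] \<psi> c in auto)
    then show ?thesis by simp
  qed
  define z where "z = (\<lambda>t. emb (\<psi> t) (R (\<psi> t)))"
  have "solution_on F UNIV z"
    unfolding solution_on_def
  proof
    fix t :: real
    let ?\<phi> = "\<psi> t"
    let ?r = "R ?\<phi>" and ?C = "qcos ?\<phi>" and ?S = "qsin ?\<phi>" and ?k = "qspeed ?\<phi>"
    have k: "?k \<noteq> 0" "1 + ?r * Q ?\<phi> \<noteq> 0" using qspeed_pos[of ?\<phi>] RQ_pos[of ?\<phi>] by auto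
    have c: "((\<lambda>t. qcos (\<psi> t)) has_real_derivative - 2 * ?S^3 * (?r^7 * (1 + ?r * Q ?\<phi>))) (at t)"
      using DERIV_chain2[OF qtrig_derivs(1) \<psi>'[of t]] k by (simp add: ac_simps)
    have s: "((\<lambda>t. qsin (\<psi> t)) has_real_derivative 3 * ?C^5 * (?r^7 * (1 + ?r * Q ?\<phi>))) (at t)"
      using DERIV_chain2[OF qtrig_derivs(2) \<psi>'[of t]] k by (simp add: ac_simps)
    have cancel: "(k * (a / u)) * (b * u / k) = a * b" if "k \<noteq> 0" "u \<noteq> 0" for k a b u :: real
      using that by simp
    have "(?k * (?r^2 * P ?\<phi> / (1 + ?r * Q ?\<phi>))) * (?r^7 * (1 + ?r * Q ?\<phi>) / ?k) = ?r^2 * P ?\<phi> * ?r^7"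
      by (rule cancel[OF k])
    also have "\<dots> = ?r^9 * P ?\<phi>" by algebra
    finally have r: "((\<lambda>t. R (\<psi> t)) has_real_derivative ?r^9 * P ?\<phi>) (at t)"
      using DERIV_chain2[OF tderD[OF polar_orbitD(1)[OF R]] \<psi>'[of t]] by simp
    have "((\<lambda>t. R (\<psi> t) ^ 2 * qcos (\<psi> t)) has_real_derivative
        2 * ?r * (?r^9 * P ?\<phi>) * ?C + ?r^2 * (- 2 * ?S^3 * (?r^7 * (1 + ?r * Q ?\<phi>)))) (at t)"
      by (auto intro!: derivative_eq_intros c r)
    moreover have "2 * ?r * (?r^9 * P ?\<phi>) * ?C + ?r^2 * (- 2 * ?S^3 * (?r^7 * (1 + ?r * Q ?\<phi>)))
      = - 2 * ?r^9 * ?S^3 + ?r^10 * X ?\<phi>" unfolding PQ_XY(1)[symmetric] by algebra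
    moreover have "((\<lambda>t. R (\<psi> t) ^ 3 * qsin (\<psi> t)) has_real_derivative
        3 * ?r^2 * (?r^9 * P ?\<phi>) * ?S + ?r^3 * (3 * ?C^5 * (?r^7 * (1 + ?r * Q ?\<phi>)))) (at t)"
      by (auto intro!: derivative_eq_intros s r)
    moreover have "3 * ?r^2 * (?r^9 * P ?\<phi>) * ?S + ?r^3 * (3 * ?C^5 * (?r^7 * (1 + ?r * Q ?\<phi>)))
      = 3 * ?r^10 * ?C^5 + ?r^11 * Y ?\<phi>" unfolding PQ_XY(2)[symmetric] by algebra
    ultimately show "(z has_vector_derivative F (z t)) (at t)"
      unfolding z_def field_emb unfolding emb_def
      by (intro has_vector_derivative_Pair) (simp_all flip: has_real_derivative_iff_has_vector_derivative)
  qed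
  moreover have "z (t + T) = z t" for t
  proof -
    have "\<tau> (\<psi> t + 2 * pi) = t + T" by (simp add: T \<psi>)
    then have "\<psi> (t + T) = \<psi> t + 2 * pi" using \<psi>(2) by metis
    then show ?thesis using polar_orbitD(2)[OF R] by (simp add: z_def per_def emb_per)
  qed
  moreover have "\<exists>t. z t \<noteq> z 0"
  proof
    have "0 < R x ^ 2 * sqrt (gauge2 x)" for x using Rpos[of x] gauge2(1)[of x] by simp
    then have "fst (z 0) > 0" "fst (z (\<tau> pi)) < 0"
      using \<psi>(2)[of 0] \<psi>(2)[of pi] \<tau>(1) by (simp_all add: z_def emb_def qcos_def)
    then show "z (\<tau> pi) \<noteq> z 0" by auto
  qed
  moreover have "orbit_curve R = range z"
  proof -
    have "range \<psi> = UNIV" using \<psi>(2) by (metis surjI)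
    have "range z = (\<lambda>\<phi>. emb \<phi> (R \<phi>)) ` (range \<psi>)" by (simp add: z_def image_image)
    then show ?thesis by (simp only: orbit_curve_def \<open>range \<psi> = UNIV\<close>)
  qed
  ultimately show thesis using T0 that by blast
qed

section \<open>Signed radial distance to the curve\<close>

definition ang :: "real \<times> real \<Rightarrow> real" where
  "ang p = (SOME \<phi>. p = emb \<phi> (qnorm p))"

lemma emb_ang: "p \<noteq> 0 \<Longrightarrow> p = emb (ang p) (qnorm p)"
  unfolding ang_def by (rule someI_ex) (use emb_exists[of p] in blast)

definition excess :: "real \<times> real \<Rightarrow> real" where
  "excess p = qnorm p - R (ang p)"

lemma excess_emb:
  assumes "p = emb \<phi> (qnorm p)" "p \<noteq> 0"
  shows "excess p = qnorm p - R \<phi>"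
  using per_emb[OF polar_orbitD(2)[OF R], of \<phi> "qnorm p" "ang p" "qnorm p"] assms emb_ang[OF assms(2)]
    qnorm_pos[OF assms(2)] by (simp add: excess_def)

lemma excess_zero_imp:
  assumes "excess p = 0" "p \<noteq> 0"
  shows "p \<in> orbit_curve R"
proof -
  have "p = emb (ang p) (R (ang p))" using emb_ang[OF assms(2)] assms(1) by (simp add: excess_def)
  then show ?thesis unfolding orbit_curve_def by blast
qed

lemma curve_imp_excess_zero:
  assumes "p \<in> orbit_curve R"
  shows "excess p = 0"
proof -
  have p: "p \<noteq> 0" using assms zero_notin_curve by auto
  show ?thesis using curve_memD[OF assms emb_ang[OF p] qnorm_pos[OF p]] by (simp add: excess_def)
qed

text \<open>\<open>ang\<close> is an arbitrary choice and may jump, but near each point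
  \<open>excess\<close> agrees with its expression in a continuous branch of the angle.\<close>

lemma continuous_excess: "continuous_on (- {0}) excess"
proof (rule continuous_at_imp_continuous_on, rule ballI)
  fix p :: "real \<times> real" assume "p \<in> - {0}"
  then have p: "p \<noteq> 0" by simp
  define \<phi>0 r0 where "\<phi>0 = ang p" and "r0 = qnorm p"
  have p0: "p = emb \<phi>0 r0" "r0 > 0" using emb_ang[OF p] qnorm_pos[OF p] by (simp_all add: \<phi>0_def r0_def)
  obtain A A' where A: "A (emb \<phi>0 r0) = \<phi>0" "(A has_derivative A') (at (emb \<phi>0 r0))"
    "\<forall>\<^sub>F q in nhds (emb \<phi>0 r0). q = emb (A q) (qnorm q)" by (rule angle_branch[OF p0(2)])
  have "\<forall>\<^sub>F q in nhds p. q \<noteq> 0" using p by (rule t1_space_nhds)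
  with A(3)[folded p0(1)] have ev: "\<forall>\<^sub>F q in nhds p. qnorm q - R (A q) = excess q"
    by eventually_elim (simp add: excess_emb)
  have "isCont A p" using has_derivative_continuous[OF A(2)] p0 by simp
  moreover have "isCont R (A p)" by (rule DERIV_isCont[OF tderD[OF polar_orbitD(1)[OF R]]])
  ultimately have "isCont (\<lambda>q. R (A q)) p" by (rule isCont_o2)
  moreover have "isCont qnorm p"
    using continuous_qnorm continuous_on_eq_continuous_at[OF open_UNIV] by blast
  ultimately have "isCont (\<lambda>q. qnorm q - R (A q)) p" by (intro continuous_intros)
  then show "isCont excess p" using isCont_cong[OF ev] by simp
qed

text \<open>Let \<rho> be the radius of the curve at the current angle. Since r and \<rho> follow
  the same radial equation, r - \<rho> factors out of the derivative. The constant uses r \<le> 2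
  r1, a numerator r + \<rho> + \<rho> r Q of size at most 4 r1, and a denominator of at least
  1/2.\<close>

lemma excess_deriv:
  assumes z: "(z has_vector_derivative F (z t)) (at t)" and nz: "z t \<noteq> 0" and small: "qnorm (z t) \<le> 2 * r1"
    and Pm: "\<And>\<phi>. \<bar>P \<phi>\<bar> \<le> Pm"
  shows "\<exists>D. ((\<lambda>t. excess (z t)) has_real_derivative D) (at t) \<and> \<bar>D\<bar> \<le> ((2 * r1)^7 * Pm * (8 * r1)) * \<bar>excess (z t)\<bar>"
proof -
  define \<phi> r \<rho> where "\<phi> = ang (z t)" and "r = qnorm (z t)" and "\<rho> = R \<phi>"
  have zt: "z t = emb \<phi> r" "r > 0" "r \<le> 2 * r1" using emb_ang[OF nz] qnorm_pos[OF nz] small by (simp_all add: \<phi>_def r_def)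
  have \<rho>: "0 < \<rho>" "\<rho> \<le> r1" using polar_orbitD(3,4)[OF R] by (simp_all add: \<rho>_def)
  have u: "1 + \<rho> * Q \<phi> \<ge> 1 / 2" unfolding \<rho>_def by (rule RQ_pos)
  obtain a where a: "a t = \<phi>" "(a has_real_derivative r^7 * (1 + r * Q \<phi>) / qspeed \<phi>) (at t)"
    "((\<lambda>t. qnorm (z t)) has_real_derivative r^9 * P \<phi>) (at t)"
    "\<forall>\<^sub>F s in nhds t. z s = emb (a s) (qnorm (z s))" by (rule polar_solution[OF z zt(1,2)])
  have "((\<lambda>t. R (a t)) has_real_derivative (qspeed \<phi> * (\<rho>^2 * P \<phi> / (1 + \<rho> * Q \<phi>))) * (r^7 * (1 + r * Q \<phi>) / qspeed \<phi>)) (at t)"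
    by (rule DERIV_chain2[OF _ a(2)]) (use tderD[OF polar_orbitD(1)[OF R], of \<phi>] in \<open>simp add: a(1) \<rho>_def\<close>)
  from DERIV_diff[OF a(3) this]
  have d: "((\<lambda>t. qnorm (z t) - R (a t)) has_real_derivative
    r^9 * P \<phi> - (qspeed \<phi> * (\<rho>^2 * P \<phi> / (1 + \<rho> * Q \<phi>))) * (r^7 * (1 + r * Q \<phi>) / qspeed \<phi>)) (at t)" .
  have "r^9 * P \<phi> - (qspeed \<phi> * (\<rho>^2 * P \<phi> / (1 + \<rho> * Q \<phi>))) * (r^7 * (1 + r * Q \<phi>) / qspeed \<phi>)
      = r^7 * P \<phi> * (r^2 - \<rho>^2 * (1 + r * Q \<phi>) / (1 + \<rho> * Q \<phi>))" (is "?D = _")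
  proof -
    have "(k * (b / u)) * (c / k) = b * c / u" if "k > 0" for k b c u :: real using that by simp
    then have e1: "(qspeed \<phi> * (\<rho>^2 * P \<phi> / (1 + \<rho> * Q \<phi>))) * (r^7 * (1 + r * Q \<phi>) / qspeed \<phi>)
      = (\<rho>^2 * P \<phi>) * (r^7 * (1 + r * Q \<phi>)) / (1 + \<rho> * Q \<phi>)" using qspeed_pos[of \<phi>] by blast
    have e2: "r^9 * P \<phi> = r^7 * P \<phi> * r^2" by algebra
    show ?thesis unfolding e1 e2 by (simp add: right_diff_distrib mult_ac)
  qed
  also have "\<dots> = r^7 * P \<phi> * ((r + \<rho> + \<rho> * (r * Q \<phi>)) / (1 + \<rho> * Q \<phi>)) * (r - \<rho>)"
  proof -
    have "r^2 - \<rho>^2 * (1 + r * Q \<phi>) / (1 + \<rho> * Q \<phi>) = (r^2 * (1 + \<rho> * Q \<phi>) - \<rho>^2 * (1 + r * Q \<phi>)) / (1 + \<rho> * Q \<phi>)"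
      using u by (simp add: diff_divide_distrib)
    also have "r^2 * (1 + \<rho> * Q \<phi>) - \<rho>^2 * (1 + r * Q \<phi>) = (r + \<rho> + \<rho> * (r * Q \<phi>)) * (r - \<rho>)" by algebra
    finally show ?thesis by simp
  qed
  finally have D: "?D = r^7 * P \<phi> * ((r + \<rho> + \<rho> * (r * Q \<phi>)) / (1 + \<rho> * Q \<phi>)) * (r - \<rho>)" .
  have ex: "excess (z t) = r - \<rho>" by (simp add: excess_def \<phi>_def r_def \<rho>_def)
  have "\<bar>?D\<bar> \<le> ((2 * r1)^7 * Pm * (8 * r1)) * \<bar>excess (z t)\<bar>"
  proof -
    have "\<bar>\<rho> * (r * Q \<phi>)\<bar> \<le> r1 * (1 / 2)"
      unfolding abs_mult[of \<rho>] using \<rho> rQ_small[of r \<phi>] zt by (intro mult_mono) auto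
    then have "\<bar>r + \<rho> + \<rho> * (r * Q \<phi>)\<bar> \<le> 4 * r1" using zt \<rho> r1(1) by linarith
    then have "\<bar>r + \<rho> + \<rho> * (r * Q \<phi>)\<bar> / (1 + \<rho> * Q \<phi>) \<le> (4 * r1) / (1 / 2)"
      using u r1(1) by (intro frac_le) auto
    then have q: "\<bar>(r + \<rho> + \<rho> * (r * Q \<phi>)) / (1 + \<rho> * Q \<phi>)\<bar> \<le> 8 * r1" using u by (simp add: abs_divide)
    have "r^7 \<le> (2 * r1)^7" by (rule power_mono) (use zt in auto)
    then have r7: "\<bar>r^7\<bar> \<le> (2 * r1)^7" using zt(2) by (simp only: abs_of_nonneg zero_le_power less_imp_le)
    have p0: "0 \<le> Pm" using Pm[of \<phi>] by linarith
    have "\<bar>r^7 * P \<phi> * ((r + \<rho> + \<rho> * (r * Q \<phi>)) / (1 + \<rho> * Q \<phi>))\<bar> \<le> (2 * r1)^7 * Pm * (8 * r1)"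
      unfolding abs_mult[of _ "_ / _"] abs_mult[of _ "P \<phi>"] using r1(1) p0
      by (intro mult_mono r7 Pm q) auto
    then show ?thesis unfolding D ex abs_mult[of _ "r - \<rho>"] by (rule mult_right_mono) simp
  qed
  moreover have "((\<lambda>t. excess (z t)) has_real_derivative ?D) (at t)"
  proof -
    have "isCont z t" by (rule has_vector_derivative_continuous[OF z])
    then have "(z \<longlongrightarrow> z t) (nhds t)" unfolding isCont_def tendsto_at_iff_tendsto_nhds .
    then have "\<forall>\<^sub>F s in nhds t. z s \<noteq> 0" using nz by (rule tendsto_imp_eventually_ne)
    with a(4) have ev: "\<forall>\<^sub>F s in nhds t. excess (z s) = qnorm (z s) - R (a s)"
      by eventually_elim (simp add: excess_emb)
    show ?thesis by (subst DERIV_cong_ev[OF refl ev refl]) (rule d)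
  qed
  ultimately show ?thesis by blast
qed

text \<open>The times spent on the curve form a closed subset of the interval, which is open by the
  Gronwall estimate for \<open>excess\<close>; connectedness does the rest.\<close>

lemma solution_stays:
  assumes I: "open I" "is_interval I" "s \<in> I" and z: "solution_on F I z" and s: "z s \<in> orbit_curve R"
  shows "z ` I \<subseteq> orbit_curve R"
proof -
  have zd: "(z has_vector_derivative F (z t)) (at t)" if "t \<in> I" for t using z that by (simp add: solution_on_def)
  have zc: "continuous_on I z"
    by (intro continuous_at_imp_continuous_on ballI has_vector_derivative_continuous[OF zd])
  define J where "J = I \<inter> z -` orbit_curve R"
  obtain Pm where Pm: "\<And>\<phi>. \<bar>P \<phi>\<bar> \<le> Pm" using per_bounded[OF per_PQ(1) continuous_PQ(1)] by blast
  have "closedin (top_of_set I) J" unfolding J_def by (rule continuous_closedin_preimage[OF zc closed_curve])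
  moreover have "openin (top_of_set I) J"
  proof (subst openin_subopen, rule ballI)
    fix t0 assume t0: "t0 \<in> J"
    then have tI: "t0 \<in> I" and zt0: "z t0 \<in> orbit_curve R" by (auto simp: J_def)
    \<comment> \<open>The curve lies within radius r1. The doubled radius leaves a whole
      neighbourhood on which \<open>excess_deriv\<close> holds.\<close>
    define V where "V = {p. 0 < qnorm p} \<inter> {p. qnorm p < 2 * r1}"
    have "open V" unfolding V_def by (intro open_Int open_Collect_less continuous_qnorm continuous_intros)
    have "z t0 \<noteq> 0" using zt0 zero_notin_curve by auto
    moreover from curve_memD[OF zt0 emb_ang[OF this] qnorm_pos[OF this]] have "qnorm (z t0) \<le> r1"
      using polar_orbitD(4)[OF R] by simp
    ultimately have "z t0 \<in> V" using qnorm_pos r1(1) by (simp add: V_def)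
    have "open (I \<inter> z -` V)" using continuous_open_preimage[OF zc I(1) \<open>open V\<close>] .
    moreover have "t0 \<in> I \<inter> z -` V" using tI \<open>z t0 \<in> V\<close> by simp
    ultimately obtain e where e: "e > 0" "ball t0 e \<subseteq> I \<inter> z -` V" by (rule openE)
    have inV: "t \<in> I" "z t \<noteq> 0" "qnorm (z t) \<le> 2 * r1" if "t0 - e < t" "t < t0 + e" for t
    proof -
      have "t \<in> ball t0 e" using that by (simp add: dist_real_def abs_less_iff)
      with e(2) have "t \<in> I" "z t \<in> V" by auto
      then show "t \<in> I" "z t \<noteq> 0" "qnorm (z t) \<le> 2 * r1" by (auto simp: V_def)
    qed
    have "z t \<in> orbit_curve R" if "t0 - e < t" "t < t0 + e" for t
    proof (rule excess_zero_imp[OF _ inV(2)[OF that]])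
      show "excess (z t) = 0"
      proof (rule gronwall_zero[where f = "\<lambda>t. excess (z t)" and K = "(2 * r1)^7 * Pm * (8 * r1)"
            and a = "t0 - e" and b = "t0 + e" and ?t0.0 = t0])
        show "\<exists>D. ((\<lambda>t. excess (z t)) has_real_derivative D) (at u) \<and> \<bar>D\<bar> \<le> ((2 * r1)^7 * Pm * (8 * r1)) * \<bar>excess (z u)\<bar>"
          if "t0 - e < u" "u < t0 + e" for u
          by (rule excess_deriv[OF zd[OF inV(1)[OF that]] inV(2,3)[OF that] Pm])
        show "excess (z t0) = 0" by (rule curve_imp_excess_zero[OF zt0])
      qed (use e(1) that in auto)
    qed
    then have "ball t0 e \<subseteq> J" using e(2) by (auto simp: J_def dist_real_def abs_less_iff)
    then show "\<exists>T. openin (top_of_set I) T \<and> t0 \<in> T \<and> T \<subseteq> J"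
      using e by (intro exI[of _ "ball t0 e"]) (auto intro!: open_openin_trans[OF I(1)])
  qed
  moreover have "connected I" using I(2) by (simp add: is_interval_connected)
  moreover have "J \<noteq> {}" using I(3) s by (auto simp: J_def)
  ultimately have "J = I" unfolding connected_clopen by blast
  then show ?thesis unfolding J_def by blast
qed

lemma orbit_eq_curve:
  assumes "p \<in> orbit_curve R"
  shows "orbit F p = orbit_curve R" "closed_orbit F (orbit_curve R)"
proof -
  obtain z T where z: "solution_on F UNIV z" "T > 0" "\<And>t. z (t + T) = z t" "\<exists>t. z t \<noteq> z 0" "orbit_curve R = range z"
    using curve_closed_orbit by blast
  then show "closed_orbit F (orbit_curve R)" unfolding closed_orbit_def by blast
  show "orbit F p = orbit_curve R"
  proof
    show "orbit F p \<subseteq> orbit_curve R" unfolding orbit_def using solution_stays assms by blast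
    obtain s where s: "z s = p" using assms z(5) by auto
    define y where "y = (\<lambda>t. z (t + s))"
    have "solution_on F UNIV y" unfolding solution_on_def
    proof
      fix t :: real
      have "(z has_vector_derivative F (z (t + s))) (at (t + s))" using z(1) by (simp add: solution_on_def)
      from vector_diff_chain_at[of "\<lambda>t. t + s" 1 t, OF _ this]
      show "(y has_vector_derivative F (y t)) (at t)" unfolding y_def
        by (simp add: o_def) (auto intro!: derivative_eq_intros simp: has_vector_derivative_add_const)
    qed
    moreover have "range y = orbit_curve R"
    proof -
      have "range z = z ` (range (\<lambda>t. t + s))" by simp
      then show ?thesis unfolding y_def z(5) by (metis image_image)
    qed
    ultimately show "orbit_curve R \<subseteq> orbit F p" unfolding orbit_def
      by (intro Union_upper CollectI exI[of _ y] exI[of _ UNIV]) (auto simp: s y_def)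
  qed
qed

text \<open>The sign of \<open>excess\<close> splits the complement of the curve into two open sets,
  of which the one containing the origin is bounded. No Jordan curve theorem is needed.\<close>

lemma zero_inside_curve: "0 \<in> inside (orbit_curve R)"
proof -
  define N S where "N = {p. p \<noteq> 0 \<and> excess p > 0}" and "S = {p. p = 0 \<or> excess p < 0}"
  have "isCont R \<phi>" for \<phi> by (rule DERIV_isCont[OF tderD[OF polar_orbitD(1)[OF R]]])
  then have "\<exists>x\<in>{0..0 + 2 * pi}. \<forall>y\<in>{0..0 + 2 * pi}. R x \<le> R y"
    by (intro continuous_attains_inf continuous_at_imp_continuous_on) auto
  then obtain \<phi>m where m: "\<And>\<phi>. \<phi> \<in> {0..0 + 2 * pi} \<Longrightarrow> R \<phi>m \<le> R \<phi>" by blast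
  have m: "R \<phi>m \<le> R \<phi>" for \<phi>
    using per_reduceE[OF polar_orbitD(2)[OF R], of 0 \<phi>] m by metis
  have "open N"
  proof -
    have "N = - {0} \<inter> excess -` {0<..}" by (auto simp: N_def)
    then show ?thesis using continuous_open_preimage[OF continuous_excess, of "{0<..}"] by auto
  qed
  moreover have "open S"
  proof -
    \<comment> \<open>Continuity of \<open>excess\<close> is known only away from the origin; the
      region below the minimum of R supplies a neighbourhood of 0.\<close>
    have "S = (- {0} \<inter> excess -` {..<0}) \<union> {p. qnorm p < R \<phi>m}"
    proof -
      have "excess p < 0" if "qnorm p < R \<phi>m" for p
        using that m[of "ang p"] by (simp add: excess_def)
      moreover have "qnorm 0 < R \<phi>m" using polar_orbitD(3)[OF R, of \<phi>m] by simp
      ultimately show ?thesis unfolding S_def by blast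
    qed
    moreover have "open (- {0} \<inter> excess -` {..<0})" by (rule continuous_open_preimage[OF continuous_excess]) auto
    moreover have "open {p. qnorm p < R \<phi>m}" by (intro open_Collect_less continuous_qnorm continuous_intros)
    ultimately show ?thesis by auto
  qed
  moreover have "bounded S"
  proof -
    have "S \<subseteq> {- (r1^2)..r1^2} \<times> {- (r1^3)..r1^3}"
    proof
      fix p assume "p \<in> S"
      have q: "qnorm p \<le> r1"
      proof (cases "p = 0")
        case False
        then have "qnorm p < R (ang p)" using \<open>p \<in> S\<close> by (simp add: S_def excess_def)
        with polar_orbitD(4)[OF R, of "ang p"] show "qnorm p \<le> r1" by linarith
      qed (use r1 in simp)
      have "fst p ^ 6 \<le> (r1^2)^6" "snd p ^ 4 \<le> (r1^3)^4"
      proof -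
        have "fst p ^ 6 + snd p ^ 4 \<le> r1 ^ 12" unfolding qnorm_pow[symmetric] by (rule power_mono[OF q qnorm_nonneg])
        moreover have "0 \<le> fst p ^ 6" "0 \<le> snd p ^ 4" by auto
        ultimately have "fst p ^ 6 \<le> r1 ^ 12" "snd p ^ 4 \<le> r1 ^ 12" by linarith+
        then show "fst p ^ 6 \<le> (r1^2)^6" "snd p ^ 4 \<le> (r1^3)^4" by (simp_all flip: power_mult)
      qed
      then have "\<bar>fst p\<bar> ^ 6 \<le> (r1^2)^6" "\<bar>snd p\<bar> ^ 4 \<le> (r1^3)^4" by (simp_all add: power_even_abs)
      then have "\<bar>fst p\<bar> \<le> r1^2" "\<bar>snd p\<bar> \<le> r1^3"
        using r1(1) power_mono_iff[of "\<bar>fst p\<bar>" "r1^2" 6] power_mono_iff[of "\<bar>snd p\<bar>" "r1^3" 4] by auto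
      then show "p \<in> {- (r1^2)..r1^2} \<times> {- (r1^3)..r1^3}" by (cases p) (auto simp: abs_le_iff)
    qed
    then show ?thesis by (rule bounded_subset[rotated]) (intro bounded_Times bounded_closed_interval)
  qed
  moreover have "connected_component_set (- orbit_curve R) 0 \<subseteq> S"
  proof -
    let ?c = "connected_component_set (- orbit_curve R) 0"
    have sub: "?c \<subseteq> - orbit_curve R" by (rule connected_component_subset)
    have zero: "0 \<in> ?c" using zero_notin_curve by simp
    have "connected ?c" by (rule connected_connected_component)
    moreover have "?c \<subseteq> S \<union> N" using sub excess_zero_imp by (force simp: S_def N_def)
    moreover have "S \<inter> N \<inter> ?c = {}" by (auto simp: S_def N_def)
    moreover have "S \<inter> ?c \<noteq> {}" using zero by (auto simp: S_def)
    ultimately have "N \<inter> ?c = {}" using \<open>open S\<close> \<open>open N\<close> unfolding connected_def by blast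
    with \<open>?c \<subseteq> S \<union> N\<close> show ?thesis by blast
  qed
  ultimately show ?thesis using zero_notin_curve unfolding inside_def by (auto intro: bounded_subset)
qed

end
lemma center_if_polar_orbits:
  fixes r1 \<epsilon> :: real
  assumes r1: "r1 > 0" "\<And>\<phi>. 4 * r1 * \<bar>Q \<phi>\<bar> \<le> 1" and "\<epsilon> > 0"
    and fam: "\<And>\<phi> r. 0 < r \<Longrightarrow> r < \<epsilon> \<Longrightarrow> \<exists>R. polar_orbit r1 R \<and> R \<phi> = r"
  shows "center_at_origin F"
proof -
  define U where "U = insert 0 (\<Union>{orbit_curve R | R. polar_orbit r1 R})"
  have "{p. qnorm p < \<epsilon>} \<subseteq> U"
  proof
    fix p assume p: "p \<in> {p. qnorm p < \<epsilon>}"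
    show "p \<in> U"
    proof (cases "p = 0")
      case False
      then obtain \<phi> where \<phi>: "p = emb \<phi> (qnorm p)" by (rule emb_exists)
      obtain R where R: "polar_orbit r1 R" "R \<phi> = qnorm p" using fam[OF qnorm_pos[OF False]] p by auto
      then have "p \<in> orbit_curve R" using \<phi> by (metis orbit_curve_def rangeI)
      with R show ?thesis by (auto simp: U_def)
    qed (simp add: U_def)
  qed
  moreover have "open {p. qnorm p < \<epsilon>}" by (intro open_Collect_less continuous_qnorm continuous_intros)
  moreover have "0 \<in> {p. qnorm p < \<epsilon>}" using \<open>\<epsilon> > 0\<close> by simp
  ultimately have "0 \<in> interior U" by (meson interiorI)
  moreover have "orbit F p \<subseteq> U \<and> closed_orbit F (orbit F p) \<and> 0 \<in> inside (orbit F p)" if "p \<in> U - {0}" for p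
  proof -
    from that obtain R where R: "polar_orbit r1 R" "p \<in> orbit_curve R" by (auto simp: U_def)
    note o = orbit_eq_curve[OF r1 R] and i = zero_inside_curve[OF r1 R(1)]
    have "orbit_curve R \<subseteq> U" using R(1) by (auto simp: U_def)
    with o i show ?thesis by simp
  qed
  ultimately show ?thesis unfolding center_at_origin_def by blast
qed

end

section \<open>Reversible and Hamiltonian systems\<close>

text \<open>By periodicity the angle can be moved to within one turn of the base point, so the mean
  value theorem bounds the increment uniformly on the whole line.\<close>

lemma per_increment_bound:
  assumes "per G" "\<And>\<phi>. (G has_real_derivative g \<phi>) (at \<phi>)" "\<And>\<phi>. \<bar>g \<phi>\<bar> \<le> M"
  shows "\<bar>G \<phi> - G \<phi>0\<bar> \<le> 2 * pi * M"
proof -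
  have M: "M \<ge> 0" using assms(3)[of 0] by linarith
  obtain \<psi> where \<psi>: "\<psi> \<in> {\<phi>0..\<phi>0 + 2 * pi}" "G \<phi> = G \<psi>" by (rule per_reduceE[OF assms(1)])
  show ?thesis
  proof (cases "\<phi>0 = \<psi>")
    case False
    then have "\<phi>0 < \<psi>" using \<psi> by auto
    then obtain x where "G \<psi> - G \<phi>0 = (\<psi> - \<phi>0) * g x" using MVT2[of \<phi>0 \<psi> G g] assms(2) by blast
    then have "\<bar>G \<phi> - G \<phi>0\<bar> = (\<psi> - \<phi>0) * \<bar>g x\<bar>" using \<open>\<phi>0 < \<psi>\<close> \<psi>(2) by (simp add: abs_mult)
    also have "\<dots> \<le> 2 * pi * M" using \<psi>(1) M assms(3) by (intro mult_mono) auto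
    finally show ?thesis .
  qed (use \<psi> M in simp)
qed

text \<open>The reflection symmetry makes the primitive of the right-hand side along a symmetric function
  periodic again, so that Picard's operator acts on symmetric periodic functions.\<close>

lemma symmetric_periodic_solution:
  fixes f :: "real \<Rightarrow> real \<Rightarrow> real"
  assumes cont: "\<And>v. continuous_on UNIV v \<Longrightarrow> continuous_on UNIV (\<lambda>\<phi>. f \<phi> (v \<phi>))"
    and f_per: "\<And>\<phi> x. f (\<phi> + 2 * pi) x = f \<phi> x" and f_refl: "\<And>\<phi> x. f (pi - \<phi>) x = - f \<phi> x"
    and lip: "\<And>\<phi> x y. qspeed \<phi> * \<bar>f \<phi> x - f \<phi> y\<bar> \<le> L * \<bar>x - y\<bar>" and L: "0 \<le> L" "2 * pi * L < 1"
    and bound: "\<And>\<phi> x. qspeed \<phi> * \<bar>f \<phi> x\<bar> \<le> M"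
  obtains v where "tder v (\<lambda>\<phi>. f \<phi> (v \<phi>))" "per v" "v \<phi>0 = c" "\<And>\<phi>. \<bar>v \<phi> - c\<bar> \<le> 2 * pi * M"
proof -
  \<comment> \<open>Both symmetries survive uniform limits, so this set is complete.\<close>
  define S :: "(real \<Rightarrow>\<^sub>C real) set" where "S = {v. (\<forall>\<phi>. apply_bcontfun v (\<phi> + 2 * pi) = apply_bcontfun v \<phi>)
      \<and> (\<forall>\<phi>. apply_bcontfun v (pi - \<phi>) = apply_bcontfun v \<phi>)}"
  have ev: "continuous_on UNIV (\<lambda>v :: real \<Rightarrow>\<^sub>C real. apply_bcontfun v x)" for x
    unfolding continuous_on_iff using dist_bounded[of _ x] le_less_trans by blast
  have "closed S" unfolding S_def by (intro closed_Collect_conj closed_Collect_all closed_Collect_eq ev)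
  then have S: "complete S" by (simp add: complete_eq_closed)
  have bc: "continuous_on UNIV (apply_bcontfun v)" for v :: "real \<Rightarrow>\<^sub>C real"
    using apply_bcontfun[of v] by (simp add: bcontfun_def)
  have "\<exists>G. \<forall>v. G v \<phi>0 = 0 \<and> tder (G v) (\<lambda>\<phi>. f \<phi> (apply_bcontfun v \<phi>))"
    by (intro choice allI tder_exists cont bc)
  then obtain G where G: "\<And>v. G v \<phi>0 = 0" "\<And>v. tder (G v) (\<lambda>\<phi>. f \<phi> (apply_bcontfun v \<phi>))" by blast
  have G_refl: "G v (pi - \<phi>) = G v \<phi>" and G_per: "per (G v)" if "v \<in> S" for v \<phi>
  proof -
    have r: "f (pi - \<phi>) (apply_bcontfun v (pi - \<phi>)) = - f \<phi> (apply_bcontfun v \<phi>)" for \<phi>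
      using that f_refl by (simp add: S_def)
    show "G v (pi - \<phi>) = G v \<phi>" by (rule tder_refl[OF G(2) r])
    show "per (G v)"
      by (rule tder_refl_per[OF G(2) _ r]) (use that f_per in \<open>simp add: per_def S_def\<close>)
  qed
  have G_bound: "\<bar>G v \<phi>\<bar> \<le> 2 * pi * M" if "v \<in> S" for v \<phi>
  proof -
    have "\<bar>G v \<phi> - G v \<phi>0\<bar> \<le> 2 * pi * M"
      by (rule per_increment_bound[OF G_per[OF that] tderD[OF G(2)]])
         (use bound qspeed_pos in \<open>simp add: abs_mult less_imp_le\<close>)
    then show ?thesis by (simp add: G(1))
  qed
  define T where "T = (\<lambda>v. Bcontfun (\<lambda>\<phi>. c + G v \<phi>))"
  have T: "apply_bcontfun (T v) = (\<lambda>\<phi>. c + G v \<phi>)" if "v \<in> S" for v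
  proof -
    have "(\<lambda>\<phi>. c + G v \<phi>) \<in> bcontfun"
    proof (rule bcontfun_normI)
      show "continuous_on UNIV (\<lambda>\<phi>. c + G v \<phi>)" by (intro continuous_intros tder_continuous[OF G(2)])
      show "norm (c + G v \<phi>) \<le> \<bar>c\<bar> + 2 * pi * M" for \<phi> using G_bound[OF that, of \<phi>] by simp
    qed
    then show ?thesis by (simp add: T_def Bcontfun_inverse)
  qed
  have "\<exists>!v\<in>S. T v = v"
  proof (rule Banach_fix[OF S _ _ L(2)])
    show "S \<noteq> {}" by (rule ex_in_conv[THEN iffD1], rule exI[of _ "const_bcontfun 0"]) (simp add: S_def)
    show "0 \<le> 2 * pi * L" using L by simp
    show "T ` S \<subseteq> S"
    proof
      fix w assume "w \<in> T ` S"
      then obtain v where v: "v \<in> S" "w = T v" by blast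
      then show "w \<in> S" using G_refl[OF v(1)] G_per[OF v(1)] by (simp add: S_def T per_def)
    qed
    show "dist (T v) (T w) \<le> 2 * pi * L * dist v w" if "v \<in> S" "w \<in> S" for v w
    proof (rule dist_bound)
      fix \<phi>
      have "\<bar>(G v \<phi> - G w \<phi>) - (G v \<phi>0 - G w \<phi>0)\<bar> \<le> 2 * pi * (L * dist v w)"
      proof (rule per_increment_bound[where G = "\<lambda>\<phi>. G v \<phi> - G w \<phi>"])
        show "per (\<lambda>\<phi>. G v \<phi> - G w \<phi>)" using G_per that by (simp add: per_def)
        show "((\<lambda>\<phi>. G v \<phi> - G w \<phi>) has_real_derivative
            qspeed \<phi> * (f \<phi> (apply_bcontfun v \<phi>) - f \<phi> (apply_bcontfun w \<phi>))) (at \<phi>)" for \<phi>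
          by (rule tderD[OF tder_diff[OF G(2) G(2)]])
        show "\<bar>qspeed \<phi> * (f \<phi> (apply_bcontfun v \<phi>) - f \<phi> (apply_bcontfun w \<phi>))\<bar> \<le> L * dist v w" for \<phi>
        proof -
          have "\<bar>qspeed \<phi> * (f \<phi> (apply_bcontfun v \<phi>) - f \<phi> (apply_bcontfun w \<phi>))\<bar>
              \<le> L * \<bar>apply_bcontfun v \<phi> - apply_bcontfun w \<phi>\<bar>"
            using lip qspeed_pos[of \<phi>] by (simp add: abs_mult less_imp_le)
          also have "\<dots> \<le> L * dist v w" using dist_bounded[of v \<phi> w] L by (intro mult_left_mono) (simp_all add: dist_real_def)
          finally show ?thesis .
        qed
      qed
      then show "dist (apply_bcontfun (T v) \<phi>) (apply_bcontfun (T w) \<phi>) \<le> 2 * pi * L * dist v w"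
        using that by (simp add: T G(1) dist_real_def)
    qed
  qed
  then obtain v where v: "v \<in> S" "T v = v" by blast
  then have eq: "apply_bcontfun v = (\<lambda>\<phi>. c + G v \<phi>)" using T by metis
  show thesis
  proof (rule that[of "apply_bcontfun v"])
    show "tder (apply_bcontfun v) (\<lambda>\<phi>. f \<phi> (apply_bcontfun v \<phi>))"
    proof -
      have "tder (\<lambda>\<phi>. c + G v \<phi>) (\<lambda>\<phi>. f \<phi> (apply_bcontfun v \<phi>))"
        by (rule tder_cong[OF tder_add[OF tder_const G(2)]]) simp
      then show ?thesis using eq by metis
    qed
    show "per (apply_bcontfun v)" using v(1) by (simp add: S_def per_def)
    show "apply_bcontfun v \<phi>0 = c" unfolding eq by (simp add: G)
    show "\<bar>apply_bcontfun v \<phi> - c\<bar> \<le> 2 * pi * M" for \<phi> unfolding eq using G_bound[OF v(1)] by simp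
  qed
qed

context qh_field
begin

section \<open>The radial equation in the variable 1/r\<close>

lemma obtain_radius:
  assumes "b > 0"
  obtains r1 where "0 < r1" "r1 \<le> b" "\<And>\<phi>. 4 * r1 * \<bar>Q \<phi>\<bar> \<le> 1"
proof -
  obtain K where K: "K > 0" "\<And>\<phi>. \<bar>Q \<phi>\<bar> \<le> K" using per_bounded[OF per_PQ(2) continuous_PQ(2)] by blast
  show thesis
  proof (rule that[of "min b (1 / (4 * K))"])
    fix \<phi>
    have "4 * min b (1 / (4 * K)) * \<bar>Q \<phi>\<bar> \<le> 4 * (1 / (4 * K)) * K"
      using K \<open>b > 0\<close> by (intro mult_mono) auto
    then show "4 * min b (1 / (4 * K)) * \<bar>Q \<phi>\<bar> \<le> 1" using K by simp
  qed (use K \<open>b > 0\<close> in auto)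
qed

text \<open>For u = 1/r the equation becomes u' = - P u / (u + Q). Small orbits correspond to large
  u, where the right-hand side is bounded and its Lipschitz constant in u tends to 0.\<close>

lemma polar_orbit_inverse:
  assumes v: "tder v (\<lambda>\<phi>. - P \<phi> * v \<phi> / (v \<phi> + Q \<phi>))" "per v" "\<And>\<phi>. v \<phi> \<ge> 1 / r1"
    and r1: "r1 > 0" "\<And>\<phi>. 4 * r1 * \<bar>Q \<phi>\<bar> \<le> 1"
  shows "polar_orbit r1 (\<lambda>\<phi>. 1 / v \<phi>)"
proof -
  have pos: "v \<phi> > 0" for \<phi> using v(3)[of \<phi>] r1(1) by (smt (verit) zero_less_divide_1_iff)
  have vQ: "v \<phi> + Q \<phi> > 0" for \<phi>
  proof -
    define u where "u = 1 / r1"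
    have "4 * \<bar>Q \<phi>\<bar> \<le> u" using r1(2)[of \<phi>] r1(1) by (simp add: u_def field_simps)
    moreover have "u > 0" "u \<le> v \<phi>" using r1(1) v(3)[of \<phi>] by (simp_all add: u_def)
    ultimately show ?thesis by linarith
  qed
  have "tder (\<lambda>\<phi>. 1 / v \<phi>) (\<lambda>\<phi>. (1 / v \<phi>) ^ 2 * P \<phi> / (1 + 1 / v \<phi> * Q \<phi>))"
    unfolding tder_def
  proof
    fix \<phi>
    have "((\<lambda>\<phi>. 1 / v \<phi>) has_real_derivative - (qspeed \<phi> * (- P \<phi> * v \<phi> / (v \<phi> + Q \<phi>))) / (v \<phi>)^2) (at \<phi>)"
      using pos[of \<phi>] by (auto intro!: derivative_eq_intros tderD[OF v(1)] simp: power2_eq_square)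
    moreover have "- (qspeed \<phi> * (- P \<phi> * v \<phi> / (v \<phi> + Q \<phi>))) / (v \<phi>)^2
        = qspeed \<phi> * ((1 / v \<phi>) ^ 2 * P \<phi> / (1 + 1 / v \<phi> * Q \<phi>))"
    proof -
      have "1 + 1 / v \<phi> * Q \<phi> = (v \<phi> + Q \<phi>) / v \<phi>" using pos[of \<phi>] by (simp add: field_simps)
      then show ?thesis using pos[of \<phi>] vQ[of \<phi>] by (simp add: power2_eq_square)
    qed
    ultimately show "((\<lambda>\<phi>. 1 / v \<phi>) has_real_derivative qspeed \<phi> * ((1 / v \<phi>) ^ 2 * P \<phi> / (1 + 1 / v \<phi> * Q \<phi>))) (at \<phi>)"
      by simp
  qed
  moreover have "per (\<lambda>\<phi>. 1 / v \<phi>)" using v(2) by (simp add: per_def)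
  moreover have "0 < 1 / v \<phi> \<and> 1 / v \<phi> \<le> r1" for \<phi>
    using pos[of \<phi>] v(3)[of \<phi>] r1(1) by (simp add: field_simps)
  ultimately show ?thesis unfolding polar_orbit_def by blast
qed

lemma center_if_reversible:
  assumes "a50 = 0" "b41 = 0"
  shows "center_at_origin F"
proof -
  have P_refl: "P (pi - \<phi>) = - P \<phi>" and Q_refl: "Q (pi - \<phi>) = Q \<phi>" for \<phi>
    unfolding P_def Q_def X_def Y_def unfolding assms by (simp_all add: field_simps)
  have "per (\<lambda>\<phi>. qspeed \<phi> * P \<phi>)" using per_PQ by (simp add: per_def)
  moreover have "continuous_on UNIV (\<lambda>\<phi>. qspeed \<phi> * P \<phi>)"
    by (intro continuous_intros continuous_qtrig continuous_PQ)
  ultimately obtain K where K: "K > 0" "\<And>\<phi>. \<bar>qspeed \<phi> * P \<phi>\<bar> \<le> K"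
    using per_bounded by blast
  \<comment> \<open>With Lipschitz constant K r1 this makes 2 pi L at most 1/2, as the contraction
    requires.\<close>
  obtain r1 where r1: "0 < r1" "r1 \<le> 1 / (4 * pi * K)" "\<And>\<phi>. 4 * r1 * \<bar>Q \<phi>\<bar> \<le> 1"
    by (rule obtain_radius[of "1 / (4 * pi * K)"]) (use K pi_gt_zero in auto)
  define u1 where "u1 = 1 / r1"
  have u1: "u1 > 0" "\<bar>Q \<phi>\<bar> \<le> u1 / 4" for \<phi> using r1(1) r1(3)[of \<phi>] by (simp_all add: u1_def field_simps)
  \<comment> \<open>Cutting off at u1 = 1/r1 makes the right-hand side bounded and Lipschitz for all
    x, as the fixed point argument requires.\<close>
  define f where "f = (\<lambda>\<phi> x. - P \<phi> * (max x u1 / (max x u1 + Q \<phi>)))"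
  have den: "max x u1 + Q \<phi> \<ge> 3 / 4 * max x u1" "max x u1 + Q \<phi> > 0" for x \<phi> using u1(1) u1(2)[of \<phi>] by linarith+
  have quot: "\<bar>max x u1 / (max x u1 + Q \<phi>)\<bar> \<le> 2" for x \<phi>
  proof -
    define y where "y = max x u1"
    have "0 < y" "0 < y + Q \<phi>" "y \<le> 2 * (y + Q \<phi>)"
      using den[of x \<phi>] u1(1) unfolding y_def[symmetric] by (auto simp: y_def)
    then show ?thesis unfolding y_def[symmetric] by (simp add: abs_divide pos_divide_le_eq)
  qed
  \<comment> \<open>The solution stays within 2 pi (2 K) of its initial value 1/r, so for r <
    \<epsilon> it never enters the cut-off region.\<close>
  define \<epsilon> where "\<epsilon> = 1 / (u1 + 2 * pi * (2 * K))"
  have \<epsilon>: "\<epsilon> > 0" using u1(1) K(1) pi_gt_zero by (auto simp: \<epsilon>_def intro!: add_pos_pos)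
  show ?thesis
  proof (rule center_if_polar_orbits[OF r1(1,3) \<epsilon>])
    fix \<phi>0 r :: real assume r: "0 < r" "r < \<epsilon>"
    have "\<exists>v. tder v (\<lambda>\<phi>. f \<phi> (v \<phi>)) \<and> per v \<and> v \<phi>0 = 1 / r \<and> (\<forall>\<phi>. \<bar>v \<phi> - 1 / r\<bar> \<le> 2 * pi * (2 * K))"
    proof (rule symmetric_periodic_solution[of f "K * r1" "2 * K" \<phi>0 "1 / r"])
      show "continuous_on UNIV (\<lambda>\<phi>. f \<phi> (v \<phi>))" if "continuous_on UNIV v" for v
        unfolding f_def using den by (intro continuous_intros continuous_PQ that) (auto simp: less_imp_neq[symmetric])
      show "f (\<phi> + 2 * pi) x = f \<phi> x" for \<phi> x using per_PQ by (simp add: f_def per_def)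
      show "f (pi - \<phi>) x = - f \<phi> x" for \<phi> x by (simp add: f_def P_refl Q_refl)
      show "qspeed \<phi> * \<bar>f \<phi> x - f \<phi> y\<bar> \<le> K * r1 * \<bar>x - y\<bar>" for \<phi> x y
      proof -
        let ?x = "max x u1" and ?y = "max y u1"
        have d: "?x + Q \<phi> > 0" "?y + Q \<phi> > 0" using den(2) by auto
        have "f \<phi> x - f \<phi> y = - P \<phi> * (?x / (?x + Q \<phi>) - ?y / (?y + Q \<phi>))"
          by (simp add: f_def algebra_simps)
        also have "?x / (?x + Q \<phi>) - ?y / (?y + Q \<phi>) = Q \<phi> * (?x - ?y) / ((?x + Q \<phi>) * (?y + Q \<phi>))"
          using d by (simp add: field_simps)
        finally have e: "qspeed \<phi> * \<bar>f \<phi> x - f \<phi> y\<bar> = \<bar>qspeed \<phi> * P \<phi>\<bar> * (\<bar>Q \<phi>\<bar> / ((?x + Q \<phi>) * (?y + Q \<phi>)) * \<bar>?x - ?y\<bar>)"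
          using d qspeed_pos[of \<phi>] by (simp add: abs_mult abs_divide)
        have "3 / 4 * u1 \<le> ?x + Q \<phi>" "3 / 4 * u1 \<le> ?y + Q \<phi>" using den(1)[of x \<phi>] den(1)[of y \<phi>] by linarith+
        then have "(3 / 4 * u1) * (3 / 4 * u1) \<le> (?x + Q \<phi>) * (?y + Q \<phi>)" using u1(1) by (intro mult_mono) auto
        then have "\<bar>Q \<phi>\<bar> / ((?x + Q \<phi>) * (?y + Q \<phi>)) \<le> (u1 / 4) / ((3 / 4 * u1) * (3 / 4 * u1))"
          using u1 by (intro frac_le) auto
        also have "\<dots> = 4 / 9 * r1" using r1(1) by (simp add: u1_def field_simps)
        also have "\<dots> \<le> r1" using r1(1) by simp
        finally have "\<bar>Q \<phi>\<bar> / ((?x + Q \<phi>) * (?y + Q \<phi>)) * \<bar>?x - ?y\<bar> \<le> r1 * \<bar>x - y\<bar>"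
          using r1(1) by (intro mult_mono) (auto simp: max_def)
        then have "\<bar>qspeed \<phi> * P \<phi>\<bar> * (\<bar>Q \<phi>\<bar> / ((?x + Q \<phi>) * (?y + Q \<phi>)) * \<bar>?x - ?y\<bar>) \<le> K * (r1 * \<bar>x - y\<bar>)"
          by (rule mult_mono[OF K(2)]) (use K(1) d in auto)
        then show ?thesis unfolding e by simp
      qed
      show "0 \<le> K * r1" using K r1 by simp
      have "2 * pi * (K * r1) \<le> 2 * pi * (K * (1 / (4 * pi * K)))" using K r1 pi_gt_zero by (intro mult_left_mono) auto
      also have "\<dots> = 1 / 2" using K pi_gt_zero by simp
      finally show "2 * pi * (K * r1) < 1" by simp
      show "qspeed \<phi> * \<bar>f \<phi> x\<bar> \<le> 2 * K" for \<phi> x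
      proof -
        have "qspeed \<phi> * \<bar>f \<phi> x\<bar> = \<bar>qspeed \<phi> * P \<phi>\<bar> * \<bar>max x u1 / (max x u1 + Q \<phi>)\<bar>"
          using qspeed_pos[of \<phi>] by (simp add: f_def abs_mult)
        also have "\<dots> \<le> K * 2" by (rule mult_mono[OF K(2) quot]) (use K(1) in auto)
        finally show ?thesis by simp
      qed
    qed blast
    then obtain v where v: "tder v (\<lambda>\<phi>. f \<phi> (v \<phi>))" "per v" "v \<phi>0 = 1 / r" "\<And>\<phi>. \<bar>v \<phi> - 1 / r\<bar> \<le> 2 * pi * (2 * K)"
      by blast
    have "1 / \<epsilon> < 1 / r" using r by (intro divide_strict_left_mono) auto
    then have ur: "u1 + 2 * pi * (2 * K) \<le> 1 / r" by (simp add: \<epsilon>_def)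
    have vu: "v \<phi> \<ge> u1" for \<phi> using v(4)[of \<phi>] ur by linarith
    have "tder v (\<lambda>\<phi>. - P \<phi> * v \<phi> / (v \<phi> + Q \<phi>))"
      by (rule tder_cong[OF v(1)]) (simp add: f_def max_absorb1 vu)
    then have "polar_orbit r1 (\<lambda>\<phi>. 1 / v \<phi>)"
      by (rule polar_orbit_inverse[OF _ v(2) vu[unfolded u1_def] r1(1,3)])
    then show "\<exists>R. polar_orbit r1 R \<and> R \<phi>0 = r" using v(3) by (intro exI[of _ "\<lambda>\<phi>. 1 / v \<phi>"]) simp
  qed
qed

text \<open>Here \<open>u = 1 / r\<close> along a level set of the Hamiltonian satisfies
  \<open>u + 12/13 Q = h u\<^sup>1\<^sup>3\<close>, which is linear in \<open>Q\<close>, so \<open>u\<close> is a function of \<open>Q(\<phi>)\<close>.\<close>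

lemma center_if_hamiltonian:
  assumes div0: "5 * a50 + b41 = 0" and "\<delta> = 0"
  shows "center_at_origin F"
proof -
  have P: "P \<phi> = - Q' \<phi> / 13" for \<phi> using P_alt[OF div0, of \<phi>] \<open>\<delta> = 0\<close> by simp
  obtain r1 where r1: "0 < r1" "r1 \<le> 1" "\<And>\<phi>. 4 * r1 * \<bar>Q \<phi>\<bar> \<le> 1" by (rule obtain_radius[of 1]) auto
  define U where "U = 1 / r1"
  have U: "U > 0" "4 * \<bar>Q \<phi>\<bar> \<le> U" for \<phi> using r1(1) r1(3)[of \<phi>] by (simp_all add: U_def field_simps)
  show ?thesis
  proof (rule center_if_polar_orbits[OF r1(1,3), of "r1 / 2"])
    show "r1 / 2 > 0" using r1 by simp
    fix \<phi>0 r :: real assume r: "0 < r" "r < r1 / 2"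
    define u0 where "u0 = 1 / r"
    have u0: "u0 > 2 * U"
      using r r1(1) by (simp add: u0_def U_def field_simps)
    \<comment> \<open>The value of the Hamiltonian, in suitable normalization, on the level set
      through the starting point.\<close>
    define h where "h = (u0 + 12 / 13 * Q \<phi>0) / u0 ^ 13"
    have hu0: "h * u0 ^ 13 = u0 + 12 / 13 * Q \<phi>0" using u0 U(1) by (simp add: h_def)
    have Q0: "- (u0 / 8) \<le> Q \<phi>0" "Q \<phi>0 \<le> u0 / 8" using U(2)[of \<phi>0] u0 by linarith+
    then have num: "u0 / 2 < u0 + 12 / 13 * Q \<phi>0" "u0 + 12 / 13 * Q \<phi>0 < 2 * u0" using u0 U(1) by linarith+
    have h: "h > 0" unfolding h_def using num u0 U(1) by (intro divide_pos_pos) auto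
    have "u0 * (h * u0 ^ 12) = u0 + 12 / 13 * Q \<phi>0" using hu0 by algebra
    then have h12: "1 / 2 < h * u0 ^ 12" "h * u0 ^ 12 < 2"
    proof -
      assume e: "u0 * (h * u0 ^ 12) = u0 + 12 / 13 * Q \<phi>0"
      have "u0 * (1 / 2) < u0 * (h * u0 ^ 12)" "u0 * (h * u0 ^ 12) < u0 * 2" unfolding e using num by simp_all
      then show "1 / 2 < h * u0 ^ 12" "h * u0 ^ 12 < 2" using u0 U(1) by auto
    qed
    \<comment> \<open>A point safely beyond the critical point 13 h u^12 = 1 of \<Phi>, so \<Phi>
      increases from there on. The bounds 1/2 < h u0^12 < 2 together with u0 > 2 U place it between
      U and u0.\<close>
    define us where "us = root 12 (1 / (2 * h))"
    have us: "us > 0" "h * us ^ 12 = 1 / 2" using h by (simp_all add: us_def)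
    have us_le: "us < u0"
    proof (rule power_less_imp_less_base[of _ 12])
      show "us ^ 12 < u0 ^ 12" using us(2) h12(1) h by (metis mult_less_cancel_left_pos)
    qed (use u0 U(1) in auto)
    have us_ge: "U < us"
    proof (rule power_less_imp_less_base[of _ 12])
      have "2 ^ 12 * U ^ 12 < u0 ^ 12" unfolding power_mult_distrib[symmetric] using u0 U(1) by (intro power_strict_mono) auto
      then have "h * (2 ^ 12 * U ^ 12) < 2" using h h12(2) by (smt (verit) mult_less_cancel_left_pos)
      then have "h * U ^ 12 < h * us ^ 12" unfolding us(2) by simp
      then show "U ^ 12 < us ^ 12" using h by simp
    qed (use us in auto)
    define \<Phi> where "\<Phi> = (\<lambda>u. 13 / 12 * (h * u ^ 13 - u))"
    have \<Phi>': "(\<Phi> has_real_derivative 13 / 12 * (13 * h * u ^ 12 - 1)) (at u)" for u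
      unfolding \<Phi>_def by (auto intro!: derivative_eq_intros)
    have \<Phi>'_pos: "13 / 12 * (13 * h * u ^ 12 - 1) > 0" if "us \<le> u" for u
    proof -
      have "h * us ^ 12 \<le> h * u ^ 12" using that us h by (intro mult_left_mono power_mono) auto
      then show ?thesis using us(2) by simp
    qed
    have mono: "\<Phi> x < \<Phi> y" if "us \<le> x" "x < y" for x y
    proof (rule DERIV_pos_imp_increasing[OF that(2)])
      fix t assume "x \<le> t" "t \<le> y"
      then show "\<exists>d. (\<Phi> has_real_derivative d) (at t) \<and> 0 < d" using \<Phi>'[of t] \<Phi>'_pos[of t] that by force
    qed
    have "us * (h * us ^ 12) = us / 2" unfolding us(2) by simp
    then have \<Phi>s: "\<Phi> us = - (13 / 24) * us" unfolding \<Phi>_def by (simp add: algebra_simps flip: power_Suc2) algebra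
    \<comment> \<open>\<Phi> at \<open>us\<close> is -13/24 us, while Q is at least -U/4 > -us/4. So
      all values of Q lie in the range of the increasing branch.\<close>
    have low: "\<Phi> us < Q \<phi>" for \<phi> using U(2)[of \<phi>] us_ge U(1) unfolding \<Phi>s by linarith
    have surj: "\<exists>u. us < u \<and> \<Phi> u = q" if q: "\<Phi> us < q" for q
    proof -
      define b where "b = max (2 * us) \<bar>q\<bar>"
      have b: "2 * us \<le> b" "q \<le> b" by (auto simp: b_def)
      have "h * (2 * us) ^ 12 \<le> h * b ^ 12" using b us h by (intro mult_left_mono power_mono) auto
      moreover have "h * (2 * us) ^ 12 = 2 ^ 12 * (h * us ^ 12)" by algebra
      ultimately have "2 \<le> h * b ^ 12" using us(2) by simp
      define w where "w = b * (h * b ^ 12)"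
      have "b * 2 \<le> w" unfolding w_def using \<open>2 \<le> h * b ^ 12\<close> b us(1) by (intro mult_left_mono) auto
      moreover have "\<Phi> b = 13 / 12 * w - 13 / 12 * b" unfolding \<Phi>_def w_def by algebra
      ultimately have "q \<le> \<Phi> b" using b us(1) by linarith
      moreover have "continuous_on {us..b} \<Phi>"
        by (intro continuous_at_imp_continuous_on ballI DERIV_isCont[OF \<Phi>'])
      ultimately have "\<exists>u\<ge>us. u \<le> b \<and> \<Phi> u = q" using q b us(1) by (intro IVT') auto
      then obtain u where "us \<le> u" "\<Phi> u = q" by blast
      with q show ?thesis by (intro exI[of _ u]) (auto simp: less_le)
    qed
    define \<psi> where "\<psi> = (\<lambda>q. SOME u. us < u \<and> \<Phi> u = q)"
    have \<psi>: "us < \<psi> q" "\<Phi> (\<psi> q) = q" if "\<Phi> us < q" for q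
      unfolding \<psi>_def using someI_ex[OF surj[OF that]] by auto
    have \<psi>_inv: "\<psi> (\<Phi> u) = u" if "us < u" for u
    proof -
      have "\<Phi> us < \<Phi> u" by (rule mono) (use that in auto)
      note * = \<psi>[OF this]
      show ?thesis using mono[of u "\<psi> (\<Phi> u)"] mono[of "\<psi> (\<Phi> u)" u] * that
        by (cases u "\<psi> (\<Phi> u)" rule: linorder_cases) auto
    qed
    have \<psi>': "(\<psi> has_real_derivative inverse (13 / 12 * (13 * h * \<psi> q ^ 12 - 1))) (at q)" if q: "\<Phi> us < q" for q
    proof (rule DERIV_inverse_function[where f = \<Phi> and g = \<psi> and x = q and a = "\<Phi> us" and b = "q + 1", OF \<Phi>'])
      show "13 / 12 * (13 * h * \<psi> q ^ 12 - 1) \<noteq> 0" using \<Phi>'_pos[of "\<psi> q"] \<psi>(1)[OF q] by simp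
      have "isCont \<psi> (\<Phi> (\<psi> q))"
      proof (rule isCont_inverse_function[where d = "(\<psi> q - us) / 2" and x = "\<psi> q" and f = \<Phi> and g = \<psi>])
        show "(\<psi> q - us) / 2 > 0" using \<psi>(1)[OF q] by simp
        show "\<psi> (\<Phi> u) = u" if "\<bar>u - \<psi> q\<bar> \<le> (\<psi> q - us) / 2" for u
        proof (rule \<psi>_inv)
          define e where "e = \<psi> q - us"
          have "e > 0" "\<bar>u - \<psi> q\<bar> \<le> e / 2" "\<psi> q = us + e" using that \<psi>(1)[OF q] by (simp_all add: e_def)
          then show "us < u" by linarith
        qed
      qed (rule DERIV_isCont[OF \<Phi>'])
      then show "isCont \<psi> q" by (simp add: \<psi>(2)[OF q])
    qed (use q \<psi> in auto)
    define v where "v = (\<lambda>\<phi>. \<psi> (Q \<phi>))"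
    have v: "us < v \<phi>" "\<Phi> (v \<phi>) = Q \<phi>" for \<phi> using \<psi>[OF low] by (simp_all add: v_def)
    have "polar_orbit r1 (\<lambda>\<phi>. 1 / v \<phi>)"
    proof (rule polar_orbit_inverse[OF _ _ _ r1(1,3)])
      show "per v" using per_PQ(2) by (simp add: per_def v_def)
      show "1 / r1 \<le> v \<phi>" for \<phi> using v(1)[of \<phi>] us_ge by (simp add: U_def)
      show "tder v (\<lambda>\<phi>. - P \<phi> * v \<phi> / (v \<phi> + Q \<phi>))"
        unfolding tder_def
      proof
        fix \<phi>
        have vpos: "v \<phi> > 0" using v(1)[of \<phi>] us(1) by linarith
        have vQ: "v \<phi> + Q \<phi> > 0" using U(2)[of \<phi>] v(1)[of \<phi>] us_ge U(1) by linarith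
        have "13 / 12 * (h * v \<phi> ^ 13 - v \<phi>) = Q \<phi>" using v(2)[of \<phi>] by (simp add: \<Phi>_def)
        then have e13: "13 * (h * v \<phi> ^ 13) = 13 * v \<phi> + 12 * Q \<phi>" by (simp add: field_simps)
        have "v \<phi> * (13 / 12 * (13 * h * v \<phi> ^ 12 - 1)) = 13 / 12 * (13 * (h * v \<phi> ^ 13) - v \<phi>)" by algebra
        also have "\<dots> = 13 * (v \<phi> + Q \<phi>)" unfolding e13 by (simp add: field_simps)
        finally have "13 / 12 * (13 * h * v \<phi> ^ 12 - 1) = 13 * (v \<phi> + Q \<phi>) / v \<phi>"
          using vpos by (metis less_irrefl nonzero_mult_div_cancel_left)
        then have i: "inverse (13 / 12 * (13 * h * v \<phi> ^ 12 - 1)) = v \<phi> / (13 * (v \<phi> + Q \<phi>))"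
          by (simp only: inverse_divide)
        have "(v has_real_derivative inverse (13 / 12 * (13 * h * v \<phi> ^ 12 - 1)) * (qspeed \<phi> * Q' \<phi>)) (at \<phi>)"
          unfolding v_def by (rule DERIV_chain2[OF \<psi>'[OF low] tderD[OF tder_Q[OF div0]]])
        then show "(v has_real_derivative qspeed \<phi> * (- P \<phi> * v \<phi> / (v \<phi> + Q \<phi>))) (at \<phi>)"
          unfolding i P by (simp add: mult_ac)
      qed
    qed
    moreover have "1 / v \<phi>0 = r"
    proof -
      have "\<Phi> u0 = Q \<phi>0" using hu0 by (simp add: \<Phi>_def)
      then have "v \<phi>0 = u0" using \<psi>_inv[OF us_le] by (simp add: v_def)
      then show ?thesis by (simp add: u0_def)
    qed
    ultimately show "\<exists>R. polar_orbit r1 R \<and> R \<phi>0 = r" by blast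
  qed
qed

end

theorem theorem4p2:
  fixes a22 a50 b13 b41 :: real
  shows "center_at_origin (planar_field a22 a50 b13 b41) \<longleftrightarrow>
    (a50 = - (1 / 5) * b41 \<and> a22 = - (3 / 2) * b13) \<or>
    (a50 = - (1 / 5) * b41 \<and> b41 = 0)"
proof -
  interpret qh_field a22 a50 b13 b41 .
  show ?thesis
  proof
    assume center: "center_at_origin (planar_field a22 a50 b13 b41)"
    then have div0: "5 * a50 + b41 = 0" using not_center_order0 by blast
    have "a22 = - (3 / 2) * b13" if "b41 \<noteq> 0"
    proof (rule ccontr)
      assume "a22 \<noteq> - (3 / 2) * b13"
      then have \<delta>: "\<delta> \<noteq> 0" by (simp add: \<delta>_def field_simps)
      have B: "B \<noteq> 0" using that by (simp add: B_def)
      have "3 * \<delta> / 14 - 27 * \<beta> / 13 = 0" using not_center_order2[OF div0 B \<delta>] center by blast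
      \<comment> \<open>This is the only line that order 2 leaves open; on it \<delta> \<noteq> 0
        forces \<beta> \<noteq> 0, as order 4 requires.\<close>
      then have e: "\<delta> = 126 / 13 * \<beta>" by (simp add: field_simps)
      with \<delta> have "\<beta> \<noteq> 0" by auto
      then show False using not_center_order4[OF div0 B _ e] center by blast
    qed
    then show "(a50 = - (1 / 5) * b41 \<and> a22 = - (3 / 2) * b13) \<or> (a50 = - (1 / 5) * b41 \<and> b41 = 0)"
      using div0 by auto
  next
    assume "(a50 = - (1 / 5) * b41 \<and> a22 = - (3 / 2) * b13) \<or> (a50 = - (1 / 5) * b41 \<and> b41 = 0)"
    then consider "5 * a50 + b41 = 0" "\<delta> = 0" | "a50 = 0" "b41 = 0" by (auto simp: \<delta>_def)
    then show "center_at_origin (planar_field a22 a50 b13 b41)"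
      using center_if_hamiltonian center_if_reversible by cases auto
  qed
qed

end
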